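(* Let $(M,F)$ be a Landsberg space with constant flag curvature and dimension greater than $2$, which satisfies (for all indices, in all natural coordinates on $TM\setminus 0$) $$\frac{\partial R^i_{kl}}{\partial y^m}\dot A^m_{hp}+R^m_{kl}\Gamma^i_{mph}-R^i_{ml}\Gamma^m_{kph}-R^i_{km}\Gamma^m_{lph}=0.$$ Then $(M,F)$ is symmetric.
   Context: Let $M$ be an $n$-dimensional smooth manifold. Local coordinates $(x^i)$ on $M$ induce natural coordinates $(x^i,y^i)$ on $TM$ via $y=y^i\frac{\partial}{\partial x^i}$. Repeated indices are summed. A Finsler structure is a function $F:TM\to[0,\infty)$ that is differentiable (smooth) away from the zero section, satisfies $F(x,\lambda y)=\lambda F(x,y)$ for all $\lambda>0$, and such that the matrix $g_{ij}=\frac12\frac{\partial^2F^2}{\partial y^i\partial y^j}$ is positive-definite at every point of $TM\setminus 0$; $(g^{ij})$ is its inverse. $(M,F)$ is called a Finsler space (Finsler manifold). All tensors below live on $TM\setminus 0$; their indices refer to the pulled-back bundle $\pi^*TM$ and its dual, where $\pi:TM\setminus 0\to M$. Put $N^i_m=\frac14\frac{\partial}{\partial y^m}\Big(g^{is}\big(\frac{\partial g_{sk}}{\partial x^j}+\frac{\partial g_{sj}}{\partial x^k}-\frac{\partial g_{kj}}{\partial x^s}\big)y^jy^k\Big)$ and $\frac{\delta}{\delta x^i}=\frac{\partial}{\partial x^i}-N^m_i\frac{\partial}{\partial y^m}$. The Chern connection $\nabla$ has coefficients $\Gamma^i_{jk}=\frac{g^{is}}2\big(\frac{\delta g_{sj}}{\delta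 x^k}-\frac{\delta g_{jk}}{\delta x^s}+\frac{\delta g_{ks}}{\delta x^j}\big)$. $\nabla_h$, also written as a subscript $|h$, denotes the horizontal covariant derivative along $\frac{\delta}{\delta x^h}$: e.g. $\nabla_hT^i_j=T^i_{j|h}=\frac{\delta T^i_j}{\delta x^h}+T^m_j\Gamma^i_{mh}-T^i_m\Gamma^m_{jh}$, and similarly for other tensor types (one term per index). Notation: $\Gamma^i_{mph}=\frac{\partial}{\partial y^h}\Gamma^i_{mp}$. The hh-curvature is $R^i_{jkl}=\frac{\delta\Gamma^i_{jl}}{\delta x^k}-\frac{\delta\Gamma^i_{jk}}{\delta x^l}+\Gamma^i_{hk}\Gamma^h_{jl}-\Gamma^i_{hl}\Gamma^h_{jk}$. With $\ell^i=y^i/F$, put $R^i_{kl}=\ell^jR^i_{jkl}$. The Cartan tensor is $A_{ijk}=\frac F2\frac{\partial g_{ij}}{\partial y^k}$, $A^i_{jk}=g^{is}A_{sjk}$, and $\dot A_{ijk}=A_{ijk|s}\ell^s$, $\dot A^i_{jk}=A^i_{jk|s}\ell^s$. Flag curvature: a nowhere zero vector field $X$ on an open set $O\subset M$ determines the Riemannian metric $g_{ij}(x,X(x))\,dx^i\otimes dx^j$ on $O$; $X$ is a geodesic vector field if its integral curves are geodesics of $F$. For a nonzero $v_m\in T_mM$ and a two-dimensional subspace $P\subset T_mM$ containing $v_m$, take a geodesic vector field $X$ on a neighborhood of $m$ with $X(m)=v_m$; the flag curvature of $M$ at the flag $(P,v_m)$ is the sectional curvature at the plane $P$ of the Riemannian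 metric associated to $X$. Constant flag curvature means that this number is the same constant $\lambda$ for all flags at all points. A Landsberg space is a Finsler space with $\dot A_{ijk}=0$ identically. A Finsler space is called symmetric if $\nabla_{\delta/\delta x^l}R^i_{jkh}=0$ identically on $TM\setminus 0$ for all indices. *)

theory Defs
  imports "HOL-Analysis.Analysis"
begin

section \<open>Smooth maps between open subsets of normed spaces\<close>

primrec Ck_on :: "nat \<Rightarrow> 'a::real_normed_vector set \<Rightarrow> ('a \<Rightarrow> 'b::real_normed_vector) \<Rightarrow> bool"
  where
    "Ck_on 0 S f \<longleftrightarrow> continuous_on S f"
  | "Ck_on (Suc k) S f \<longleftrightarrow>
       (\<forall>x\<in>S. f differentiable (at x)) \<and> (\<forall>v. Ck_on k S (\<lambda>x. frechet_derivative f (at x) v))"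

text \<open>Only meant for open \<open>S\<close>, because the derivatives are full derivatives \<open>at x\<close>.\<close>

definition smooth_on :: "'a::real_normed_vector set \<Rightarrow> ('a \<Rightarrow> 'b::real_normed_vector) \<Rightarrow> bool"
  where "smooth_on S f \<longleftrightarrow> (\<forall>k. Ck_on k S f)"


section \<open>Smooth manifolds and their tangent bundles\<close>

text \<open>A chart is a pair of its domain and its coordinate map; the values of the coordinate map
  outside the domain are irrelevant. The manifold is the type \<open>'a\<close> with a maximal atlas.\<close>

type_synonym ('a, 'n) chart = "'a set \<times> ('a \<Rightarrow> real ^ 'n)"

abbreviation dom_of :: "('a, 'n) chart \<Rightarrow> 'a set" where "dom_of \<equiv> fst"

abbreviation coord :: "('a, 'n) chart \<Rightarrow> 'a \<Rightarrow> real ^ 'n" where "coord \<equiv> snd"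

abbreviation region :: "('a, 'n) chart \<Rightarrow> (real ^ 'n) set"
  where "region c \<equiv> coord c ` dom_of c"

definition coord_inv :: "('a, 'n) chart \<Rightarrow> real ^ 'n \<Rightarrow> 'a"
  where "coord_inv c = inv_into (dom_of c) (coord c)"

definition is_chart :: "('a::topological_space, 'n::finite) chart \<Rightarrow> bool"
  where "is_chart c \<longleftrightarrow>
    open (dom_of c) \<and> open (region c) \<and>
    homeomorphism (dom_of c) (region c) (coord c) (coord_inv c)"

definition transition :: "('a, 'n) chart \<Rightarrow> ('a, 'n) chart \<Rightarrow> real ^ 'n \<Rightarrow> real ^ 'n"
  where "transition c d = coord d \<circ> coord_inv c"

definition compatible :: "('a, 'n::finite) chart \<Rightarrow> ('a, 'n) chart \<Rightarrow> bool"
  where "compatible c d \<longleftrightarrow>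
    smooth_on (coord c ` (dom_of c \<inter> dom_of d)) (transition c d) \<and>
    smooth_on (coord d ` (dom_of c \<inter> dom_of d)) (transition d c)"

definition smooth_structure :: "('a::topological_space, 'n::finite) chart set \<Rightarrow> bool"
  where "smooth_structure A \<longleftrightarrow>
    (\<forall>c\<in>A. is_chart c) \<and> (\<Union>c\<in>A. dom_of c) = UNIV \<and>
    (\<forall>c\<in>A. \<forall>d\<in>A. compatible c d) \<and>
    (\<forall>c. is_chart c \<and> (\<forall>d\<in>A. compatible c d) \<longrightarrow> c \<in> A)"

text \<open>A tangent vector at \<open>p\<close> is the family of its components \<open>(y\<^sup>i)\<close> in all the charts around \<open>p\<close>,
  which are related by the Jacobians of the coordinate changes. The value at all other
  arguments is \<open>0\<close> by convention, so that two tangent vectors at \<open>p\<close> with the same components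
  are equal. The vector space operations are those on the components.\<close>

type_synonym ('a, 'n) tangent = "('a, 'n) chart \<Rightarrow> real ^ 'n"

definition tangent_space :: "('a, 'n::finite) chart set \<Rightarrow> 'a \<Rightarrow> ('a, 'n) tangent set"
  where "tangent_space A p = {v.
    (\<forall>c\<in>A. \<forall>d\<in>A. p \<in> dom_of c \<and> p \<in> dom_of d \<longrightarrow>
       v d = frechet_derivative (transition c d) (at (coord c p)) (v c)) \<and>
    (\<forall>c. \<not> (c \<in> A \<and> p \<in> dom_of c) \<longrightarrow> v c = 0)}"

definition tangent_bundle :: "('a, 'n::finite) chart set \<Rightarrow> ('a \<times> ('a, 'n) tangent) set"
  where "tangent_bundle A = (SIGMA p:UNIV. tangent_space A p)"

definition zero_tangent :: "('a, 'n::finite) tangent"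
  where "zero_tangent = (\<lambda>_. 0)"

definition lincomb :: "real \<Rightarrow> ('a, 'n::finite) tangent \<Rightarrow> real \<Rightarrow> ('a, 'n) tangent \<Rightarrow> ('a, 'n) tangent"
  where "lincomb a u b w = (\<lambda>c. a *\<^sub>R u c + b *\<^sub>R w c)"

definition plane_basis ::
    "('a, 'n::finite) chart set \<Rightarrow> 'a \<Rightarrow> ('a, 'n) tangent \<Rightarrow> ('a, 'n) tangent \<Rightarrow>
      ('a, 'n) tangent set \<Rightarrow> bool"
  where "plane_basis A p u w P \<longleftrightarrow>
    u \<in> tangent_space A p \<and> w \<in> tangent_space A p \<and>
    (\<forall>a b. lincomb a u b w = zero_tangent \<longrightarrow> a = 0 \<and> b = 0) \<and>
    P = {lincomb a u b w | a b. True}"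

definition tangent_plane :: "('a, 'n::finite) chart set \<Rightarrow> 'a \<Rightarrow> ('a, 'n) tangent set \<Rightarrow> bool"
  where "tangent_plane A p P \<longleftrightarrow> (\<exists>u w. plane_basis A p u w P)"

text \<open>The tangent vector \<open>y\<^sup>i \<partial>/\<partial>x\<^sup>i\<close> at \<open>p\<close>, for the coordinates \<open>(x\<^sup>i)\<close> of the chart \<open>c\<close>.\<close>

definition coord_vector ::
    "('a, 'n::finite) chart set \<Rightarrow> ('a, 'n) chart \<Rightarrow> 'a \<Rightarrow> real ^ 'n \<Rightarrow> ('a, 'n) tangent"
  where "coord_vector A c p y =
    (\<lambda>d. if d \<in> A \<and> p \<in> dom_of d
         then frechet_derivative (transition c d) (at (coord c p)) y else 0)"

text \<open>A function on \<open>TM\<close> in the natural coordinates \<open>(x, y)\<close> that the chart \<open>c\<close> induces.\<close>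

definition local_rep ::
    "('a, 'n::finite) chart set \<Rightarrow> ('a \<times> ('a, 'n) tangent \<Rightarrow> real) \<Rightarrow> ('a, 'n) chart \<Rightarrow>
      (real ^ 'n) \<times> (real ^ 'n) \<Rightarrow> real"
  where "local_rep A F c = (\<lambda>(x, y). F (coord_inv c x, coord_vector A c (coord_inv c x) y))"

definition slit_region :: "('a, 'n::finite) chart \<Rightarrow> ((real ^ 'n) \<times> (real ^ 'n)) set"
  where "slit_region c = region c \<times> (- {0})"


section \<open>Local expressions of the tensors of a Finsler structure\<close>

text \<open>Here \<open>f\<close> is the local representation of \<open>F\<close> in natural coordinates, and a point of the slit
  tangent bundle is a pair \<open>z = (x, y)\<close>. The arguments of a tensor are its indices from left to
  right, e.g. \<open>Rhh f i j k l\<close> is \<open>R\<^sup>i\<^sub>j\<^sub>k\<^sub>l\<close>.\<close>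

type_synonym 'n loc = "(real ^ 'n) \<times> (real ^ 'n) \<Rightarrow> real"

definition dx :: "'n::finite \<Rightarrow> 'n loc \<Rightarrow> 'n loc"
  where "dx i T z = frechet_derivative T (at z) (axis i 1, 0)"

definition dy :: "'n::finite \<Rightarrow> 'n loc \<Rightarrow> 'n loc"
  where "dy i T z = frechet_derivative T (at z) (0, axis i 1)"

definition g_lo :: "'n::finite loc \<Rightarrow> 'n \<Rightarrow> 'n \<Rightarrow> 'n loc"
  where "g_lo f i j z = 1/2 * dy i (dy j (\<lambda>z. (f z)\<^sup>2)) z"

definition g_up :: "'n::finite loc \<Rightarrow> 'n \<Rightarrow> 'n \<Rightarrow> 'n loc"
  where "g_up f i j z = matrix_inv (\<chi> i j. g_lo f i j z) $ i $ j"

definition spray :: "'n::finite loc \<Rightarrow> 'n \<Rightarrow> 'n loc"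
  where "spray f i z = 1/4 * (\<Sum>s\<in>UNIV. \<Sum>k\<in>UNIV. \<Sum>j\<in>UNIV.
    g_up f i s z * (dx j (g_lo f s k) z + dx k (g_lo f s j) z - dx s (g_lo f k j) z)
      * snd z $ j * snd z $ k)"

definition nonlin :: "'n::finite loc \<Rightarrow> 'n \<Rightarrow> 'n \<Rightarrow> 'n loc"
  where "nonlin f i m = dy m (spray f i)"

definition dh :: "'n::finite loc \<Rightarrow> 'n \<Rightarrow> 'n loc \<Rightarrow> 'n loc"
  where "dh f i T z = dx i T z - (\<Sum>m\<in>UNIV. nonlin f m i z * dy m T z)"

definition chern :: "'n::finite loc \<Rightarrow> 'n \<Rightarrow> 'n \<Rightarrow> 'n \<Rightarrow> 'n loc"
  where "chern f i j k z = (\<Sum>s\<in>UNIV. g_up f i s z / 2 *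
    (dh f k (g_lo f s j) z - dh f s (g_lo f j k) z + dh f j (g_lo f k s) z))"

definition chern_y :: "'n::finite loc \<Rightarrow> 'n \<Rightarrow> 'n \<Rightarrow> 'n \<Rightarrow> 'n \<Rightarrow> 'n loc"
  where "chern_y f i m p h = dy h (chern f i m p)"

text \<open>Horizontal covariant derivatives along \<open>\<delta>/\<delta>x\<^sup>h\<close> of tensors of types (0,3), (1,2) and (1,3);
  the index \<open>h\<close> of the derivative comes last.\<close>

definition cov03 :: "'n::finite loc \<Rightarrow> ('n \<Rightarrow> 'n \<Rightarrow> 'n \<Rightarrow> 'n loc) \<Rightarrow> 'n \<Rightarrow> 'n \<Rightarrow> 'n \<Rightarrow> 'n \<Rightarrow> 'n loc"
  where "cov03 f T i j k h z = dh f h (T i j k) z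
    - (\<Sum>m\<in>UNIV. T m j k z * chern f m i h z)
    - (\<Sum>m\<in>UNIV. T i m k z * chern f m j h z)
    - (\<Sum>m\<in>UNIV. T i j m z * chern f m k h z)"

definition cov12 :: "'n::finite loc \<Rightarrow> ('n \<Rightarrow> 'n \<Rightarrow> 'n \<Rightarrow> 'n loc) \<Rightarrow> 'n \<Rightarrow> 'n \<Rightarrow> 'n \<Rightarrow> 'n \<Rightarrow> 'n loc"
  where "cov12 f T i j k h z = dh f h (T i j k) z
    + (\<Sum>m\<in>UNIV. T m j k z * chern f i m h z)
    - (\<Sum>m\<in>UNIV. T i m k z * chern f m j h z)
    - (\<Sum>m\<in>UNIV. T i j m z * chern f m k h z)"

definition cov13 ::
    "'n::finite loc \<Rightarrow> ('n \<Rightarrow> 'n \<Rightarrow> 'n \<Rightarrow> 'n \<Rightarrow> 'n loc) \<Rightarrow> 'n \<Rightarrow> 'n \<Rightarrow> 'n \<Rightarrow> 'n \<Rightarrow> 'n \<Rightarrow> 'n loc"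
  where "cov13 f T i j k l h z = dh f h (T i j k l) z
    + (\<Sum>m\<in>UNIV. T m j k l z * chern f i m h z)
    - (\<Sum>m\<in>UNIV. T i m k l z * chern f m j h z)
    - (\<Sum>m\<in>UNIV. T i j m l z * chern f m k h z)
    - (\<Sum>m\<in>UNIV. T i j k m z * chern f m l h z)"

definition Rhh :: "'n::finite loc \<Rightarrow> 'n \<Rightarrow> 'n \<Rightarrow> 'n \<Rightarrow> 'n \<Rightarrow> 'n loc"
  where "Rhh f i j k l z = dh f k (chern f i j l) z - dh f l (chern f i j k) z
    + (\<Sum>h\<in>UNIV. chern f i h k z * chern f h j l z)
    - (\<Sum>h\<in>UNIV. chern f i h l z * chern f h j k z)"

definition ell :: "'n::finite loc \<Rightarrow> 'n \<Rightarrow> 'n loc"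
  where "ell f i z = snd z $ i / f z"

definition R2 :: "'n::finite loc \<Rightarrow> 'n \<Rightarrow> 'n \<Rightarrow> 'n \<Rightarrow> 'n loc"
  where "R2 f i k l z = (\<Sum>j\<in>UNIV. ell f j z * Rhh f i j k l z)"

definition cartan_lo :: "'n::finite loc \<Rightarrow> 'n \<Rightarrow> 'n \<Rightarrow> 'n \<Rightarrow> 'n loc"
  where "cartan_lo f i j k z = f z / 2 * dy k (g_lo f i j) z"

definition cartan_up :: "'n::finite loc \<Rightarrow> 'n \<Rightarrow> 'n \<Rightarrow> 'n \<Rightarrow> 'n loc"
  where "cartan_up f i j k z = (\<Sum>s\<in>UNIV. g_up f i s z * cartan_lo f s j k z)"

definition cartan_dot_lo :: "'n::finite loc \<Rightarrow> 'n \<Rightarrow> 'n \<Rightarrow> 'n \<Rightarrow> 'n loc"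
  where "cartan_dot_lo f i j k z = (\<Sum>s\<in>UNIV. cov03 f (cartan_lo f) i j k s z * ell f s z)"

definition cartan_dot_up :: "'n::finite loc \<Rightarrow> 'n \<Rightarrow> 'n \<Rightarrow> 'n \<Rightarrow> 'n loc"
  where "cartan_dot_up f i j k z = (\<Sum>s\<in>UNIV. cov12 f (cartan_up f) i j k s z * ell f s z)"


section \<open>Finsler spaces\<close>

definition finsler_structure ::
    "('a::topological_space, 'n::finite) chart set \<Rightarrow> ('a \<times> ('a, 'n) tangent \<Rightarrow> real) \<Rightarrow> bool"
  where "finsler_structure A F \<longleftrightarrow>
    (\<forall>(p, v)\<in>tangent_bundle A. 0 \<le> F (p, v)) \<and>
    (\<forall>(p, v)\<in>tangent_bundle A. \<forall>t>0. F (p, \<lambda>c. t *\<^sub>R v c) = t * F (p, v)) \<and>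
    (\<forall>c\<in>A. smooth_on (slit_region c) (local_rep A F c)) \<and>
    (\<forall>c\<in>A. \<forall>z\<in>slit_region c. \<forall>u. u \<noteq> 0 \<longrightarrow>
       0 < (\<Sum>i\<in>UNIV. \<Sum>j\<in>UNIV. g_lo (local_rep A F c) i j z * u $ i * u $ j))"

definition landsberg ::
    "('a::topological_space, 'n::finite) chart set \<Rightarrow> ('a \<times> ('a, 'n) tangent \<Rightarrow> real) \<Rightarrow> bool"
  where "landsberg A F \<longleftrightarrow>
    (\<forall>c\<in>A. \<forall>z\<in>slit_region c. \<forall>i j k. cartan_dot_lo (local_rep A F c) i j k z = 0)"

definition symmetric_finsler ::
    "('a::topological_space, 'n::finite) chart set \<Rightarrow> ('a \<times> ('a, 'n) tangent \<Rightarrow> real) \<Rightarrow> bool"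
  where "symmetric_finsler A F \<longleftrightarrow>
    (\<forall>c\<in>A. \<forall>z\<in>slit_region c. \<forall>i j k h l.
       cov13 (local_rep A F c) (Rhh (local_rep A F c)) i j k h l z = 0)"


section \<open>Sectional curvature of a Riemannian metric in local coordinates\<close>

definition dr :: "'n::finite \<Rightarrow> (real ^ 'n \<Rightarrow> real) \<Rightarrow> real ^ 'n \<Rightarrow> real"
  where "dr i T x = frechet_derivative T (at x) (axis i 1)"

definition christoffel ::
    "('n::finite \<Rightarrow> 'n \<Rightarrow> real ^ 'n \<Rightarrow> real) \<Rightarrow> 'n \<Rightarrow> 'n \<Rightarrow> 'n \<Rightarrow> real ^ 'n \<Rightarrow> real"
  where "christoffel h i j k x = 1/2 * (\<Sum>s\<in>UNIV. matrix_inv (\<chi> a b. h a b x) $ i $ s *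
    (dr j (h s k) x + dr k (h s j) x - dr s (h j k) x))"

text \<open>\<open>R(\<partial>\<^sub>k, \<partial>\<^sub>l) \<partial>\<^sub>j = R\<^sup>i\<^sub>j\<^sub>k\<^sub>l \<partial>\<^sub>i\<close>, where \<open>R(X, Y) = [\<nabla>\<^sub>X, \<nabla>\<^sub>Y] - \<nabla>\<^bsub>[X, Y]\<^esub>\<close>.\<close>

definition riemann ::
    "('n::finite \<Rightarrow> 'n \<Rightarrow> real ^ 'n \<Rightarrow> real) \<Rightarrow> 'n \<Rightarrow> 'n \<Rightarrow> 'n \<Rightarrow> 'n \<Rightarrow> real ^ 'n \<Rightarrow> real"
  where "riemann h i j k l x = dr k (christoffel h i j l) x - dr l (christoffel h i j k) x
    + (\<Sum>m\<in>UNIV. christoffel h i m k x * christoffel h m j l x)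
    - (\<Sum>m\<in>UNIV. christoffel h i m l x * christoffel h m j k x)"

definition metric_at :: "('n::finite \<Rightarrow> 'n \<Rightarrow> real ^ 'n \<Rightarrow> real) \<Rightarrow> real ^ 'n \<Rightarrow> real ^ 'n \<Rightarrow> real ^ 'n \<Rightarrow> real"
  where "metric_at h x u w = (\<Sum>i\<in>UNIV. \<Sum>j\<in>UNIV. h i j x * u $ i * w $ j)"

text \<open>\<open>h(R(u, w)w, u) / (h(u, u) h(w, w) - h(u, w)\<^sup>2)\<close>, so that spheres have positive curvature.\<close>

definition sectional ::
    "('n::finite \<Rightarrow> 'n \<Rightarrow> real ^ 'n \<Rightarrow> real) \<Rightarrow> real ^ 'n \<Rightarrow> real ^ 'n \<Rightarrow> real ^ 'n \<Rightarrow> real"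
  where "sectional h x u w =
    metric_at h x
      (\<chi> i. \<Sum>j\<in>UNIV. \<Sum>k\<in>UNIV. \<Sum>l\<in>UNIV. riemann h i j k l x * w $ j * u $ k * w $ l) u /
    (metric_at h x u u * metric_at h x w w - (metric_at h x u w)\<^sup>2)"


section \<open>Geodesic vector fields and flag curvature\<close>

definition velocity :: "('a, 'n::finite) chart \<Rightarrow> (real \<Rightarrow> 'a) \<Rightarrow> real \<Rightarrow> real ^ 'n"
  where "velocity c \<gamma> t = vector_derivative (coord c \<circ> \<gamma>) (at t)"

text \<open>The geodesic equation for constant speed geodesics, in every chart. Its right-hand
  side is \<open>- \<Gamma>\<^sup>i\<^sub>j\<^sub>k y\<^sup>j y\<^sup>k\<close> along \<open>y = \<gamma>'\<close>, i.e. it says that \<open>\<gamma>\<close> is autoparallel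
  for the Chern connection.\<close>

definition is_geodesic ::
    "('a::topological_space, 'n::finite) chart set \<Rightarrow> ('a \<times> ('a, 'n) tangent \<Rightarrow> real) \<Rightarrow>
      real set \<Rightarrow> (real \<Rightarrow> 'a) \<Rightarrow> bool"
  where "is_geodesic A F I \<gamma> \<longleftrightarrow>
    continuous_on I \<gamma> \<and>
    (\<forall>c\<in>A. \<forall>t\<in>I. \<gamma> t \<in> dom_of c \<longrightarrow>
       (coord c \<circ> \<gamma>) differentiable (at t) \<and> velocity c \<gamma> t \<noteq> 0 \<and>
       (velocity c \<gamma> has_vector_derivative
         (\<chi> i. - 2 * spray (local_rep A F c) i (coord c (\<gamma> t), velocity c \<gamma> t))) (at t))"

definition vector_field ::
    "('a::topological_space, 'n::finite) chart set \<Rightarrow> 'a set \<Rightarrow> ('a \<Rightarrow> ('a, 'n) tangent) \<Rightarrow> bool"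
  where "vector_field A U X \<longleftrightarrow>
    (\<forall>p\<in>U. X p \<in> tangent_space A p) \<and>
    (\<forall>c\<in>A. smooth_on (coord c ` (dom_of c \<inter> U)) (\<lambda>x. X (coord_inv c x) c))"

definition integral_curve ::
    "('a::topological_space, 'n::finite) chart set \<Rightarrow> 'a set \<Rightarrow> ('a \<Rightarrow> ('a, 'n) tangent) \<Rightarrow>
      real set \<Rightarrow> (real \<Rightarrow> 'a) \<Rightarrow> bool"
  where "integral_curve A U X I \<gamma> \<longleftrightarrow>
    \<gamma> ` I \<subseteq> U \<and> continuous_on I \<gamma> \<and>
    (\<forall>c\<in>A. \<forall>t\<in>I. \<gamma> t \<in> dom_of c \<longrightarrow>
       ((coord c \<circ> \<gamma>) has_vector_derivative X (\<gamma> t) c) (at t))"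

definition geodesic_vector_field ::
    "('a::topological_space, 'n::finite) chart set \<Rightarrow> ('a \<times> ('a, 'n) tangent \<Rightarrow> real) \<Rightarrow>
      'a set \<Rightarrow> ('a \<Rightarrow> ('a, 'n) tangent) \<Rightarrow> bool"
  where "geodesic_vector_field A F U X \<longleftrightarrow>
    open U \<and> vector_field A U X \<and> (\<forall>p\<in>U. X p \<noteq> zero_tangent) \<and>
    (\<forall>I \<gamma>. open I \<and> is_interval I \<and> integral_curve A U X I \<gamma> \<longrightarrow> is_geodesic A F I \<gamma>)"

text \<open>The Riemannian metric \<open>g\<^sub>i\<^sub>j(x, X(x)) dx\<^sup>i \<otimes> dx\<^sup>j\<close> associated to \<open>X\<close>, in the chart \<open>c\<close>.\<close>

definition osculating_metric ::
    "('a, 'n::finite) chart set \<Rightarrow> ('a \<times> ('a, 'n) tangent \<Rightarrow> real) \<Rightarrow> ('a \<Rightarrow> ('a, 'n) tangent) \<Rightarrow>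
      ('a, 'n) chart \<Rightarrow> 'n \<Rightarrow> 'n \<Rightarrow> real ^ 'n \<Rightarrow> real"
  where "osculating_metric A F X c i j x = g_lo (local_rep A F c) i j (x, X (coord_inv c x) c)"

text \<open>The sectional curvature of a plane does not depend on the chart or the basis that is used to
  compute it.\<close>

definition has_sectional_curvature ::
    "('a, 'n::finite) chart set \<Rightarrow> (('a, 'n) chart \<Rightarrow> 'n \<Rightarrow> 'n \<Rightarrow> real ^ 'n \<Rightarrow> real) \<Rightarrow> 'a \<Rightarrow>
      ('a, 'n) tangent set \<Rightarrow> real \<Rightarrow> bool"
  where "has_sectional_curvature A h p P K \<longleftrightarrow>
    (\<forall>c\<in>A. \<forall>u w. p \<in> dom_of c \<and> plane_basis A p u w P \<longrightarrow>
       sectional (h c) (coord c p) (u c) (w c) = K)"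

text \<open>The flag curvature of \<open>(P, v)\<close> is computed from some geodesic vector field that extends \<open>v\<close>;
  such fields exist, and the result does not depend on the choice.\<close>

definition has_flag_curvature ::
    "('a::topological_space, 'n::finite) chart set \<Rightarrow> ('a \<times> ('a, 'n) tangent \<Rightarrow> real) \<Rightarrow>
      'a \<Rightarrow> ('a, 'n) tangent set \<Rightarrow> ('a, 'n) tangent \<Rightarrow> real \<Rightarrow> bool"
  where "has_flag_curvature A F p P v K \<longleftrightarrow>
    (\<exists>U X. p \<in> U \<and> geodesic_vector_field A F U X \<and> X p = v \<and>
       has_sectional_curvature A (osculating_metric A F X) p P K)"

definition constant_flag_curvature ::
    "('a::topological_space, 'n::finite) chart set \<Rightarrow> ('a \<times> ('a, 'n) tangent \<Rightarrow> real) \<Rightarrow> bool"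
  where "constant_flag_curvature A F \<longleftrightarrow>
    (\<exists>K. \<forall>p v P. v \<in> tangent_space A p \<and> v \<noteq> zero_tangent \<and> tangent_plane A p P \<and> v \<in> P \<longrightarrow>
       has_flag_curvature A F p P v K)"

end

theory Submission
  imports Defs
begin

text \<open>
  The curvature tensor of a Landsberg space of constant flag curvature \<open>K\<close> is
  \<open>R\<^sup>i\<^sub>j\<^sub>k\<^sub>l = K (\<delta>\<^sup>i\<^sub>k g\<^sub>j\<^sub>l - \<delta>\<^sup>i\<^sub>l g\<^sub>j\<^sub>k)\<close>, as for a Riemannian space form
  (\<open>landsberg_constant_curvature\<close>). Since the Chern connection is metric along horizontal
  directions (\<open>dh_g\<close>), this tensor is parallel (\<open>cov13_Rhh_eq_0\<close>).

  The formula comes from the curvature \<open>\<rho>\<^sup>i\<^sub>k\<^sub>l = y\<^sup>j R\<^sup>i\<^sub>j\<^sub>k\<^sub>l\<close> of the nonlinear connection \<open>N\<close>. Along a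
  geodesic field \<open>\<xi>\<close> the Levi-Civita connection of the osculating metric and \<open>N\<close> define the same
  covariant derivative of \<open>\<xi>\<close> (\<open>christoffel_\<xi>\<close>), hence \<open>\<rho>\<^sup>i\<^sub>k\<^sub>l y\<^sup>l\<close> is the Jacobi endomorphism of that
  Riemannian metric in the direction of \<open>\<xi>\<close> (\<open>riemann_\<xi>_\<xi>\<close>). It is symmetric, so constant flag
  curvature determines it: \<open>\<rho>\<^sup>i\<^sub>k\<^sub>l y\<^sup>l = K (F\<^sup>2 \<delta>\<^sup>i\<^sub>k - y\<^sub>k y\<^sup>i)\<close> (\<open>constant_flag_curvature_local\<close>).

  On a Landsberg space the Chern connection is the Berwald connection, \<open>\<Gamma>\<^sup>i\<^sub>j\<^sub>k = \<partial>N\<^sup>i\<^sub>k/\<partial>y\<^sup>j\<close>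
  (\<open>landsberg_dy_N\<close>), and therefore \<open>R\<^sup>i\<^sub>j\<^sub>k\<^sub>l = \<partial>\<rho>\<^sup>i\<^sub>k\<^sub>l/\<partial>y\<^sup>j\<close> (\<open>landsberg_dy_\<rho>\<close>). With the first Bianchi
  identity a fibre derivative of the Jacobi endomorphism yields \<open>\<rho>\<^sup>i\<^sub>k\<^sub>l = K (\<delta>\<^sup>i\<^sub>k y\<^sub>l - \<delta>\<^sup>i\<^sub>l y\<^sub>k)\<close>, and
  another one, because of \<open>\<partial>y\<^sub>l/\<partial>y\<^sup>j = g\<^sub>j\<^sub>l\<close>, yields the formula for \<open>R\<close>.

  Geodesic fields are defined through their integral curves. Local existence of these curves
  (\<open>ex_integral_curve\<close>) turns the definition into the differential equation
  \<open>\<xi>\<^sup>j \<partial>\<^sub>j\<xi>\<^sup>i = - 2 G\<^sup>i\<close> (\<open>geodesic_vector_field_equation\<close>), where \<open>G\<^sup>i\<close> are the spray coefficients,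
  whose fibre derivatives are \<open>N\<^sup>i\<^sub>m\<close>.
\<close>

section \<open>Calculus of smooth functions\<close>

lemma has_derivative_fd:
  "f differentiable (at x) \<Longrightarrow> (f has_derivative frechet_derivative f (at x)) (at x)"
  by (simp add: frechet_derivative_works[symmetric])

lemma fd_eqI: "(f has_derivative f') (at x) \<Longrightarrow> frechet_derivative f (at x) v = f' v"
  using frechet_derivative_at by metis

lemma Ck_on_transform:
  assumes "Ck_on k S f" "open S" "\<And>x. x \<in> S \<Longrightarrow> f x = g x"
  shows "Ck_on k S g"
  using assms(1,3)
proof (induction k arbitrary: f g)
  case 0
  then show ?case by (metis Ck_on.simps(1) continuous_on_cong)
next
  case (Suc k)
  have der: "(g has_derivative frechet_derivative f (at x)) (at x)" if "x \<in> S" for x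
    using has_derivative_transform_within_open[OF has_derivative_fd assms(2) that] Suc.prems that
    by auto
  have eq: "frechet_derivative f (at x) v = frechet_derivative g (at x) v" if "x \<in> S" for x v
    using fd_eqI[OF der[OF that]] by simp
  have "Ck_on k S (\<lambda>x. frechet_derivative g (at x) v)" for v
    using Suc.IH[of "\<lambda>x. frechet_derivative f (at x) v"] Suc.prems(1) eq by simp
  then show ?case using der by (auto simp: differentiable_def)
qed

lemma Ck_on_Suc_imp: "Ck_on (Suc k) S f \<Longrightarrow> Ck_on k S f"
proof (induction k arbitrary: f)
  case 0
  then show ?case
    by (auto intro!: continuous_at_imp_continuous_on differentiable_imp_continuous_within)
next
  case (Suc k)
  then show ?case by (metis Ck_on.simps(2))
qed

lemma Ck_on_const: "Ck_on k S (\<lambda>x. c)"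
  by (induction k arbitrary: c) (auto simp: frechet_derivative_const)

lemma Ck_on_linear_compose:
  assumes "bounded_linear L" "open S" "Ck_on k S f"
  shows "Ck_on k S (\<lambda>x. L (f x))"
  using assms(3)
proof (induction k arbitrary: f)
  case 0
  then show ?case using bounded_linear.continuous_on[OF assms(1)] by auto
next
  case (Suc k)
  have der: "((\<lambda>x. L (f x)) has_derivative (\<lambda>v. L (frechet_derivative f (at x) v))) (at x)"
    if "x \<in> S" for x
    using Suc.prems that by (auto intro!: bounded_linear.has_derivative[OF assms(1)] has_derivative_fd)
  have "Ck_on k S (\<lambda>x. L (frechet_derivative f (at x) v))" for v
    using Suc by simp
  then have "Ck_on k S (\<lambda>x. frechet_derivative (\<lambda>x. L (f x)) (at x) v)" for v
    using Ck_on_transform[OF _ assms(2)] fd_eqI[OF der] by (metis (mono_tags, lifting))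
  then show ?case using der by (auto simp: differentiable_def)
qed

lemma Ck_on_add:
  assumes "open S" "Ck_on k S f" "Ck_on k S g"
  shows "Ck_on k S (\<lambda>x. f x + g x)"
  using assms(2,3)
proof (induction k arbitrary: f g)
  case 0
  then show ?case by (auto intro: continuous_intros)
next
  case (Suc k)
  have der: "((\<lambda>x. f x + g x) has_derivative
      (\<lambda>v. frechet_derivative f (at x) v + frechet_derivative g (at x) v)) (at x)"
    if "x \<in> S" for x
    using Suc.prems that by (auto intro!: has_derivative_add has_derivative_fd)
  have "Ck_on k S (\<lambda>x. frechet_derivative f (at x) v + frechet_derivative g (at x) v)" for v
    using Suc by simp
  then have "Ck_on k S (\<lambda>x. frechet_derivative (\<lambda>x. f x + g x) (at x) v)" for v
    using Ck_on_transform[OF _ assms(1)] fd_eqI[OF der] by (metis (mono_tags, lifting))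
  then show ?case using der by (auto simp: differentiable_def)
qed

lemma Ck_on_mult:
  fixes f g :: "'a::real_normed_vector \<Rightarrow> real"
  assumes "open S" "Ck_on k S f" "Ck_on k S g"
  shows "Ck_on k S (\<lambda>x. f x * g x)"
  using assms(2,3)
proof (induction k arbitrary: f g)
  case 0
  then show ?case by (auto intro: continuous_intros)
next
  case (Suc k)
  have der: "((\<lambda>x. f x * g x) has_derivative
      (\<lambda>v. f x * frechet_derivative g (at x) v + frechet_derivative f (at x) v * g x)) (at x)"
    if "x \<in> S" for x
    using Suc.prems that by (auto intro!: has_derivative_mult has_derivative_fd)
  have "Ck_on k S (\<lambda>x. f x * frechet_derivative g (at x) v + frechet_derivative f (at x) v * g x)" for v
    using Suc.IH Suc.prems Ck_on_Suc_imp[OF Suc.prems(1)] Ck_on_Suc_imp[OF Suc.prems(2)]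
    by (auto intro!: Ck_on_add[OF assms(1)])
  then have "Ck_on k S (\<lambda>x. frechet_derivative (\<lambda>x. f x * g x) (at x) v)" for v
    using Ck_on_transform[OF _ assms(1)] fd_eqI[OF der] by (metis (mono_tags, lifting))
  then show ?case using der by (auto simp: differentiable_def)
qed

lemma Ck_on_sum:
  assumes "open S" "\<And>i. i \<in> I \<Longrightarrow> Ck_on k S (f i)"
  shows "Ck_on k S (\<lambda>x. \<Sum>i\<in>I. f i x)"
  using assms(2)
  by (induction I rule: infinite_finite_induct) (auto intro: Ck_on_const Ck_on_add[OF assms(1)])

lemma Ck_on_Pair:
  assumes "open S" "Ck_on k S f" "Ck_on k S g"
  shows "Ck_on k S (\<lambda>x. (f x, g x))"
proof -
  have L: "bounded_linear (\<lambda>a::'b. (a, 0::'c))" "bounded_linear (\<lambda>b::'c. (0::'b, b))"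
    by (auto intro!: bounded_linear_Pair bounded_linear_zero bounded_linear_ident)
  have "Ck_on k S (\<lambda>x. (f x, 0::'c) + (0::'b, g x))"
    by (rule Ck_on_add[OF assms(1) Ck_on_linear_compose[OF L(1) assms(1,2)]
          Ck_on_linear_compose[OF L(2) assms(1,3)]])
  then show ?thesis by simp
qed

lemma Ck_on_ident: "Ck_on k S (\<lambda>x. x)"
  by (cases k) (auto intro: Ck_on_const)

text \<open>In a basis the chain rule is a finite sum of products, so that the product rule settles the
  induction step.\<close>

lemma Ck_on_compose:
  fixes f :: "'a::real_normed_vector \<Rightarrow> 'b::euclidean_space" and T :: "'b \<Rightarrow> real"
  assumes "open S" "open V" "Ck_on k S f" "Ck_on k V T" "f ` S \<subseteq> V"
  shows "Ck_on k S (\<lambda>x. T (f x))"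
  using assms(3,4)
proof (induction k arbitrary: T)
  case 0
  then show ?case
    using continuous_on_compose2[of V T S f] assms(5) by auto
next
  case (Suc k)
  have dT: "(T has_derivative frechet_derivative T (at (f x))) (at (f x))" if "x \<in> S" for x
    using Suc.prems that assms(5) by (auto intro!: has_derivative_fd)
  have der: "((\<lambda>x. T (f x)) has_derivative
      (\<lambda>v. frechet_derivative T (at (f x)) (frechet_derivative f (at x) v))) (at x)"
    if "x \<in> S" for x
    by (rule has_derivative_compose[where f = f and g = T, OF _ dT[OF that]])
       (use Suc.prems(1) that in \<open>auto intro!: has_derivative_fd\<close>)
  have expand: "frechet_derivative T (at (f x)) (frechet_derivative f (at x) v) =
      (\<Sum>b\<in>Basis. (frechet_derivative f (at x) v \<bullet> b) * frechet_derivative T (at (f x)) b)"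
    if "x \<in> S" for x v
  proof -
    interpret linear "frechet_derivative T (at (f x))"
      using dT[OF that] has_derivative_linear by blast
    have "frechet_derivative T (at (f x)) (\<Sum>b\<in>Basis. (frechet_derivative f (at x) v \<bullet> b) *\<^sub>R b)
      = (\<Sum>b\<in>Basis. (frechet_derivative f (at x) v \<bullet> b) * frechet_derivative T (at (f x)) b)"
      by (simp only: sum scale real_scaleR_def)
    then show ?thesis by (simp add: euclidean_representation)
  qed
  have "Ck_on k S (\<lambda>x. \<Sum>b\<in>Basis. (frechet_derivative f (at x) v \<bullet> b) *
      frechet_derivative T (at (f x)) b)" for v
  proof (intro Ck_on_sum[OF assms(1)] Ck_on_mult[OF assms(1)])
    fix b :: 'b
    show "Ck_on k S (\<lambda>x. frechet_derivative f (at x) v \<bullet> b)"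
      by (rule Ck_on_linear_compose[OF bounded_linear_inner_left assms(1)]) (use Suc.prems(1) in simp)
    show "Ck_on k S (\<lambda>x. frechet_derivative T (at (f x)) b)"
      using Suc.IH[OF Ck_on_Suc_imp[OF Suc.prems(1)]] Suc.prems(2) by auto
  qed
  then have "Ck_on k S (\<lambda>x. frechet_derivative (\<lambda>x. T (f x)) (at x) v)" for v
    by (rule Ck_on_transform[OF _ assms(1)]) (simp add: fd_eqI[OF der] expand)
  then show ?case using der by (auto simp: differentiable_def)
qed

text \<open>The derivative of the inverse is a polynomial in the inverse, so that the product rule suffices.\<close>

lemma Ck_on_inverse: "Ck_on k (- {0::real}) inverse"
proof (induction k)
  case 0
  then show ?case by (auto intro!: continuous_intros)
next
  case (Suc k)
  have der: "(inverse has_derivative (\<lambda>v. - (inverse x * v * inverse x))) (at x)"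
    if "x \<in> - {0}" for x :: real
    using has_derivative_inverse'[of x UNIV] that by auto
  have "Ck_on k (- {0}) (\<lambda>x::real. inverse x * inverse x * (- v))" for v
    by (intro Ck_on_mult Ck_on_const Suc) auto
  then have "Ck_on k (- {0}) (\<lambda>x::real. frechet_derivative inverse (at x) v)" for v
    by (rule Ck_on_transform) (auto simp: fd_eqI[OF der])
  then show ?case using der by (auto simp: differentiable_def)
qed

lemma smooth_on_transform:
  "smooth_on S f \<Longrightarrow> open S \<Longrightarrow> (\<And>x. x \<in> S \<Longrightarrow> f x = g x) \<Longrightarrow> smooth_on S g"
  unfolding smooth_on_def using Ck_on_transform by blast

lemma smooth_on_const: "smooth_on S (\<lambda>x. c)"
  by (simp add: smooth_on_def Ck_on_const)

lemma smooth_on_ident: "smooth_on S (\<lambda>x. x)"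
  by (simp add: smooth_on_def Ck_on_ident)

lemma smooth_on_linear_compose:
  "bounded_linear L \<Longrightarrow> open S \<Longrightarrow> smooth_on S f \<Longrightarrow> smooth_on S (\<lambda>x. L (f x))"
  by (simp add: smooth_on_def Ck_on_linear_compose)

lemma smooth_on_add:
  "open S \<Longrightarrow> smooth_on S f \<Longrightarrow> smooth_on S g \<Longrightarrow> smooth_on S (\<lambda>x. f x + g x)"
  by (simp add: smooth_on_def Ck_on_add)

lemma smooth_on_mult:
  fixes f g :: "'a::real_normed_vector \<Rightarrow> real"
  shows "open S \<Longrightarrow> smooth_on S f \<Longrightarrow> smooth_on S g \<Longrightarrow> smooth_on S (\<lambda>x. f x * g x)"
  by (simp add: smooth_on_def Ck_on_mult)

lemma smooth_on_minus: "open S \<Longrightarrow> smooth_on S f \<Longrightarrow> smooth_on S (\<lambda>x. - f x)"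
  by (rule smooth_on_linear_compose[OF bounded_linear_minus[OF bounded_linear_ident]])

lemma smooth_on_diff:
  "open S \<Longrightarrow> smooth_on S f \<Longrightarrow> smooth_on S g \<Longrightarrow> smooth_on S (\<lambda>x. f x - g x)"
  using smooth_on_add[OF _ _ smooth_on_minus, of S f g] by simp

lemma smooth_on_sum:
  "open S \<Longrightarrow> (\<And>i. i \<in> I \<Longrightarrow> smooth_on S (f i)) \<Longrightarrow> smooth_on S (\<lambda>x. \<Sum>i\<in>I. f i x)"
  by (simp add: smooth_on_def Ck_on_sum)

lemma smooth_on_prod:
  fixes f :: "'i \<Rightarrow> 'a::real_normed_vector \<Rightarrow> real"
  assumes "open S" "\<And>i. i \<in> I \<Longrightarrow> smooth_on S (f i)"
  shows "smooth_on S (\<lambda>x. \<Prod>i\<in>I. f i x)"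
  using assms(2)
  by (induction I rule: infinite_finite_induct)
     (auto intro: smooth_on_const smooth_on_mult[OF assms(1)])

lemma smooth_on_power2:
  fixes f :: "'a::real_normed_vector \<Rightarrow> real"
  shows "open S \<Longrightarrow> smooth_on S f \<Longrightarrow> smooth_on S (\<lambda>x. (f x)\<^sup>2)"
  by (simp add: power2_eq_square smooth_on_mult)

lemma smooth_on_compose:
  fixes f :: "'a::real_normed_vector \<Rightarrow> 'b::euclidean_space" and T :: "'b \<Rightarrow> real"
  shows "open S \<Longrightarrow> open V \<Longrightarrow> smooth_on S f \<Longrightarrow> smooth_on V T \<Longrightarrow> f ` S \<subseteq> V \<Longrightarrow>
    smooth_on S (\<lambda>x. T (f x))"
  unfolding smooth_on_def using Ck_on_compose by blast

lemma smooth_on_Pair: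
  "open S \<Longrightarrow> smooth_on S f \<Longrightarrow> smooth_on S g \<Longrightarrow> smooth_on S (\<lambda>x. (f x, g x))"
  by (simp add: smooth_on_def Ck_on_Pair)

lemma smooth_on_divide:
  fixes f g :: "'a::real_normed_vector \<Rightarrow> real"
  assumes "open S" "smooth_on S f" "smooth_on S g" "\<And>x. x \<in> S \<Longrightarrow> g x \<noteq> 0"
  shows "smooth_on S (\<lambda>x. f x / g x)"
proof -
  have "smooth_on S (\<lambda>x. inverse (g x))"
    by (rule smooth_on_compose[OF assms(1) _ assms(3), of "- {0}"])
       (use assms(4) Ck_on_inverse in \<open>auto simp: smooth_on_def\<close>)
  then show ?thesis
    using smooth_on_mult[OF assms(1,2)] by (simp add: divide_inverse)
qed

lemma smooth_on_differentiable: "smooth_on S f \<Longrightarrow> x \<in> S \<Longrightarrow> f differentiable (at x)"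
  unfolding smooth_on_def by (metis Ck_on.simps(2))

lemma smooth_on_has_derivative:
  "smooth_on S f \<Longrightarrow> x \<in> S \<Longrightarrow> (f has_derivative frechet_derivative f (at x)) (at x)"
  using smooth_on_differentiable has_derivative_fd by blast

lemma smooth_on_fd: "smooth_on S f \<Longrightarrow> smooth_on S (\<lambda>x. frechet_derivative f (at x) v)"
  unfolding smooth_on_def by (metis Ck_on.simps(2))

lemma smooth_on_continuous_on: "smooth_on S f \<Longrightarrow> continuous_on S f"
  unfolding smooth_on_def by (metis Ck_on.simps(1))

lemma fd_cong:
  assumes "f differentiable (at x)" "open S" "x \<in> S" "\<And>x. x \<in> S \<Longrightarrow> f x = g x"
  shows "frechet_derivative g (at x) v = frechet_derivative f (at x) v"
  using frechet_derivative_transform_within_open[OF assms(1-3)] assms(4) by metis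

lemma fd_linear:
  assumes "f differentiable (at x)"
  shows "frechet_derivative f (at x) (a *\<^sub>R v + w) =
    a *\<^sub>R frechet_derivative f (at x) v + frechet_derivative f (at x) w"
    "frechet_derivative f (at x) (\<Sum>i\<in>I. c i *\<^sub>R u i) = (\<Sum>i\<in>I. c i *\<^sub>R frechet_derivative f (at x) (u i))"
proof -
  interpret linear "frechet_derivative f (at x)"
    using assms by (rule linear_frechet_derivative)
  show "frechet_derivative f (at x) (a *\<^sub>R v + w) =
    a *\<^sub>R frechet_derivative f (at x) v + frechet_derivative f (at x) w"
    "frechet_derivative f (at x) (\<Sum>i\<in>I. c i *\<^sub>R u i) = (\<Sum>i\<in>I. c i *\<^sub>R frechet_derivative f (at x) (u i))"
    by (simp_all add: add scale sum)
qed

lemma fd_add: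
  assumes "f differentiable (at x)" "g differentiable (at x)"
  shows "frechet_derivative (\<lambda>x. f x + g x) (at x) v =
    frechet_derivative f (at x) v + frechet_derivative g (at x) v"
  by (rule fd_eqI) (intro has_derivative_add has_derivative_fd assms)

lemma fd_diff:
  assumes "f differentiable (at x)" "g differentiable (at x)"
  shows "frechet_derivative (\<lambda>x. f x - g x) (at x) v =
    frechet_derivative f (at x) v - frechet_derivative g (at x) v"
  by (rule fd_eqI) (intro has_derivative_diff has_derivative_fd assms)

lemma fd_mult:
  fixes f g :: "'a::real_normed_vector \<Rightarrow> real"
  assumes "f differentiable (at x)" "g differentiable (at x)"
  shows "frechet_derivative (\<lambda>x. f x * g x) (at x) v =
    frechet_derivative f (at x) v * g x + f x * frechet_derivative g (at x) v"
  using fd_eqI[OF has_derivative_mult[OF has_derivative_fd[OF assms(1)] has_derivative_fd[OF assms(2)]]]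
  by simp

lemma fd_sum:
  assumes "\<And>i. i \<in> I \<Longrightarrow> f i differentiable (at x)"
  shows "frechet_derivative (\<lambda>x. \<Sum>i\<in>I. f i x) (at x) v = (\<Sum>i\<in>I. frechet_derivative (f i) (at x) v)"
  by (rule fd_eqI) (auto intro!: has_derivative_sum has_derivative_fd assms)

text \<open>Mixed second derivatives agree: both are limits of the same second-order difference quotient,
  by the mean value theorem applied in the two possible orders.\<close>

lemma second_difference_mean_value:
  fixes T :: "'a::real_normed_vector \<Rightarrow> real"
  assumes T: "smooth_on S T" and "0 < h"
    and S: "\<And>s t. 0 \<le> s \<Longrightarrow> s \<le> h \<Longrightarrow> 0 \<le> t \<Longrightarrow> t \<le> h \<Longrightarrow> z + s *\<^sub>R v + t *\<^sub>R w \<in> S"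
  obtains s t where "0 < s" "s < h" "0 < t" "t < h"
    "T (z + h *\<^sub>R v + h *\<^sub>R w) - T (z + h *\<^sub>R v) - T (z + h *\<^sub>R w) + T z =
      h * h * frechet_derivative (\<lambda>x. frechet_derivative T (at x) v) (at (z + s *\<^sub>R v + t *\<^sub>R w)) w"
proof -
  define p where "p s = T (z + s *\<^sub>R v + h *\<^sub>R w) - T (z + s *\<^sub>R v)" for s
  let ?DT = "\<lambda>x. frechet_derivative T (at x) v"
  have line: "((\<lambda>s. T (z + s *\<^sub>R v + b)) has_real_derivative ?DT (z + s *\<^sub>R v + b)) (at s)"
    if "z + s *\<^sub>R v + b \<in> S" for s b
  proof -
    have "((\<lambda>s. T (z + s *\<^sub>R v + b)) has_derivative
        (\<lambda>r. frechet_derivative T (at (z + s *\<^sub>R v + b)) (r *\<^sub>R v))) (at s)"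
      by (rule has_derivative_compose[where f = "\<lambda>s. z + s *\<^sub>R v + b" and g = T,
            OF _ smooth_on_has_derivative[OF T that]])
         (auto intro!: derivative_eq_intros)
    moreover have "(\<lambda>r. frechet_derivative T (at (z + s *\<^sub>R v + b)) (r *\<^sub>R v)) =
        (*) (?DT (z + s *\<^sub>R v + b))"
      using fd_linear(1)[OF smooth_on_differentiable[OF T that], of _ v 0]
        linear_0[OF linear_frechet_derivative[OF smooth_on_differentiable[OF T that]]] by auto
    ultimately show ?thesis by (simp add: has_field_derivative_def)
  qed
  have "\<exists>s>0. s < h \<and> p h - p 0 = (h - 0) * (?DT (z + s *\<^sub>R v + h *\<^sub>R w) - ?DT (z + s *\<^sub>R v))"
  proof (rule MVT2[OF \<open>0 < h\<close>])
    fix s assume "0 \<le> s" "s \<le> h"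
    then show "(p has_real_derivative (?DT (z + s *\<^sub>R v + h *\<^sub>R w) - ?DT (z + s *\<^sub>R v))) (at s)"
      unfolding p_def using line[of s "h *\<^sub>R w"] line[of s 0] S[of s h] S[of s 0] \<open>0 < h\<close>
      by (auto intro!: derivative_intros)
  qed
  then obtain s where s: "0 < s" "s < h" and
    p: "p h - p 0 = h * (?DT (z + s *\<^sub>R v + h *\<^sub>R w) - ?DT (z + s *\<^sub>R v))" by auto
  have line2: "((\<lambda>t. ?DT (z + s *\<^sub>R v + t *\<^sub>R w)) has_real_derivative
      frechet_derivative ?DT (at (z + s *\<^sub>R v + t *\<^sub>R w)) w) (at t)"
    if "z + s *\<^sub>R v + t *\<^sub>R w \<in> S" for t
  proof -
    let ?x = "z + s *\<^sub>R v + t *\<^sub>R w"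
    have d: "?DT differentiable (at ?x)" using smooth_on_differentiable[OF smooth_on_fd[OF T] that] .
    have "((\<lambda>t. ?DT (z + s *\<^sub>R v + t *\<^sub>R w)) has_derivative
        (\<lambda>r. frechet_derivative ?DT (at ?x) (r *\<^sub>R w))) (at t)"
      by (rule has_derivative_compose[where f = "\<lambda>t. z + s *\<^sub>R v + t *\<^sub>R w" and g = ?DT,
            OF _ has_derivative_fd[OF d]])
         (auto intro!: derivative_eq_intros)
    moreover have "(\<lambda>r. frechet_derivative ?DT (at ?x) (r *\<^sub>R w)) = (*) (frechet_derivative ?DT (at ?x) w)"
      using fd_linear(1)[OF d, of _ w 0] linear_0[OF linear_frechet_derivative[OF d]] by auto
    ultimately show ?thesis by (simp add: has_field_derivative_def)
  qed
  have "\<exists>t>0. t < h \<and> ?DT (z + s *\<^sub>R v + h *\<^sub>R w) - ?DT (z + s *\<^sub>R v + 0 *\<^sub>R w) =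
      (h - 0) * frechet_derivative ?DT (at (z + s *\<^sub>R v + t *\<^sub>R w)) w"
    by (rule MVT2[OF \<open>0 < h\<close>]) (use line2 S s in auto)
  then obtain t where "0 < t" "t < h" and
    "?DT (z + s *\<^sub>R v + h *\<^sub>R w) - ?DT (z + s *\<^sub>R v) =
      h * frechet_derivative ?DT (at (z + s *\<^sub>R v + t *\<^sub>R w)) w" by auto
  moreover have "p h - p 0 = T (z + h *\<^sub>R v + h *\<^sub>R w) - T (z + h *\<^sub>R v) - T (z + h *\<^sub>R w) + T z"
    by (simp add: p_def)
  ultimately show ?thesis using that s p by simp
qed

lemma fd_commute:
  fixes T :: "'a::real_normed_vector \<Rightarrow> real"
  assumes "open S" "smooth_on S T" "z \<in> S"
  shows "frechet_derivative (\<lambda>x. frechet_derivative T (at x) v) (at z) w =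
    frechet_derivative (\<lambda>x. frechet_derivative T (at x) w) (at z) v" (is "?A z = ?B z")
proof (rule ccontr)
  assume ne: "?A z \<noteq> ?B z"
  define e where "e = \<bar>?A z - ?B z\<bar> / 2"
  have "0 < e" using ne by (simp add: e_def)
  have "continuous_on S ?A" "continuous_on S ?B"
    using assms(2) by (auto intro!: smooth_on_continuous_on smooth_on_fd)
  then have "isCont ?A z" "isCont ?B z"
    using assms(1,3) continuous_on_eq_continuous_at by blast+
  then obtain d1 d2 where "0 < d1" "0 < d2"
    and d1: "\<And>x. dist x z < d1 \<Longrightarrow> dist (?A x) (?A z) < e"
    and d2: "\<And>x. dist x z < d2 \<Longrightarrow> dist (?B x) (?B z) < e"
    using \<open>0 < e\<close> unfolding continuous_at_eps_delta by metis
  obtain d0 where "0 < d0" and d0: "ball z d0 \<subseteq> S"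
    using assms(1,3) open_contains_ball by blast
  define d where "d = min d0 (min d1 d2)"
  define h where "h = d / (2 * (norm v + norm w + 1))"
  have "0 < d" using \<open>0 < d0\<close> \<open>0 < d1\<close> \<open>0 < d2\<close> by (simp add: d_def)
  then have "0 < h" by (simp add: h_def add_nonneg_pos)
  have near: "dist (z + s *\<^sub>R v + t *\<^sub>R w) z < d" if "0 \<le> s" "s \<le> h" "0 \<le> t" "t \<le> h" for s t
  proof -
    have "dist (z + s *\<^sub>R v + t *\<^sub>R w) z \<le> norm (s *\<^sub>R v) + norm (t *\<^sub>R w)"
      using norm_triangle_ineq[of "s *\<^sub>R v" "t *\<^sub>R w"] by (simp add: dist_norm add.assoc)
    also have "\<dots> \<le> h * norm v + h * norm w"
      using that by (simp add: add_mono mult_right_mono)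
    also have "\<dots> < 2 * h * (norm v + norm w + 1)"
      using \<open>0 < h\<close> by (simp add: algebra_simps add_nonneg_pos)
    also have "\<dots> = d" using add_nonneg_pos[of "norm v + norm w" 1] by (simp add: h_def field_simps)
    finally show ?thesis .
  qed
  have inS: "x \<in> S" if "dist x z < d" for x
    using that d0 by (auto simp: d_def dist_commute)
  obtain s t where st: "0 < s" "s < h" "0 < t" "t < h"
    "T (z + h *\<^sub>R v + h *\<^sub>R w) - T (z + h *\<^sub>R v) - T (z + h *\<^sub>R w) + T z =
      h * h * ?A (z + s *\<^sub>R v + t *\<^sub>R w)"
    by (rule second_difference_mean_value[OF assms(2) \<open>0 < h\<close>, of z v w])
       (use near inS in auto)
  obtain s' t' where st': "0 < s'" "s' < h" "0 < t'" "t' < h"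
    "T (z + h *\<^sub>R w + h *\<^sub>R v) - T (z + h *\<^sub>R w) - T (z + h *\<^sub>R v) + T z =
      h * h * ?B (z + s' *\<^sub>R w + t' *\<^sub>R v)"
    by (rule second_difference_mean_value[OF assms(2) \<open>0 < h\<close>, of z w v])
       (use near inS in \<open>auto simp: add.assoc add.commute[of "_ *\<^sub>R w"]\<close>)
  have swap: "z + b *\<^sub>R w + a *\<^sub>R v = z + a *\<^sub>R v + b *\<^sub>R w" for a b by simp
  have "h * h * ?A (z + s *\<^sub>R v + t *\<^sub>R w) = h * h * ?B (z + t' *\<^sub>R v + s' *\<^sub>R w)"
    using st(5) st'(5)[unfolded swap] by linarith
  then have "?A (z + s *\<^sub>R v + t *\<^sub>R w) = ?B (z + t' *\<^sub>R v + s' *\<^sub>R w)"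
    using \<open>0 < h\<close> by simp
  moreover have "dist (?A (z + s *\<^sub>R v + t *\<^sub>R w)) (?A z) < e"
    using near[of s t] st by (intro d1) (simp add: d_def)
  moreover have "dist (?B (z + t' *\<^sub>R v + s' *\<^sub>R w)) (?B z) < e"
    using near[of t' s'] st' by (intro d2) (simp add: d_def)
  ultimately have "\<bar>?B (z + t' *\<^sub>R v + s' *\<^sub>R w) - ?A z\<bar> < e" "\<bar>?B (z + t' *\<^sub>R v + s' *\<^sub>R w) - ?B z\<bar> < e"
    by (simp_all add: dist_real_def)
  then have "\<bar>?A z - ?B z\<bar> < 2 * e" by linarith
  then show False by (simp add: e_def)
qed

lemma smooth_on_det:
  fixes M :: "'a::real_normed_vector \<Rightarrow> real ^ 'n ^ 'n"
  assumes "open S" "\<And>i j. smooth_on S (\<lambda>x. M x $ i $ j)"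
  shows "smooth_on S (\<lambda>x. det (M x))"
  unfolding det_def
  by (intro smooth_on_sum smooth_on_mult smooth_on_prod smooth_on_const assms)

lemma matrix_inv_right: "invertible A \<Longrightarrow> A ** matrix_inv A = mat 1"
  unfolding invertible_def matrix_inv_def by (metis (mono_tags, lifting) someI_ex)

lemma matrix_inv_left: "invertible A \<Longrightarrow> matrix_inv A ** A = mat 1"
  unfolding invertible_def matrix_inv_def by (metis (mono_tags, lifting) someI_ex)

text \<open>By Cramer's rule the entries of the inverse are rational functions of the entries.\<close>

lemma smooth_on_matrix_inv:
  fixes M :: "'a::real_normed_vector \<Rightarrow> real ^ 'n ^ 'n"
  assumes "open S" and M: "\<And>i j. smooth_on S (\<lambda>x. M x $ i $ j)"
    and inv: "\<And>x. x \<in> S \<Longrightarrow> invertible (M x)"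
  shows "smooth_on S (\<lambda>x. matrix_inv (M x) $ i $ j)"
proof -
  have det0: "det (M x) \<noteq> 0" if "x \<in> S" for x
    using inv[OF that] invertible_det_nz by blast
  let ?C = "\<lambda>x. (\<chi> a b. if b = i then axis j 1 $ a else M x $ a $ b) :: real ^ 'n ^ 'n"
  have "matrix_inv (M x) $ i $ j = det (?C x) / det (M x)" if "x \<in> S" for x
  proof -
    have "M x *v (matrix_inv (M x) *v axis j 1) = axis j 1"
      using matrix_inv_right[OF inv[OF that]] by (simp add: matrix_vector_mul_assoc)
    then have "matrix_inv (M x) *v axis j 1 =
        (\<chi> k. det (\<chi> a b. if b = k then axis j 1 $ a else M x $ a $ b) / det (M x))"
      using cramer[OF det0[OF that]] by blast
    then have "(matrix_inv (M x) *v axis j 1) $ i = det (?C x) / det (M x)"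
      by simp
    then show ?thesis by (simp add: matrix_vector_mul_component inner_axis)
  qed
  moreover have "smooth_on S (\<lambda>x. det (?C x) / det (M x))"
  proof (intro smooth_on_divide smooth_on_det assms(1) M det0)
    fix a b show "smooth_on S (\<lambda>x. ?C x $ a $ b)"
      by (cases "b = i") (simp_all add: smooth_on_const M)
  qed auto
  ultimately show ?thesis using smooth_on_transform[OF _ assms(1)] by (metis (mono_tags, lifting))
qed

section \<open>Integral curves of smooth vector fields\<close>

lemma smooth_on_lipschitz_cball:
  fixes f :: "'a::euclidean_space \<Rightarrow> 'b::real_normed_vector"
  assumes "smooth_on S f" "cball x0 r \<subseteq> S"
  obtains L where "0 < L" "\<And>x y. x \<in> cball x0 r \<Longrightarrow> y \<in> cball x0 r \<Longrightarrow> norm (f x - f y) \<le> L * norm (x - y)"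
proof -
  let ?D = "\<lambda>x. frechet_derivative f (at x)"
  have "compact ((\<lambda>x. \<Sum>b\<in>Basis. norm (?D x b)) ` cball x0 r)"
    using assms by (intro compact_continuous_image continuous_intros)
      (auto intro: continuous_on_subset[OF smooth_on_continuous_on[OF smooth_on_fd]])
  then obtain B where B: "\<And>x. x \<in> cball x0 r \<Longrightarrow> \<bar>\<Sum>b\<in>Basis. norm (?D x b)\<bar> \<le> B"
    unfolding bounded_iff image_iff by (force dest!: compact_imp_bounded simp: bounded_iff)
  have on: "onorm (?D x) \<le> max B 1" if x: "x \<in> cball x0 r" for x
  proof (rule onorm_le)
    fix v
    have "f differentiable (at x)" using assms x smooth_on_differentiable by blast
    then have "?D x v = (\<Sum>b\<in>Basis. (v \<bullet> b) *\<^sub>R ?D x b)"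
      using fd_linear(2)[of f x "\<lambda>b. v \<bullet> b" "\<lambda>b. b" Basis] by (simp add: euclidean_representation)
    also have "norm \<dots> \<le> (\<Sum>b\<in>Basis. norm v * norm (?D x b))"
      by (rule sum_norm_le) (auto intro!: mult_right_mono Basis_le_norm)
    also have "\<dots> = norm v * (\<Sum>b\<in>Basis. norm (?D x b))" by (simp add: sum_distrib_left)
    also have "\<dots> \<le> norm v * max B 1" using B[OF x] by (intro mult_left_mono) auto
    finally show "norm (?D x v) \<le> max B 1 * norm v" by (simp add: mult.commute)
  qed
  have der: "(f has_derivative ?D x) (at x within cball x0 r)" if "x \<in> cball x0 r" for x
    using smooth_on_has_derivative[OF assms(1)] assms(2) that has_derivative_at_withinI by blast
  show ?thesis
  proof (rule that[of "max B 1"])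
    fix x y assume "x \<in> cball x0 r" "y \<in> cball x0 r"
    then show "norm (f x - f y) \<le> max B 1 * norm (x - y)"
      using differentiable_bound[OF convex_cball der on] by blast
  qed simp
qed

lemma norm_integral_diff_le:
  fixes u :: "real \<Rightarrow> 'a::banach"
  assumes "continuous_on {a..b} u" "\<And>t. t \<in> {a..b} \<Longrightarrow> norm (u t) \<le> B"
    "s \<in> {a..b}" "t \<in> {a..b}"
  shows "norm (integral {a..s} u - integral {a..t} u) \<le> B * \<bar>s - t\<bar>"
proof -
  have "norm (integral {a..s} u - integral {a..t} u) \<le> B * norm (s - t)"
  proof (rule differentiable_bound[where f' = "\<lambda>t h. h *\<^sub>R u t"])
    show "((\<lambda>x. integral {a..x} u) has_derivative (\<lambda>h. h *\<^sub>R u x)) (at x within {a..b})"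
      if "x \<in> {a..b}" for x
      using integral_has_vector_derivative[OF assms(1) that] by (simp add: has_vector_derivative_def)
    show "onorm (\<lambda>h. h *\<^sub>R u x) \<le> B" if "x \<in> {a..b}" for x
      using assms(2)[OF that]
      by (intro onorm_le) (simp add: mult.commute[of B] mult_left_mono)
  qed (use assms in auto)
  then show ?thesis by simp
qed

text \<open>The Picard--Lindelof theorem: on a short time interval the integral operator of the differential
  equation contracts the bounded continuous curves that stay in a small ball.\<close>

lemma ex_integral_curve:
  fixes X :: "'a::euclidean_space \<Rightarrow> 'a"
  assumes "open S" "smooth_on S X" "x0 \<in> S"
  obtains e \<eta> where "0 < e" "\<eta> 0 = x0" "\<And>t. t \<in> {-e<..<e} \<Longrightarrow> \<eta> t \<in> S"
    "\<And>t. t \<in> {-e<..<e} \<Longrightarrow> (\<eta> has_vector_derivative X (\<eta> t)) (at t)"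
proof -
  obtain r where "0 < r" and rS: "cball x0 r \<subseteq> S"
    using assms open_contains_cball by blast
  obtain L where "0 < L" and
    L: "\<And>x y. x \<in> cball x0 r \<Longrightarrow> y \<in> cball x0 r \<Longrightarrow> norm (X x - X y) \<le> L * norm (x - y)"
    using smooth_on_lipschitz_cball[OF assms(2) rS] by blast
  have contX: "continuous_on (cball x0 r) X"
    using smooth_on_continuous_on[OF assms(2)] rS continuous_on_subset by blast
  obtain M where "0 < M" and M: "\<And>x. x \<in> cball x0 r \<Longrightarrow> norm (X x) \<le> M"
    using compact_imp_bounded[OF compact_continuous_image[OF contX compact_cball], unfolded bounded_pos]
    by blast
  \<comment> \<open>Up to time \<open>r / M\<close> a curve of speed at most \<open>M\<close> stays in the ball, and up to time
    \<open>1 / (2 L)\<close> the integral operator contracts distances by the factor \<open>1/2\<close>.\<close>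
  define e where "e = min (r / M) (1 / (2 * L))"
  have "0 < e" using \<open>0 < r\<close> \<open>0 < M\<close> \<open>0 < L\<close> by (simp add: e_def)
  have eM: "M * e \<le> r" and eL: "L * e \<le> 1/2"
    using \<open>0 < M\<close> \<open>0 < L\<close> by (auto simp: e_def min_def field_simps)
  \<comment> \<open>Clamping the time turns curves on the interval into elements of the complete space of bounded
    continuous functions on the whole line.\<close>
  define c where "c t = max (-e) (min e t)" for t :: real
  have c: "c t \<in> {-e..e}" "\<bar>c t\<bar> \<le> e" for t using \<open>0 < e\<close> by (auto simp: c_def)
  have c_id: "c t = t" if "t \<in> {-e..e}" for t using that by (auto simp: c_def)
  have cont_c: "continuous_on UNIV c" unfolding c_def by (intro continuous_intros)
  define Z where "Z = PiC UNIV (\<lambda>_::real. cball x0 r)"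
  \<comment> \<open>A difference of two integrals, because \<open>s\<close> may be negative.\<close>
  define J where "J \<phi> s = integral {-e..s} (\<lambda>t. X (apply_bcontfun \<phi> t)) -
      integral {-e..0} (\<lambda>t. X (apply_bcontfun \<phi> t))" for \<phi> and s
  define P where "P \<phi> = Bcontfun (\<lambda>t. x0 + J \<phi> (c t))" for \<phi>
  have Z: "apply_bcontfun \<phi> t \<in> cball x0 r" if "\<phi> \<in> Z" for \<phi> t
    using that by (auto simp: Z_def mem_PiC_iff)
  have cont: "continuous_on {-e..e} (\<lambda>t. X (apply_bcontfun \<phi> t))" if "\<phi> \<in> Z" for \<phi>
    by (rule continuous_on_compose2[OF contX]) (use Z[OF that] in auto)
  have J_deriv: "(J \<phi> has_vector_derivative X (apply_bcontfun \<phi> s)) (at s within {-e..e})"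
    if "\<phi> \<in> Z" "s \<in> {-e..e}" for \<phi> s
    unfolding J_def
    using has_vector_derivative_diff[OF integral_has_vector_derivative[OF cont[OF that(1)] that(2)]
        has_vector_derivative_const] by simp
  have J_bound: "norm (J \<phi> s) \<le> r" if "\<phi> \<in> Z" "s \<in> {-e..e}" for \<phi> s
  proof -
    have "norm (J \<phi> s) \<le> M * \<bar>s - 0\<bar>"
      unfolding J_def using \<open>0 < e\<close>
      by (intro norm_integral_diff_le[OF cont[OF that(1)] M[OF Z[OF that(1)]] that(2)]) auto
    also have "\<dots> \<le> M * e" using that(2) \<open>0 < M\<close> by (intro mult_left_mono) auto
    finally show ?thesis using eM by simp
  qed
  have P_apply: "apply_bcontfun (P \<phi>) t = x0 + J \<phi> (c t)" if "\<phi> \<in> Z" for \<phi> t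
  proof -
    have "continuous_on {-e..e} (J \<phi>)"
      unfolding continuous_on_eq_continuous_within
      by (intro ballI has_vector_derivative_continuous[OF J_deriv[OF that]])
    then have "continuous_on UNIV (\<lambda>t. x0 + J \<phi> (c t))"
      using c by (intro continuous_intros continuous_on_compose2[OF _ cont_c]) auto
    moreover have "bounded (range (\<lambda>t. x0 + J \<phi> (c t)))"
      by (rule bounded_subset[OF bounded_cball[of x0 r]])
        (use J_bound[OF that c(1)] in \<open>auto simp: dist_norm\<close>)
    ultimately show ?thesis unfolding P_def by (simp add: Bcontfun_inverse bcontfun_def)
  qed
  have "\<exists>!\<phi>. \<phi> \<in> Z \<and> P \<phi> = \<phi>"
  proof (rule Banach_fix[of Z "1/2"])
    show "complete Z" unfolding Z_def by (simp add: complete_eq_closed closed_PiC)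
    show "Z \<noteq> {}"
      using \<open>0 < r\<close> by (intro ex_in_conv[THEN iffD1] exI[of _ "const_bcontfun x0"])
        (auto simp: Z_def mem_PiC_iff const_bcontfun.rep_eq)
    show "P ` Z \<subseteq> Z"
    proof
      fix \<psi> assume "\<psi> \<in> P ` Z"
      then obtain \<phi> where "\<phi> \<in> Z" "\<psi> = P \<phi>" by blast
      then have "apply_bcontfun \<psi> t \<in> cball x0 r" for t
        using J_bound[OF _ c(1)] by (simp add: P_apply dist_norm)
      then show "\<psi> \<in> Z" by (simp add: Z_def mem_PiC_iff)
    qed
    fix \<phi> \<psi> assume pq: "\<phi> \<in> Z" "\<psi> \<in> Z"
    show "dist (P \<phi>) (P \<psi>) \<le> 1 / 2 * dist \<phi> \<psi>"
    proof (rule dist_bound)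
      fix t
      let ?u = "\<lambda>t. X (apply_bcontfun \<phi> t) - X (apply_bcontfun \<psi> t)"
      have split: "integral {-e..s} ?u = integral {-e..s} (\<lambda>t. X (apply_bcontfun \<phi> t)) -
          integral {-e..s} (\<lambda>t. X (apply_bcontfun \<psi> t))" if "s \<in> {-e..e}" for s
        using that by (intro integral_diff integrable_continuous_interval
            continuous_on_subset[OF cont[OF pq(1)]] continuous_on_subset[OF cont[OF pq(2)]]) auto
      have bound: "norm (?u s) \<le> L * dist \<phi> \<psi>" for s
      proof -
        have "norm (?u s) \<le> L * dist (apply_bcontfun \<phi> s) (apply_bcontfun \<psi> s)"
          using L[OF Z[OF pq(1)] Z[OF pq(2)]] by (simp add: dist_norm)
        also have "\<dots> \<le> L * dist \<phi> \<psi>" using \<open>0 < L\<close> by (simp add: dist_bounded)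
        finally show ?thesis .
      qed
      have "dist (P \<phi> t) (P \<psi> t) = norm (integral {-e..c t} ?u - integral {-e..0} ?u)"
        using c \<open>0 < e\<close> by (simp add: P_apply pq J_def split dist_norm algebra_simps)
      also have "\<dots> \<le> (L * dist \<phi> \<psi>) * \<bar>c t - 0\<bar>"
        using c \<open>0 < e\<close>
        by (intro norm_integral_diff_le[OF continuous_on_diff[OF cont[OF pq(1)] cont[OF pq(2)]] bound]) auto
      also have "\<dots> \<le> (L * dist \<phi> \<psi>) * e"
        using c \<open>0 < L\<close> by (intro mult_left_mono) auto
      also have "\<dots> = (L * e) * dist \<phi> \<psi>" by simp
      also have "\<dots> \<le> 1/2 * dist \<phi> \<psi>" using eL by (intro mult_right_mono) auto
      finally show "dist (P \<phi> t) (P \<psi> t) \<le> 1 / 2 * dist \<phi> \<psi>" .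
    qed
  qed auto
  then obtain \<phi> where \<phi>: "\<phi> \<in> Z" "P \<phi> = \<phi>" by blast
  have eq: "apply_bcontfun \<phi> t = x0 + J \<phi> t" if "t \<in> {-e..e}" for t
    using P_apply[OF \<phi>(1), of t] \<phi>(2) c_id[OF that] by simp
  show ?thesis
  proof (rule that[OF \<open>0 < e\<close>, of "apply_bcontfun \<phi>"])
    show "\<phi> 0 = x0" using eq[of 0] \<open>0 < e\<close> by (simp add: J_def)
    fix t assume t: "t \<in> {-e<..<e}"
    show "\<phi> t \<in> S" using Z[OF \<phi>(1)] rS by blast
    have "(J \<phi> has_vector_derivative X (\<phi> t)) (at t)"
      using J_deriv[OF \<phi>(1), of t] t by (simp add: at_within_Icc_at)
    then have "((\<lambda>t. x0 + J \<phi> t) has_vector_derivative X (\<phi> t)) (at t)"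
      by (auto intro!: derivative_eq_intros)
    then show "(\<phi> has_vector_derivative X (\<phi> t)) (at t)"
      by (rule has_vector_derivative_transform_within_open[OF _ open_greaterThanLessThan t])
         (simp add: eq)
  qed
qed

section \<open>Derivations in natural coordinates\<close>

text \<open>The operators \<open>dx i\<close>, \<open>dy i\<close> and \<open>dh f i\<close> are all derivatives along vector fields, which
  is what makes the rules of calculus available to them uniformly.\<close>

definition derivation_on :: "'a::real_normed_vector set \<Rightarrow> (('a \<Rightarrow> real) \<Rightarrow> 'a \<Rightarrow> real) \<Rightarrow> bool"
  where "derivation_on S d \<longleftrightarrow>
    (\<exists>w. \<forall>T z. smooth_on S T \<longrightarrow> z \<in> S \<longrightarrow> d T z = frechet_derivative T (at z) (w z))"

lemma derivation_on_add:
  assumes "open S" "derivation_on S d" "smooth_on S T" "smooth_on S U" "z \<in> S"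
  shows "d (\<lambda>z. T z + U z) z = d T z + d U z"
proof -
  obtain w where w: "\<And>T z. smooth_on S T \<Longrightarrow> z \<in> S \<Longrightarrow> d T z = frechet_derivative T (at z) (w z)"
    using assms(2) unfolding derivation_on_def by blast
  show ?thesis
    using assms(3-5) by (simp add: w smooth_on_add assms(1) fd_add smooth_on_differentiable)
qed

lemma derivation_on_diff:
  assumes "open S" "derivation_on S d" "smooth_on S T" "smooth_on S U" "z \<in> S"
  shows "d (\<lambda>z. T z - U z) z = d T z - d U z"
proof -
  obtain w where w: "\<And>T z. smooth_on S T \<Longrightarrow> z \<in> S \<Longrightarrow> d T z = frechet_derivative T (at z) (w z)"
    using assms(2) unfolding derivation_on_def by blast
  show ?thesis
    using assms(3-5) by (simp add: w smooth_on_diff assms(1) fd_diff smooth_on_differentiable)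
qed

lemma derivation_on_mult:
  assumes "open S" "derivation_on S d" "smooth_on S T" "smooth_on S U" "z \<in> S"
  shows "d (\<lambda>z. T z * U z) z = d T z * U z + T z * d U z"
proof -
  obtain w where w: "\<And>T z. smooth_on S T \<Longrightarrow> z \<in> S \<Longrightarrow> d T z = frechet_derivative T (at z) (w z)"
    using assms(2) unfolding derivation_on_def by blast
  show ?thesis
    using assms(3-5) by (simp add: w smooth_on_mult assms(1) fd_mult smooth_on_differentiable)
qed

lemma derivation_on_cdivide:
  fixes T :: "'a::real_normed_vector \<Rightarrow> real"
  assumes "open S" "derivation_on S d" "smooth_on S T" "z \<in> S"
  shows "d (\<lambda>z. T z / c) z = d T z / c"
proof -
  have "d (\<lambda>z. T z * inverse c) z = d T z * inverse c + T z * d (\<lambda>z. inverse c) z"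
    by (rule derivation_on_mult[OF assms(1-3) smooth_on_const assms(4)])
  moreover have "d (\<lambda>z. inverse c) z = 0"
    using assms(2,4) smooth_on_const[of S "inverse c"] unfolding derivation_on_def
    by (auto simp: frechet_derivative_const)
  ultimately show ?thesis by (simp add: divide_inverse)
qed

lemma derivation_on_const:
  assumes "derivation_on S d" "z \<in> S"
  shows "d (\<lambda>z. c) z = 0"
  using assms smooth_on_const[of S c] unfolding derivation_on_def
  by (auto simp: frechet_derivative_const)

lemma derivation_on_sum:
  assumes "open S" "derivation_on S d" "\<And>i. i \<in> I \<Longrightarrow> smooth_on S (T i)" "z \<in> S"
  shows "d (\<lambda>z. \<Sum>i\<in>I. T i z) z = (\<Sum>i\<in>I. d (T i) z)"
proof -
  obtain w where w: "\<And>T z. smooth_on S T \<Longrightarrow> z \<in> S \<Longrightarrow> d T z = frechet_derivative T (at z) (w z)"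
    using assms(2) unfolding derivation_on_def by blast
  show ?thesis
    using assms(3,4) fd_sum[of I T z, OF smooth_on_differentiable[OF assms(3,4)]]
    by (simp add: w smooth_on_sum assms(1))
qed

lemma derivation_on_cong:
  assumes "open S" "derivation_on S d" "smooth_on S T" "z \<in> S" "\<And>z. z \<in> S \<Longrightarrow> T z = U z"
  shows "d U z = d T z"
proof -
  have "smooth_on S U" by (rule smooth_on_transform[OF assms(3,1,5)])
  moreover obtain w where w: "\<And>T z. smooth_on S T \<Longrightarrow> z \<in> S \<Longrightarrow> d T z = frechet_derivative T (at z) (w z)"
    using assms(2) unfolding derivation_on_def by blast
  ultimately show ?thesis
    using fd_cong[OF smooth_on_differentiable[OF assms(3,4)] assms(1,4,5)] assms(3,4) by (simp add: w)
qed

lemma derivation_on_dx: "derivation_on S (dx i)"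
  unfolding derivation_on_def dx_def by (intro exI[of _ "\<lambda>_. (axis i 1, 0)"]) simp

lemma derivation_on_dy: "derivation_on S (dy i)"
  unfolding derivation_on_def dy_def by (intro exI[of _ "\<lambda>_. (0, axis i 1)"]) simp

lemma derivation_on_dh:
  fixes f :: "'a::finite loc"
  shows "derivation_on S (dh f i)"
  unfolding derivation_on_def
proof (intro exI allI impI)
  fix T :: "'a loc" and z
  let ?w = "\<lambda>z. (- 1) *\<^sub>R (\<Sum>m\<in>UNIV. nonlin f m i z *\<^sub>R (0, axis m 1)) + (axis i 1, 0)"
  assume "smooth_on S T" "z \<in> S"
  then have "T differentiable (at z)" by (rule smooth_on_differentiable)
  then show "dh f i T z = frechet_derivative T (at z) (?w z)"
    by (simp only: fd_linear dh_def dx_def dy_def) simp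
qed

lemma dx_dy_commute:
  assumes "open S" "smooth_on S T" "z \<in> S"
  shows "dy i (dx j T) z = dx j (dy i T) z" "dx i (dx j T) z = dx j (dx i T) z"
    "dy i (dy j T) z = dy j (dy i T) z"
  using fd_commute[OF assms] unfolding dx_def dy_def by (simp_all add: fun_eq_iff)

text \<open>Almost all index manipulations below are instances of the associativity of contraction.\<close>

lemma contract_swap:
  fixes a :: "'i \<Rightarrow> real" and b :: "'i \<Rightarrow> 'm \<Rightarrow> real" and c :: "'m \<Rightarrow> real"
  shows "(\<Sum>i\<in>I. a i * (\<Sum>m\<in>M. b i m * c m)) = (\<Sum>m\<in>M. (\<Sum>i\<in>I. a i * b i m) * c m)"
  unfolding sum_distrib_left sum_distrib_right mult.assoc by (rule sum.swap)

lemma sum_delta_mult [simp]: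
  fixes h :: "'n::finite \<Rightarrow> real"
  shows "(\<Sum>j\<in>UNIV. (if i = j then 1 else 0) * h j) = h i"
    "(\<Sum>j\<in>UNIV. (if j = i then 1 else 0) * h j) = h i"
    "(\<Sum>j\<in>UNIV. h j * (if i = j then 1 else 0)) = h i"
    "(\<Sum>j\<in>UNIV. h j * (if j = i then 1 else 0)) = h i"
  by (simp_all add: if_distrib[of "\<lambda>c. c * _"] if_distrib[of "\<lambda>c. _ * c"] cong: if_cong)


section \<open>The local calculus of a Finsler structure\<close>

locale finsler_domain =
  fixes \<Omega> :: "(real ^ 'n::finite) set" and f :: "'n loc"
  assumes open_base: "open \<Omega>"
    and smooth_F: "smooth_on (\<Omega> \<times> - {0}) f"
    and homogeneous: "\<And>x y t. x \<in> \<Omega> \<Longrightarrow> y \<noteq> 0 \<Longrightarrow> 0 < t \<Longrightarrow> f (x, t *\<^sub>R y) = t * f (x, y)"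
    and positive_definite: "\<And>z u. z \<in> \<Omega> \<times> - {0} \<Longrightarrow> u \<noteq> 0 \<Longrightarrow>
      0 < (\<Sum>i\<in>UNIV. \<Sum>j\<in>UNIV. g_lo f i j z * u $ i * u $ j)"
begin

abbreviation S :: "((real ^ 'n) \<times> (real ^ 'n)) set" where "S \<equiv> \<Omega> \<times> - {0}"

abbreviation g :: "'n \<Rightarrow> 'n \<Rightarrow> 'n loc" where "g \<equiv> g_lo f"

abbreviation y :: "'n \<Rightarrow> 'n loc" where "y i z \<equiv> snd z $ i"

abbreviation N :: "'n \<Rightarrow> 'n \<Rightarrow> 'n loc" where "N \<equiv> nonlin f"

abbreviation \<Gamma> :: "'n \<Rightarrow> 'n \<Rightarrow> 'n \<Rightarrow> 'n loc" where "\<Gamma> \<equiv> chern f"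

lemma open_S: "open S"
  using open_base by (intro open_Times) auto

lemmas der_rules [simp] =
  derivation_on_add[OF open_S derivation_on_dx] derivation_on_diff[OF open_S derivation_on_dx]
  derivation_on_mult[OF open_S derivation_on_dx] derivation_on_const[OF derivation_on_dx, of _ S]
  derivation_on_sum[OF open_S derivation_on_dx] derivation_on_cdivide[OF open_S derivation_on_dx]
  derivation_on_add[OF open_S derivation_on_dy] derivation_on_diff[OF open_S derivation_on_dy]
  derivation_on_mult[OF open_S derivation_on_dy] derivation_on_const[OF derivation_on_dy, of _ S]
  derivation_on_sum[OF open_S derivation_on_dy] derivation_on_cdivide[OF open_S derivation_on_dy]
  derivation_on_add[OF open_S derivation_on_dh] derivation_on_diff[OF open_S derivation_on_dh]
  derivation_on_mult[OF open_S derivation_on_dh] derivation_on_const[OF derivation_on_dh, of _ S]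
  derivation_on_sum[OF open_S derivation_on_dh] derivation_on_cdivide[OF open_S derivation_on_dh]

lemmas dx_cong = derivation_on_cong[OF open_S derivation_on_dx]
lemmas dy_cong = derivation_on_cong[OF open_S derivation_on_dy]
lemmas dh_cong = derivation_on_cong[OF open_S derivation_on_dh]

lemma smooth_y [simp]: "smooth_on S (y k)"
proof -
  have "bounded_linear (\<lambda>z::(real ^ 'n) \<times> (real ^ 'n). snd z $ k)"
    using bounded_linear_compose[OF bounded_linear_vec_nth bounded_linear_snd] .
  from smooth_on_linear_compose[OF this open_S smooth_on_ident] show ?thesis .
qed

lemma der_y [simp]:
  assumes "z \<in> S"
  shows "dx i (y k) z = 0" "dy i (y k) z = (if i = k then 1 else 0)" "dh f i (y k) z = - N k i z"
proof -
  have "((\<lambda>z::(real ^ 'n) \<times> (real ^ 'n). snd z $ k) has_derivative (\<lambda>v. snd v $ k)) (at z)"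
    by (intro bounded_linear_imp_has_derivative
        bounded_linear_compose[OF bounded_linear_vec_nth bounded_linear_snd])
  then show 1: "dx i (y k) z = 0" "dy i (y k) z = (if i = k then 1 else 0)" for i
    unfolding dx_def dy_def by (subst fd_eqI, assumption, auto simp: axis_def)+
  show "dh f i (y k) z = - N k i z" by (simp add: dh_def 1)
qed

lemma smooth_dx [simp]: "smooth_on S T \<Longrightarrow> smooth_on S (dx i T)"
  unfolding dx_def[abs_def] by (rule smooth_on_fd)

lemma smooth_dy [simp]: "smooth_on S T \<Longrightarrow> smooth_on S (dy i T)"
  unfolding dy_def[abs_def] by (rule smooth_on_fd)

lemmas smooth_rules [simp] =
  smooth_on_const[of S] smooth_on_add[OF open_S] smooth_on_diff[OF open_S]
  smooth_on_mult[OF open_S] smooth_on_sum[OF open_S] smooth_on_minus[OF open_S]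
  smooth_on_mult[OF open_S _ smooth_on_const, of _ "inverse c" for c, folded divide_inverse]

lemma smooth_F2 [simp]: "smooth_on S (\<lambda>z. (f z)\<^sup>2)"
  by (rule smooth_on_power2[OF open_S smooth_F])

lemma smooth_g [simp]: "smooth_on S (g i j)"
  unfolding g_lo_def[abs_def] by simp

lemma invertible_g:
  assumes "z \<in> S"
  shows "invertible (\<chi> i j. g i j z)"
proof -
  have "u = 0" if "(\<chi> i j. g i j z) *v u = 0" for u :: "real ^ 'n"
  proof (rule ccontr)
    assume "u \<noteq> 0"
    have "(\<Sum>j\<in>UNIV. g i j z * u $ j) = 0" for i
      using arg_cong[OF that, of "\<lambda>v. v $ i"] by (simp add: matrix_vector_mult_def)
    then have "(\<Sum>i\<in>UNIV. \<Sum>j\<in>UNIV. g i j z * u $ i * u $ j) = 0"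
      by (simp add: mult.commute mult.left_commute flip: sum_distrib_left)
    then show False using positive_definite[OF assms \<open>u \<noteq> 0\<close>] by simp
  qed
  then show ?thesis
    using matrix_left_invertible_ker invertible_left_inverse by blast
qed

lemma smooth_g_up [simp]: "smooth_on S (g_up f i j)"
  unfolding g_up_def[abs_def]
  by (rule smooth_on_matrix_inv[OF open_S]) (auto intro!: invertible_g)

lemma g_g_up:
  assumes "z \<in> S"
  shows "(\<Sum>s\<in>UNIV. g i s z * g_up f s j z) = (if i = j then 1 else 0)"
    "(\<Sum>s\<in>UNIV. g_up f i s z * g s j z) = (if i = j then 1 else 0)"
  using arg_cong[OF matrix_inv_right[OF invertible_g[OF assms]], of "\<lambda>M. M $ i $ j"]
    arg_cong[OF matrix_inv_left[OF invertible_g[OF assms]], of "\<lambda>M. M $ i $ j"]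
  by (simp_all add: matrix_matrix_mult_def mat_def g_up_def)

lemma lower_raise:
  assumes "z \<in> S"
  shows "(\<Sum>i\<in>UNIV. g a i z * (\<Sum>s\<in>UNIV. g_up f i s z * w s)) = w a"
proof -
  have "(\<Sum>i\<in>UNIV. g a i z * (\<Sum>s\<in>UNIV. g_up f i s z * w s)) =
      (\<Sum>s\<in>UNIV. (\<Sum>i\<in>UNIV. g a i z * g_up f i s z) * w s)"
    by (rule contract_swap)
  then show ?thesis by (simp add: g_g_up assms)
qed

lemma lower_cancel:
  assumes "z \<in> S" "\<And>a. (\<Sum>i\<in>UNIV. g a i z * u i) = (\<Sum>i\<in>UNIV. g a i z * v i)"
  shows "u i = v i"
proof -
  have "u i = (\<Sum>a\<in>UNIV. g_up f i a z * (\<Sum>b\<in>UNIV. g a b z * u b))" for u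
  proof -
    have "(\<Sum>a\<in>UNIV. g_up f i a z * (\<Sum>b\<in>UNIV. g a b z * u b)) =
        (\<Sum>b\<in>UNIV. (\<Sum>a\<in>UNIV. g_up f i a z * g a b z) * u b)"
      by (rule contract_swap)
    then show ?thesis by (simp add: g_g_up assms)
  qed
  from this[of u] this[of v] show ?thesis using assms(2) by simp
qed

lemma smooth_spray [simp]: "smooth_on S (spray f i)"
  unfolding spray_def[abs_def] by simp

lemma smooth_N [simp]: "smooth_on S (N i m)"
  unfolding nonlin_def by simp

lemma smooth_dh [simp]: "smooth_on S T \<Longrightarrow> smooth_on S (dh f i T)"
  unfolding dh_def[abs_def] by simp

lemma smooth_\<Gamma> [simp]: "smooth_on S (\<Gamma> i j k)"
  unfolding chern_def[abs_def] by simp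

text \<open>Euler's identity for \<open>F\<^sup>2\<close>, which is homogeneous of degree 2. Its fibre derivatives give
  \<open>y\<^sub>j = \<partial>(F\<^sup>2/2)/\<partial>y\<^sup>j\<close>, then \<open>\<partial>y\<^sub>k/\<partial>y\<^sup>l = g\<^sub>k\<^sub>l\<close>, and finally that the Cartan tensor, which is totally
  symmetric, is killed by \<open>y\<close>.\<close>

lemma Euler_F2:
  assumes "z \<in> S"
  shows "(\<Sum>k\<in>UNIV. y k z * dy k (\<lambda>z. (f z)\<^sup>2) z) = 2 * (f z)\<^sup>2"
proof -
  obtain x v where z: "z = (x, v)" "x \<in> \<Omega>" "v \<noteq> 0" using assms by auto
  let ?\<phi> = "\<lambda>z. (f z)\<^sup>2"
  let ?D = "frechet_derivative ?\<phi> (at z)"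
  have d: "?\<phi> differentiable (at z)" using smooth_on_differentiable[OF smooth_F2 assms] .
  have "((\<lambda>t. ?\<phi> (x, t *\<^sub>R v)) has_derivative (\<lambda>r. ?D (0, r *\<^sub>R v))) (at 1)"
    by (rule has_derivative_compose[where f = "\<lambda>t. (x, t *\<^sub>R v)" and g = ?\<phi>])
       (use has_derivative_fd[OF d] z in \<open>auto intro!: derivative_eq_intros\<close>)
  moreover have "((\<lambda>t. ?\<phi> (x, t *\<^sub>R v)) has_derivative (\<lambda>r. 2 * r * ?\<phi> z)) (at 1)"
    by (rule has_derivative_transform_within_open[where f = "\<lambda>t. t\<^sup>2 * ?\<phi> z" and s = "{0<..}"])
       (use z homogeneous in \<open>auto intro!: derivative_eq_intros simp: power_mult_distrib\<close>)
  ultimately have "?D (0, 1 *\<^sub>R v) = 2 * 1 * ?\<phi> z"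
    using has_derivative_unique by metis
  moreover have "(0, v) = (\<Sum>k\<in>UNIV. v $ k *\<^sub>R (0::real ^ 'n, axis k (1::real)))"
    by (simp add: sum_prod prod_eq_iff fst_sum snd_sum vec_eq_iff axis_def if_distrib cong: if_cong)
  ultimately show ?thesis
    using fd_linear(2)[OF d, of "\<lambda>k. v $ k" "\<lambda>k. (0, axis k 1)" UNIV] z by (simp add: dy_def)
qed

definition y_lo :: "'n \<Rightarrow> 'n loc"
  where "y_lo k z = (\<Sum>j\<in>UNIV. g k j z * y j z)"

lemma smooth_y_lo [simp]: "smooth_on S (y_lo i)"
  unfolding y_lo_def[abs_def] by simp

lemma g_sym: "z \<in> S \<Longrightarrow> g i j z = g j i z"
  unfolding g_lo_def using dx_dy_commute(3)[OF open_S smooth_F2] by simp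

lemma dy_F2:
  assumes "z \<in> S"
  shows "dy j (\<lambda>z. (f z)\<^sup>2) z = 2 * y_lo j z"
proof -
  have "dy j (\<lambda>z. 2 * (f z)\<^sup>2) z = dy j (\<lambda>z. \<Sum>k\<in>UNIV. y k z * dy k (\<lambda>z. (f z)\<^sup>2) z) z"
    by (rule dy_cong) (simp_all add: assms Euler_F2)
  then show ?thesis
    using assms by (simp add: sum.distrib y_lo_def g_lo_def sum_distrib_left mult.commute)
qed

lemma F2_eq:
  assumes "z \<in> S"
  shows "(f z)\<^sup>2 = (\<Sum>k\<in>UNIV. y_lo k z * y k z)"
  using Euler_F2[OF assms] by (simp add: dy_F2 assms mult.commute mult.left_commute flip: sum_distrib_left)

lemma F2_eq_g:
  assumes "z \<in> S"
  shows "(f z)\<^sup>2 = (\<Sum>i\<in>UNIV. \<Sum>j\<in>UNIV. g i j z * y i z * y j z)"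
  unfolding F2_eq[OF assms] y_lo_def by (simp add: sum_distrib_right sum_distrib_left ac_simps)

lemma F2_pos:
  assumes "z \<in> S"
  shows "0 < (f z)\<^sup>2"
proof -
  have "snd z \<noteq> 0" using assms by auto
  then show ?thesis using positive_definite[OF assms, of "snd z"] by (simp add: F2_eq_g assms)
qed

lemma dy_y_lo:
  assumes "z \<in> S"
  shows "dy l (y_lo k) z = g k l z"
proof -
  have "dy l (y_lo k) z = dy l (\<lambda>z. 1/2 * dy k (\<lambda>z. (f z)\<^sup>2) z) z"
    by (rule dy_cong) (simp_all add: assms dy_F2)
  then show ?thesis using assms g_sym[OF assms, of k l] by (simp add: g_lo_def)
qed

lemma dy_g_sym:
  assumes "z \<in> S"
  shows "dy k (g i j) z = dy k (g j i) z" "dy k (g i j) z = dy i (g k j) z"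
proof -
  show "dy k (g i j) z = dy k (g j i) z"
    by (rule dy_cong) (simp_all add: assms g_sym)
  show "dy k (g i j) z = dy i (g k j) z"
    using dx_dy_commute(3)[OF open_S smooth_dy[OF smooth_F2], of z] assms
    by (simp add: g_lo_def[abs_def])
qed

lemma dy_g_y:
  assumes "z \<in> S"
  shows "(\<Sum>j\<in>UNIV. dy k (g i j) z * y j z) = 0" "(\<Sum>j\<in>UNIV. dy k (g j i) z * y j z) = 0"
    "(\<Sum>j\<in>UNIV. dy j (g k i) z * y j z) = 0"
proof -
  show *: "(\<Sum>j\<in>UNIV. dy k (g i j) z * y j z) = 0" for i k
    using dy_y_lo[OF assms, of k i] assms unfolding y_lo_def[abs_def] by (simp add: sum.distrib)
  show "(\<Sum>j\<in>UNIV. dy k (g j i) z * y j z) = 0" for i k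
    using *[of k i] dy_g_sym(1)[OF assms, of k i] by simp
  then show "(\<Sum>j\<in>UNIV. dy j (g k i) z * y j z) = 0"
    using dy_g_sym(2)[OF assms, of _ k i] by simp
qed

lemma dy_dx_g_y:
  assumes "z \<in> S"
  shows "(\<Sum>k\<in>UNIV. dy m (dx j (g a k)) z * y k z) = 0"
    "(\<Sum>k\<in>UNIV. dy m (dx j (g k a)) z * y k z) = 0"
proof -
  have "dx j (\<lambda>z. \<Sum>k\<in>UNIV. dy m (g a k) z * y k z) z = dx j (\<lambda>z. 0) z"
    by (rule dx_cong) (simp_all add: assms dy_g_y)
  then show *: "(\<Sum>k\<in>UNIV. dy m (dx j (g a k)) z * y k z) = 0"
    using assms by (simp add: dx_dy_commute(1)[OF open_S])
  have "dx j (\<lambda>z. \<Sum>k\<in>UNIV. dy m (g k a) z * y k z) z = dx j (\<lambda>z. 0) z"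
    by (rule dx_cong) (simp_all add: assms dy_g_y)
  then show *: "(\<Sum>k\<in>UNIV. dy m (dx j (g k a)) z * y k z) = 0"
    using assms by (simp add: dx_dy_commute(1)[OF open_S])
qed

section \<open>The nonlinear connection and the Chern connection\<close>

text \<open>Twice the Christoffel symbols of the first kind.\<close>

definition chr1 :: "'n \<Rightarrow> 'n \<Rightarrow> 'n \<Rightarrow> 'n loc"
  where "chr1 a j k z = dx j (g a k) z + dx k (g a j) z - dx a (g k j) z"

lemma smooth_chr1 [simp]: "smooth_on S (chr1 a j k)"
  unfolding chr1_def[abs_def] by simp

lemma lower_spray:
  assumes "z \<in> S"
  shows "(\<Sum>i\<in>UNIV. g a i z * spray f i z) =
    (\<Sum>k\<in>UNIV. (\<Sum>j\<in>UNIV. chr1 a j k z * y j z) * y k z) / 4"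
proof -
  have "spray f i z = (\<Sum>s\<in>UNIV. g_up f i s z *
      ((\<Sum>k\<in>UNIV. (\<Sum>j\<in>UNIV. chr1 s j k z * y j z) * y k z) / 4))" for i
    by (simp add: spray_def chr1_def sum_distrib_left sum_distrib_right sum_divide_distrib mult.assoc)
  then show ?thesis by (simp only: lower_raise[OF assms])
qed

lemma dy_chr1_y_y:
  assumes "z \<in> S"
  shows "(\<Sum>k\<in>UNIV. (\<Sum>j\<in>UNIV. dy m (chr1 a j k) z * y j z) * y k z) = 0"
proof -
  have "(\<Sum>j\<in>UNIV. dy m (chr1 a j k) z * y j z) = (\<Sum>j\<in>UNIV. dy m (dx j (g a k)) z * y j z)" for k
    using assms dy_dx_g_y(1)[OF assms, of m k a] dy_dx_g_y(1)[OF assms, of m a k]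
    by (simp add: chr1_def[abs_def] algebra_simps sum.distrib sum_subtractf)
  then have "(\<Sum>k\<in>UNIV. (\<Sum>j\<in>UNIV. dy m (chr1 a j k) z * y j z) * y k z) =
      (\<Sum>k\<in>UNIV. \<Sum>j\<in>UNIV. dy m (dx j (g a k)) z * y j z * y k z)"
    by (simp add: sum_distrib_right)
  also have "\<dots> = (\<Sum>j\<in>UNIV. (\<Sum>k\<in>UNIV. dy m (dx j (g a k)) z * y k z) * y j z)"
    by (subst sum.swap) (simp add: sum_distrib_right sum_distrib_left ac_simps)
  finally show ?thesis by (simp add: dy_dx_g_y(1)[OF assms])
qed

text \<open>The fibre derivative of the lowered spray coefficients. The terms in which it falls on the
  derivatives of \<open>g\<close> vanish by homogeneity, the others are equal in pairs.\<close>

lemma lower_N: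
  assumes "z \<in> S"
  shows "(\<Sum>i\<in>UNIV. g a i z * N i m z) =
    (\<Sum>j\<in>UNIV. chr1 a j m z * y j z) / 2 - (\<Sum>i\<in>UNIV. dy m (g a i) z * spray f i z)"
proof -
  have "dy m (\<lambda>z. \<Sum>i\<in>UNIV. g a i z * spray f i z) z =
      dy m (\<lambda>z. (\<Sum>k\<in>UNIV. (\<Sum>j\<in>UNIV. chr1 a j k z * y j z) * y k z) / 4) z"
    by (rule dy_cong[symmetric]) (simp_all add: assms lower_spray)
  moreover have "dy m (\<lambda>z. \<Sum>i\<in>UNIV. g a i z * spray f i z) z =
      (\<Sum>i\<in>UNIV. dy m (g a i) z * spray f i z) + (\<Sum>i\<in>UNIV. g a i z * N i m z)"
    using assms by (simp add: sum.distrib nonlin_def)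
  moreover have "dy m (\<lambda>z. (\<Sum>k\<in>UNIV. (\<Sum>j\<in>UNIV. chr1 a j k z * y j z) * y k z) / 4) z =
      ((\<Sum>k\<in>UNIV. (\<Sum>j\<in>UNIV. dy m (chr1 a j k) z * y j z) * y k z) +
       (\<Sum>k\<in>UNIV. chr1 a m k z * y k z) + (\<Sum>j\<in>UNIV. chr1 a j m z * y j z)) / 4"
    using assms by (simp add: sum.distrib distrib_right)
  moreover have "chr1 a m k z = chr1 a k m z" for k
    using dx_cong[OF smooth_g assms g_sym] by (simp add: chr1_def)
  ultimately show ?thesis by (simp add: dy_chr1_y_y[OF assms])
qed

text \<open>Euler's identity for the spray coefficients, which are homogeneous of degree 2. It is the
  contraction of the formula for the lowered \<open>N\<^sup>i\<^sub>m\<close> with \<open>y\<^sup>m\<close>, which kills the Cartan tensor.\<close>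

lemma N_y:
  assumes "z \<in> S"
  shows "(\<Sum>m\<in>UNIV. N i m z * y m z) = 2 * spray f i z"
proof (rule lower_cancel[OF assms, where u = "\<lambda>i. \<Sum>m\<in>UNIV. N i m z * y m z" and i = i])
  fix a
  have "(\<Sum>i\<in>UNIV. g a i z * (\<Sum>m\<in>UNIV. N i m z * y m z)) =
      (\<Sum>m\<in>UNIV. (\<Sum>i\<in>UNIV. g a i z * N i m z) * y m z)"
    by (rule contract_swap)
  also have "\<dots> = (\<Sum>m\<in>UNIV. (\<Sum>j\<in>UNIV. chr1 a j m z * y j z) * y m z) / 2
      - (\<Sum>m\<in>UNIV. (\<Sum>i\<in>UNIV. spray f i z * dy m (g a i) z) * y m z)"
    by (simp add: lower_N[OF assms] left_diff_distrib sum_subtractf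
        mult.commute[of "dy _ (g a _) z"] flip: sum_divide_distrib)
  also have "(\<Sum>m\<in>UNIV. (\<Sum>i\<in>UNIV. spray f i z * dy m (g a i) z) * y m z) = 0"
    by (simp only: dy_g_y(3)[OF assms] mult_zero_right sum.neutral_const flip: contract_swap)
  finally show "(\<Sum>i\<in>UNIV. g a i z * (\<Sum>m\<in>UNIV. N i m z * y m z)) =
      (\<Sum>i\<in>UNIV. g a i z * (2 * spray f i z))"
    by (simp add: mult.left_commute[of _ 2] lower_spray[OF assms] flip: sum_distrib_left)
qed

lemma lower_chern:
  assumes "z \<in> S"
  shows "(\<Sum>i\<in>UNIV. g a i z * \<Gamma> i j k z) = (dh f k (g a j) z - dh f a (g j k) z + dh f j (g k a) z) / 2"
proof -
  have "\<Gamma> i j k z = (\<Sum>s\<in>UNIV. g_up f i s z *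
      ((dh f k (g s j) z - dh f s (g j k) z + dh f j (g k s) z) / 2))" for i
    by (simp add: chern_def)
  then show ?thesis by (simp only: lower_raise[OF assms])
qed

lemma dh_g_sym: "z \<in> S \<Longrightarrow> dh f h (g i j) z = dh f h (g j i) z"
  by (rule dh_cong) (simp_all add: g_sym)

lemma chern_sym: "z \<in> S \<Longrightarrow> \<Gamma> i j k z = \<Gamma> i k j z"
  unfolding chern_def
  using dh_g_sym[of z _ k j] dh_g_sym[of z k _ j] dh_g_sym[of z j k] by (simp add: algebra_simps)

text \<open>Horizontal derivatives of the metric differ from the coordinate derivatives by terms that are
  killed by \<open>y\<close>, except in the derivative along \<open>y\<close> itself, where \<open>N\<^sup>i\<^sub>m y\<^sup>m = 2 G\<^sup>i\<close> reproduces the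
  correction term of the lowered \<open>N\<^sup>i\<^sub>m\<close>.\<close>

lemma chern_y:
  assumes "z \<in> S"
  shows "(\<Sum>j\<in>UNIV. \<Gamma> i j k z * y j z) = N i k z" "(\<Sum>j\<in>UNIV. \<Gamma> i k j z * y j z) = N i k z"
proof -
  show 1: "(\<Sum>j\<in>UNIV. \<Gamma> i j k z * y j z) = N i k z"
  proof (rule lower_cancel[OF assms, where u = "\<lambda>i. \<Sum>j\<in>UNIV. \<Gamma> i j k z * y j z" and i = i])
    fix a
    have dhg: "(\<Sum>j\<in>UNIV. dh f k (g a j) z * y j z) = (\<Sum>j\<in>UNIV. dx k (g a j) z * y j z)" for k a
    proof -
      have "(\<Sum>j\<in>UNIV. (\<Sum>m\<in>UNIV. N m k z * dy m (g a j) z) * y j z) = 0"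
        by (simp only: dy_g_y(1)[OF assms] mult_zero_right sum.neutral_const flip: contract_swap)
      then show ?thesis by (simp add: dh_def left_diff_distrib sum_subtractf)
    qed
    have sym: "dy m (g k a) z = dy k (g a m) z" for m
      using dy_g_sym[OF assms] by metis
    have "(\<Sum>j\<in>UNIV. (\<Sum>m\<in>UNIV. dy m (g k a) z * N m j z) * y j z) =
        2 * (\<Sum>m\<in>UNIV. dy k (g a m) z * spray f m z)"
      by (simp add: N_y[OF assms] sum_distrib_left mult.left_commute[of 2] sym flip: contract_swap)
    then have dhy: "(\<Sum>j\<in>UNIV. dh f j (g k a) z * y j z) =
        (\<Sum>j\<in>UNIV. dx j (g k a) z * y j z) - 2 * (\<Sum>m\<in>UNIV. dy k (g a m) z * spray f m z)"
      by (simp add: dh_def left_diff_distrib sum_subtractf mult.commute[of "N _ _ z"])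
    have dxg: "dx j (g a k) z = dx j (g k a) z" for j
      by (rule dx_cong) (simp_all add: assms g_sym)
    have "(\<Sum>i\<in>UNIV. g a i z * (\<Sum>j\<in>UNIV. \<Gamma> i j k z * y j z)) =
        (\<Sum>j\<in>UNIV. (\<Sum>i\<in>UNIV. g a i z * \<Gamma> i j k z) * y j z)"
      by (rule contract_swap)
    also have "\<dots> = ((\<Sum>j\<in>UNIV. dh f k (g a j) z * y j z) - (\<Sum>j\<in>UNIV. dh f a (g k j) z * y j z)
        + (\<Sum>j\<in>UNIV. dh f j (g k a) z * y j z)) / 2"
      unfolding lower_chern[OF assms] dh_g_sym[OF assms, of _ k]
      by (simp add: distrib_right left_diff_distrib sum.distrib sum_subtractf flip: sum_divide_distrib)
    also have "\<dots> = (\<Sum>i\<in>UNIV. g a i z * N i k z)"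
      unfolding dhg dhy lower_N[OF assms] chr1_def dxg
      by (simp add: distrib_right left_diff_distrib sum.distrib sum_subtractf field_simps)
    finally show "(\<Sum>i\<in>UNIV. g a i z * (\<Sum>j\<in>UNIV. \<Gamma> i j k z * y j z)) = (\<Sum>i\<in>UNIV. g a i z * N i k z)" .
  qed
  then show "(\<Sum>j\<in>UNIV. \<Gamma> i k j z * y j z) = N i k z"
    using chern_sym[OF assms] by simp
qed

text \<open>The Chern connection is metric along horizontal directions.\<close>

lemma dh_g:
  assumes "z \<in> S"
  shows "dh f h (g i j) z = (\<Sum>m\<in>UNIV. g m j z * \<Gamma> m i h z) + (\<Sum>m\<in>UNIV. g i m z * \<Gamma> m j h z)"
proof -
  have "(\<Sum>m\<in>UNIV. g m j z * \<Gamma> m i h z) = (\<Sum>m\<in>UNIV. g j m z * \<Gamma> m i h z)"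
    by (simp add: g_sym[OF assms, of j])
  then show ?thesis
    using dh_g_sym[OF assms, of h i j] dh_g_sym[OF assms, of j h i] dh_g_sym[OF assms, of i h j]
    by (simp add: lower_chern[OF assms] field_simps)
qed

lemma dh_y_lo:
  assumes "z \<in> S"
  shows "dh f h (y_lo k) z = (\<Sum>m\<in>UNIV. y_lo m z * \<Gamma> m k h z)"
proof -
  have "dh f h (y_lo k) z = (\<Sum>j\<in>UNIV. dh f h (g k j) z * y j z) - (\<Sum>j\<in>UNIV. g k j z * N j h z)"
    using assms by (simp add: y_lo_def[abs_def] sum.distrib sum_subtractf)
  also have "(\<Sum>j\<in>UNIV. dh f h (g k j) z * y j z) =
      (\<Sum>j\<in>UNIV. (\<Sum>m\<in>UNIV. \<Gamma> m k h z * g m j z) * y j z) +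
      (\<Sum>j\<in>UNIV. (\<Sum>m\<in>UNIV. g k m z * \<Gamma> m j h z) * y j z)"
    by (simp add: dh_g[OF assms] distrib_right sum.distrib mult.commute[of "g _ _ z" "\<Gamma> _ _ _ z"])
  also have "\<dots> = (\<Sum>m\<in>UNIV. \<Gamma> m k h z * y_lo m z) + (\<Sum>m\<in>UNIV. g k m z * N m h z)"
    unfolding contract_swap[symmetric] y_lo_def[symmetric] chern_y(1)[OF assms] ..
  finally show ?thesis by (simp add: mult.commute)
qed

lemma dh_F:
  assumes "z \<in> S"
  shows "dh f h f z = 0"
proof -
  have "dh f h (\<lambda>z. (f z)\<^sup>2) z = dh f h (\<lambda>z. \<Sum>k\<in>UNIV. y_lo k z * y k z) z"
    by (rule dh_cong[symmetric]) (simp_all add: assms F2_eq)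
  also have "\<dots> = (\<Sum>k\<in>UNIV. (\<Sum>m\<in>UNIV. y_lo m z * \<Gamma> m k h z) * y k z) - (\<Sum>k\<in>UNIV. y_lo k z * N k h z)"
    using assms by (simp add: dh_y_lo sum.distrib sum_subtractf)
  also have "\<dots> = 0"
    by (simp add: chern_y(1)[OF assms] flip: contract_swap)
  finally have "2 * (f z * dh f h f z) = 0"
    using assms smooth_F by (simp add: power2_eq_square)
  then show ?thesis using F2_pos[OF assms] by auto
qed

section \<open>Landsberg metrics\<close>

text \<open>Fibre derivatives do not commute with horizontal ones, because the coefficients \<open>N\<^sup>a\<^sub>m\<close> depend
  on \<open>y\<close>.\<close>

lemma dy_dh:
  assumes "z \<in> S" "smooth_on S T"
  shows "dy j (dh f m T) z = dh f m (dy j T) z - (\<Sum>a\<in>UNIV. dy j (N a m) z * dy a T z)"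
  using assms
  by (simp add: dh_def[abs_def] sum.distrib dx_dy_commute(1)[OF open_S assms(2,1)]
      dx_dy_commute(3)[OF open_S assms(2,1), of j])

lemma dy_N_y:
  assumes "z \<in> S"
  shows "(\<Sum>m\<in>UNIV. dy j (N a m) z * y m z) = N a j z"
proof -
  have "dy j (\<lambda>z. \<Sum>m\<in>UNIV. N a m z * y m z) z = dy j (\<lambda>z. 2 * spray f a z) z"
    by (rule dy_cong[symmetric]) (simp_all add: assms N_y)
  then show ?thesis using assms by (simp add: sum.distrib) (simp add: nonlin_def)
qed

lemma cartan_dot_eq:
  assumes "z \<in> S"
  shows "2 * cartan_dot_lo f i j k z = (\<Sum>s\<in>UNIV. dh f s (dy k (g i j)) z * y s z)
    - (\<Sum>m\<in>UNIV. dy k (g m j) z * N m i z) - (\<Sum>m\<in>UNIV. dy k (g i m) z * N m j z)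
    - (\<Sum>m\<in>UNIV. dy m (g i j) z * N m k z)"
proof -
  have "f z \<noteq> 0" using F2_pos[OF assms] by auto
  have "2 * (cov03 f (cartan_lo f) i j k s z * ell f s z) = (dh f s (dy k (g i j)) z * y s z
      - (\<Sum>m\<in>UNIV. dy k (g m j) z * \<Gamma> m i s z) * y s z - (\<Sum>m\<in>UNIV. dy k (g i m) z * \<Gamma> m j s z) * y s z
      - (\<Sum>m\<in>UNIV. dy m (g i j) z * \<Gamma> m k s z) * y s z)" for s
  proof -
    have "cov03 f (cartan_lo f) i j k s z = f z / 2 * (dh f s (dy k (g i j)) z
      - (\<Sum>m\<in>UNIV. dy k (g m j) z * \<Gamma> m i s z) - (\<Sum>m\<in>UNIV. dy k (g i m) z * \<Gamma> m j s z)
      - (\<Sum>m\<in>UNIV. dy m (g i j) z * \<Gamma> m k s z))"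
      using assms smooth_F dh_F[OF assms]
      by (simp add: cov03_def cartan_lo_def[abs_def] right_diff_distrib sum_distrib_left mult.assoc)
    then show ?thesis
      using \<open>f z \<noteq> 0\<close> by (simp only: ell_def left_diff_distrib[symmetric]) simp
  qed
  then have "2 * cartan_dot_lo f i j k z = (\<Sum>s\<in>UNIV. dh f s (dy k (g i j)) z * y s z
      - (\<Sum>m\<in>UNIV. dy k (g m j) z * \<Gamma> m i s z) * y s z - (\<Sum>m\<in>UNIV. dy k (g i m) z * \<Gamma> m j s z) * y s z
      - (\<Sum>m\<in>UNIV. dy m (g i j) z * \<Gamma> m k s z) * y s z)"
    by (simp only: cartan_dot_lo_def sum_distrib_left)
  then show ?thesis
    unfolding sum_subtractf contract_swap[symmetric] chern_y(2)[OF assms] chern_y(1)[OF assms] .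
qed

text \<open>The defect \<open>L\<close> of \<open>\<partial>N\<^sup>s\<^sub>k/\<partial>y\<^sup>j = \<Gamma>\<^sup>s\<^sub>k\<^sub>j\<close>, with its upper index lowered, is symmetric in its last
  two indices because \<open>N\<close> is a gradient. Differentiating the metric compatibility of \<open>\<Gamma>\<close> along the
  fibre and contracting with \<open>y\<close> shows that symmetrising its first two indices gives twice the
  Landsberg tensor. If that vanishes, \<open>L\<close> is symmetric in one pair of adjacent indices and
  antisymmetric in the other, hence zero.\<close>

lemma landsberg_dy_N:
  assumes landsberg: "\<And>z i j k. z \<in> S \<Longrightarrow> cartan_dot_lo f i j k z = 0" and z: "z \<in> S"
  shows "dy j (N s k) z = \<Gamma> s k j z"
proof -
  define L where "L i k j = (\<Sum>s\<in>UNIV. g i s z * (dy j (N s k) z - \<Gamma> s k j z))" for i k j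
  have L_sym: "L i k j = L i j k" for i j k
    using dx_dy_commute(3)[OF open_S smooth_spray z] chern_sym[OF z, of _ k j]
    by (simp add: L_def nonlin_def)
  have dy_\<Gamma>_y: "(\<Sum>m\<in>UNIV. dy j (\<Gamma> s k m) z * y m z) = dy j (N s k) z - \<Gamma> s k j z" for s k j
  proof -
    have "dy j (\<lambda>z. \<Sum>m\<in>UNIV. \<Gamma> s k m z * y m z) z = dy j (N s k) z"
      by (rule dy_cong) (simp_all add: z chern_y)
    then show ?thesis using z by (simp add: sum.distrib)
  qed
  have L_antisym: "L i k j = - L k i j" for i j k
  proof -
    have compat: "dh f m (dy j (g i k)) z - (\<Sum>a\<in>UNIV. dy a (g i k) z * dy j (N a m) z) =
      (\<Sum>s\<in>UNIV. dy j (g s k) z * \<Gamma> s i m z) + (\<Sum>s\<in>UNIV. g k s z * dy j (\<Gamma> s i m) z) +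
      (\<Sum>s\<in>UNIV. dy j (g i s) z * \<Gamma> s k m z) + (\<Sum>s\<in>UNIV. g i s z * dy j (\<Gamma> s k m) z)" for m
    proof -
      have "dy j (dh f m (g i k)) z =
          dy j (\<lambda>z. (\<Sum>s\<in>UNIV. g s k z * \<Gamma> s i m z) + (\<Sum>s\<in>UNIV. g i s z * \<Gamma> s k m z)) z"
        by (rule dy_cong) (simp_all add: z dh_g)
      then show ?thesis
        using z by (simp add: dy_dh sum.distrib g_sym[OF z, of k] mult.commute[of "dy j (N _ _) z"])
    qed
    have "(\<Sum>m\<in>UNIV. dh f m (dy j (g i k)) z * y m z)
        - (\<Sum>m\<in>UNIV. (\<Sum>a\<in>UNIV. dy a (g i k) z * dy j (N a m) z) * y m z) =
      (\<Sum>m\<in>UNIV. (\<Sum>s\<in>UNIV. dy j (g s k) z * \<Gamma> s i m z) * y m z) +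
      (\<Sum>m\<in>UNIV. (\<Sum>s\<in>UNIV. g k s z * dy j (\<Gamma> s i m) z) * y m z) +
      (\<Sum>m\<in>UNIV. (\<Sum>s\<in>UNIV. dy j (g i s) z * \<Gamma> s k m z) * y m z) +
      (\<Sum>m\<in>UNIV. (\<Sum>s\<in>UNIV. g i s z * dy j (\<Gamma> s k m) z) * y m z)"
      unfolding sum_subtractf[symmetric] sum.distrib[symmetric] left_diff_distrib[symmetric]
        distrib_right[symmetric] compat ..
    then have "(\<Sum>m\<in>UNIV. dh f m (dy j (g i k)) z * y m z) - (\<Sum>a\<in>UNIV. dy a (g i k) z * N a j z) =
      (\<Sum>s\<in>UNIV. dy j (g s k) z * N s i z) + L k i j + (\<Sum>s\<in>UNIV. dy j (g i s) z * N s k z) + L i k j"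
      unfolding contract_swap[symmetric] chern_y(2)[OF z] dy_N_y[OF z] chern_y(1)[OF z] dy_\<Gamma>_y
        L_def .
    then show ?thesis using cartan_dot_eq[OF z, of i k j] landsberg[OF z, of i k j] by simp
  qed
  have "L i k j = 0" for i k j
    using L_sym[of i k j] L_antisym[of i j k] L_sym[of j i k] L_antisym[of j k i] L_sym[of k j i]
      L_antisym[of k i j] by linarith
  then have "dy j (N s k) z - \<Gamma> s k j z = 0"
    by (intro lower_cancel[OF z, where u = "\<lambda>s. dy j (N s k) z - \<Gamma> s k j z" and v = "\<lambda>_. 0"])
       (simp add: L_def)
  then show ?thesis by simp
qed


section \<open>Curvature of Landsberg metrics\<close>

text \<open>The curvature of the nonlinear connection, \<open>[\<delta>/\<delta>x\<^sup>k, \<delta>/\<delta>x\<^sup>l] = - \<rho>\<^sup>i\<^sub>k\<^sub>l \<partial>/\<partial>y\<^sup>i\<close>; it equals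
  \<open>y\<^sup>j R\<^sup>i\<^sub>j\<^sub>k\<^sub>l\<close>.\<close>

definition \<rho> :: "'n \<Rightarrow> 'n \<Rightarrow> 'n \<Rightarrow> 'n loc"
  where "\<rho> i k l z = dh f k (N i l) z - dh f l (N i k) z"

lemma smooth_\<rho> [simp]: "smooth_on S (\<rho> i k l)"
  unfolding \<rho>_def[abs_def] by simp

lemma y_Rhh:
  assumes "z \<in> S"
  shows "(\<Sum>j\<in>UNIV. Rhh f i j k l z * y j z) = \<rho> i k l z"
proof -
  have dhN: "dh f k (N i l) z =
      (\<Sum>j\<in>UNIV. dh f k (\<Gamma> i j l) z * y j z) - (\<Sum>j\<in>UNIV. \<Gamma> i j l z * N j k z)" for k l
  proof -
    have "dh f k (N i l) z = dh f k (\<lambda>z. \<Sum>j\<in>UNIV. \<Gamma> i j l z * y j z) z"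
      by (rule dh_cong) (simp_all add: assms chern_y)
    then show ?thesis using assms by (simp add: sum.distrib sum_subtractf)
  qed
  have "(\<Sum>j\<in>UNIV. Rhh f i j k l z * y j z) =
      (\<Sum>j\<in>UNIV. dh f k (\<Gamma> i j l) z * y j z) - (\<Sum>j\<in>UNIV. dh f l (\<Gamma> i j k) z * y j z)
      + (\<Sum>j\<in>UNIV. (\<Sum>h\<in>UNIV. \<Gamma> i h k z * \<Gamma> h j l z) * y j z)
      - (\<Sum>j\<in>UNIV. (\<Sum>h\<in>UNIV. \<Gamma> i h l z * \<Gamma> h j k z) * y j z)"
    by (simp add: Rhh_def distrib_right left_diff_distrib sum.distrib sum_subtractf)
  also have "\<dots> = \<rho> i k l z"
    unfolding contract_swap[symmetric] chern_y(1)[OF assms] \<rho>_def dhN by simp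
  finally show ?thesis .
qed

lemma dh_chern_sym: "z \<in> S \<Longrightarrow> dh f h (\<Gamma> i j k) z = dh f h (\<Gamma> i k j) z"
  by (rule dh_cong) (simp_all add: chern_sym)

lemma Rhh_cyclic:
  assumes "z \<in> S"
  shows "Rhh f i j k l z + Rhh f i k l j z + Rhh f i l j k z = 0"
  unfolding Rhh_def dh_chern_sym[OF assms, of _ i k j] dh_chern_sym[OF assms, of _ i l j]
    dh_chern_sym[OF assms, of _ i l k] chern_sym[OF assms, of _ k j] chern_sym[OF assms, of _ l j]
    chern_sym[OF assms, of _ l k]
  by simp

lemma Rhh_antisym: "Rhh f i j l k z = - Rhh f i j k l z"
  by (simp add: Rhh_def)

lemma \<rho>_antisym: "\<rho> i l k z = - \<rho> i k l z"
  by (simp add: \<rho>_def)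

text \<open>On a Landsberg space \<open>\<Gamma>\<^sup>i\<^sub>j\<^sub>k = \<partial>N\<^sup>i\<^sub>k/\<partial>y\<^sup>j\<close>, so that the quadratic terms of \<open>R\<^sup>i\<^sub>j\<^sub>k\<^sub>l\<close> are the
  commutators of the fibre derivative with the horizontal ones.\<close>

lemma landsberg_dy_\<rho>:
  assumes landsberg: "\<And>z i j k. z \<in> S \<Longrightarrow> cartan_dot_lo f i j k z = 0" and z: "z \<in> S"
  shows "dy j (\<rho> i k l) z = Rhh f i j k l z"
proof -
  have N: "dy j (N i k) z = \<Gamma> i j k z" if "z \<in> S" for i j k z
    using landsberg_dy_N[OF landsberg that] chern_sym[OF that] by simp
  have "dy j (dh f k (N i l)) z = dh f k (\<Gamma> i j l) z - (\<Sum>a\<in>UNIV. \<Gamma> i a l z * \<Gamma> a j k z)" for k l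
  proof -
    have "dh f k (dy j (N i l)) z = dh f k (\<Gamma> i j l) z"
      by (rule dh_cong) (simp_all add: z N)
    then show ?thesis using z by (simp add: dy_dh N mult.commute)
  qed
  then show ?thesis using z by (simp add: \<rho>_def[abs_def] Rhh_def)
qed

text \<open>The tensor \<open>\<rho>\<^sup>i\<^sub>k\<^sub>l\<close> can be recovered from its contraction with \<open>y\<^sup>l\<close>, as
  \<open>3 \<rho>\<^sup>i\<^sub>k\<^sub>l = \<partial>(\<rho>\<^sup>i\<^sub>k\<^sub>m y\<^sup>m)/\<partial>y\<^sup>l - \<partial>(\<rho>\<^sup>i\<^sub>l\<^sub>m y\<^sup>m)/\<partial>y\<^sup>k\<close>, by the first Bianchi identity.\<close>

lemma landsberg_constant_curvature:
  assumes landsberg: "\<And>z i j k. z \<in> S \<Longrightarrow> cartan_dot_lo f i j k z = 0"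
    and curv: "\<And>z i k. z \<in> S \<Longrightarrow> (\<Sum>m\<in>UNIV. \<rho> i k m z * y m z) =
      K * ((f z)\<^sup>2 * (if i = k then 1 else 0) - y_lo k z * y i z)"
    and z: "z \<in> S"
  shows "Rhh f i j k l z = K * (g j l z * (if i = k then 1 else 0) - g j k z * (if i = l then 1 else 0))"
proof -
  have dcurv: "(\<Sum>m\<in>UNIV. Rhh f i l k m z * y m z) + \<rho> i k l z =
      K * (2 * y_lo l z * (if i = k then 1 else 0) - g k l z * y i z - y_lo k z * (if l = i then 1 else 0))"
    if z: "z \<in> S" for i k l z
  proof -
    have "dy l (\<lambda>z. \<Sum>m\<in>UNIV. \<rho> i k m z * y m z) z =
        dy l (\<lambda>z. K * ((f z)\<^sup>2 * (if i = k then 1 else 0) - y_lo k z * y i z)) z"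
      by (rule dy_cong[symmetric]) (simp_all add: z curv)
    then show ?thesis
      using z by (simp add: sum.distrib landsberg_dy_\<rho>[OF landsberg] dy_F2 dy_y_lo)
  qed
  have \<rho>_eq: "\<rho> i k l z = K * (y_lo l z * (if i = k then 1 else 0) - y_lo k z * (if i = l then 1 else 0))"
    if z: "z \<in> S" for i k l z
  proof -
    have "Rhh f i l k m z - Rhh f i k l m z = Rhh f i m k l z" for m
      using Rhh_cyclic[OF z, of i m k l] Rhh_cyclic[OF z, of i m l k]
        Rhh_antisym[of i l m k z] Rhh_antisym[of i k l m z] Rhh_antisym[of i m l k z] by linarith
    then have "(\<Sum>m\<in>UNIV. Rhh f i l k m z * y m z) - (\<Sum>m\<in>UNIV. Rhh f i k l m z * y m z) = \<rho> i k l z"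
      by (simp add: y_Rhh[OF z] flip: sum_subtractf left_diff_distrib)
    then have "3 * \<rho> i k l z =
        3 * (K * (y_lo l z * (if i = k then 1 else 0) - y_lo k z * (if i = l then 1 else 0)))"
      using dcurv[OF z, of i l k] dcurv[OF z, of i k l] \<rho>_antisym[of i k l z] g_sym[OF z, of k l]
      by (auto simp: algebra_simps split: if_splits)
    then show ?thesis by simp
  qed
  have "Rhh f i j k l z = dy j (\<rho> i k l) z"
    by (simp add: landsberg_dy_\<rho>[OF landsberg z])
  also have "\<dots> = dy j (\<lambda>z. K * (y_lo l z * (if i = k then 1 else 0) - y_lo k z * (if i = l then 1 else 0))) z"
    by (rule dy_cong) (simp_all add: z \<rho>_eq)
  also have "\<dots> = K * (g l j z * (if i = k then 1 else 0) - g k j z * (if i = l then 1 else 0))"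
    using z by (simp add: dy_y_lo)
  finally show ?thesis using g_sym[OF z] by metis
qed

text \<open>Such a curvature tensor is built from \<open>g\<close> and the identity, which are both parallel.\<close>

lemma cov13_Rhh_eq_0:
  assumes R: "\<And>z i j k l. z \<in> S \<Longrightarrow> Rhh f i j k l z =
      K * (g j l z * (if i = k then 1 else 0) - g j k z * (if i = l then 1 else 0))"
    and z: "z \<in> S"
  shows "cov13 f (Rhh f) i j k l h z = 0"
proof -
  have "dh f h (Rhh f i j k l) z =
      dh f h (\<lambda>z. K * (g j l z * (if i = k then 1 else 0) - g j k z * (if i = l then 1 else 0))) z"
    by (rule dh_cong) (simp_all add: z R)
  also have "\<dots> = K * (dh f h (g j l) z * (if i = k then 1 else 0) - dh f h (g j k) z * (if i = l then 1 else 0))"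
    using z by simp
  finally have 1: "dh f h (Rhh f i j k l) z = \<dots>" .
  \<comment> \<open>The four shapes of the contraction of the tensor with \<open>\<Gamma>\<close>, according to the contracted index:
    \<open>i\<close>, \<open>j\<close>, \<open>k\<close> and \<open>l\<close>.\<close>
  have eq: "(\<Sum>m\<in>UNIV. K * (a * (if m = k then 1 else 0) - b * (if m = l then 1 else 0)) * c m) =
      K * (a * c k - b * c l)"
    "(\<Sum>m\<in>UNIV. K * (u m * (if i = k then 1 else 0) - v m * (if i = l then 1 else 0)) * c m) =
      K * ((\<Sum>m\<in>UNIV. u m * c m) * (if i = k then 1 else 0) - (\<Sum>m\<in>UNIV. v m * c m) * (if i = l then 1 else 0))"
    "(\<Sum>m\<in>UNIV. K * (a * (if i = m then 1 else 0) - v m * (if i = l then 1 else 0)) * c m) =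
      K * (a * c i - (\<Sum>m\<in>UNIV. v m * c m) * (if i = l then 1 else 0))"
    "(\<Sum>m\<in>UNIV. K * (u m * (if i = k then 1 else 0) - b * (if i = m then 1 else 0)) * c m) =
      K * ((\<Sum>m\<in>UNIV. u m * c m) * (if i = k then 1 else 0) - b * c i)" for a b :: real and u v c :: "'n \<Rightarrow> real"
    by (simp_all add: mult.assoc left_diff_distrib right_diff_distrib sum_subtractf flip: sum_distrib_left)
  show ?thesis
    unfolding cov13_def 1 R[OF z] eq dh_g[OF z]
    by (auto simp: algebra_simps)
qed

end

section \<open>The osculating metric of a geodesic field\<close>

lemma derivation_on_dr: "derivation_on W (dr i)"
  unfolding derivation_on_def dr_def by (intro exI[of _ "\<lambda>_. axis i 1"]) simp

text \<open>A vector field with \<open>\<xi>\<^sup>j \<partial>\<^sub>j\<xi>\<^sup>i = - 2 G\<^sup>i\<close>, which says that its integral curves solve the geodesic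
  equation. The metric \<open>h\<close> is the osculating metric of the field.\<close>

locale geodesic_field = finsler_domain \<Omega> f for \<Omega> :: "(real ^ 'n::finite) set" and f :: "'n loc" +
  fixes W :: "(real ^ 'n) set" and \<xi> :: "real ^ 'n \<Rightarrow> real ^ 'n"
  assumes open_W: "open W" and W_subset: "W \<subseteq> \<Omega>"
    and smooth_\<xi>: "smooth_on W \<xi>" and \<xi>_nonzero: "\<And>x. x \<in> W \<Longrightarrow> \<xi> x \<noteq> 0"
    and geodesic: "\<And>x i. x \<in> W \<Longrightarrow>
      (\<Sum>j\<in>UNIV. dr j (\<lambda>x. \<xi> x $ i) x * \<xi> x $ j) = - 2 * spray f i (x, \<xi> x)"
begin

definition \<sigma> :: "real ^ 'n \<Rightarrow> (real ^ 'n) \<times> (real ^ 'n)" where "\<sigma> x = (x, \<xi> x)"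

definition h :: "'n \<Rightarrow> 'n \<Rightarrow> real ^ 'n \<Rightarrow> real" where "h i j x = g i j (\<sigma> x)"

abbreviation \<gamma> :: "'n \<Rightarrow> 'n \<Rightarrow> 'n \<Rightarrow> real ^ 'n \<Rightarrow> real" where "\<gamma> \<equiv> christoffel h"

text \<open>The covariant derivative of the field, \<open>D k m\<close> being the \<open>m\<close>-th component of the derivative in
  direction \<open>k\<close>.\<close>

definition D :: "'n \<Rightarrow> 'n \<Rightarrow> real ^ 'n \<Rightarrow> real"
  where "D k m x = dr k (\<lambda>x. \<xi> x $ m) x + N m k (\<sigma> x)"

lemmas dr_rules [simp] =
  derivation_on_add[OF open_W derivation_on_dr] derivation_on_diff[OF open_W derivation_on_dr]
  derivation_on_mult[OF open_W derivation_on_dr] derivation_on_const[OF derivation_on_dr, of _ W]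
  derivation_on_sum[OF open_W derivation_on_dr] derivation_on_cdivide[OF open_W derivation_on_dr]

lemmas dr_cong = derivation_on_cong[OF open_W derivation_on_dr]

lemmas smooth_W_rules [simp] =
  smooth_on_const[of W] smooth_on_add[OF open_W] smooth_on_diff[OF open_W]
  smooth_on_mult[OF open_W] smooth_on_sum[OF open_W] smooth_on_minus[OF open_W]
  smooth_on_mult[OF open_W _ smooth_on_const, of _ "inverse c" for c, folded divide_inverse]

lemma smooth_dr [simp]: "smooth_on W T \<Longrightarrow> smooth_on W (dr i T)"
  unfolding dr_def[abs_def] by (rule smooth_on_fd)

lemma \<sigma>_in_S [simp]: "x \<in> W \<Longrightarrow> \<sigma> x \<in> S"
  using W_subset \<xi>_nonzero by (auto simp: \<sigma>_def)

lemma snd_\<sigma> [simp]: "snd (\<sigma> x) = \<xi> x"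
  by (simp add: \<sigma>_def)

lemma smooth_\<xi>_nth [simp]: "smooth_on W (\<lambda>x. \<xi> x $ i)"
  by (rule smooth_on_linear_compose[OF bounded_linear_vec_nth open_W smooth_\<xi>])

lemma smooth_\<sigma>: "smooth_on W \<sigma>"
  unfolding \<sigma>_def[abs_def] by (rule smooth_on_Pair[OF open_W smooth_on_ident smooth_\<xi>])

lemma smooth_along [simp]:
  fixes T :: "'n loc"
  shows "smooth_on S T \<Longrightarrow> smooth_on W (\<lambda>x. T (\<sigma> x))"
  by (rule smooth_on_compose[OF open_W open_S smooth_\<sigma>, where T = T])
    (simp_all add: image_subsetI del: mem_Times_iff)

lemma smooth_h [simp]: "smooth_on W (h i j)"
  unfolding h_def[abs_def] by simp

text \<open>The chain rule, rearranged so that the horizontal derivative and the covariant derivative of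
  the field appear.\<close>

lemma dr_along:
  assumes "x \<in> W" "smooth_on S T"
  shows "dr k (\<lambda>x. T (\<sigma> x)) x = dh f k T (\<sigma> x) + (\<Sum>m\<in>UNIV. D k m x * dy m T (\<sigma> x))"
proof -
  have dT: "T differentiable (at (\<sigma> x))" using smooth_on_differentiable[OF assms(2)] assms(1) by simp
  have d\<xi>: "(\<xi> has_derivative frechet_derivative \<xi> (at x)) (at x)"
    using smooth_on_has_derivative[OF smooth_\<xi> assms(1)] .
  have "(\<sigma> has_derivative (\<lambda>v. (v, frechet_derivative \<xi> (at x) v))) (at x)"
    unfolding \<sigma>_def[abs_def] by (intro has_derivative_Pair has_derivative_ident d\<xi>)
  then have "dr k (\<lambda>x. T (\<sigma> x)) x =
      frechet_derivative T (at (\<sigma> x)) (axis k 1, frechet_derivative \<xi> (at x) (axis k 1))"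
    unfolding dr_def by (intro fd_eqI has_derivative_compose[of \<sigma> _ x UNIV, OF _ has_derivative_fd[OF dT]])
  moreover have "frechet_derivative \<xi> (at x) v $ m = frechet_derivative (\<lambda>x. \<xi> x $ m) (at x) v" for v m
    using fd_eqI[OF bounded_linear.has_derivative[OF bounded_linear_vec_nth d\<xi>]] by simp
  then have "(axis k 1, frechet_derivative \<xi> (at x) (axis k 1)) =
      1 *\<^sub>R (axis k (1::real), 0::real ^ 'n) + (\<Sum>m\<in>UNIV. dr k (\<lambda>x. \<xi> x $ m) x *\<^sub>R (0, axis m 1))"
    by (simp add: dr_def prod_eq_iff fst_sum snd_sum vec_eq_iff axis_def if_distrib cong: if_cong)
  ultimately show ?thesis
    by (simp only: fd_linear[OF dT])
       (simp add: dh_def dx_def dy_def D_def distrib_right sum.distrib)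
qed

lemma D_\<xi>:
  assumes "x \<in> W"
  shows "(\<Sum>k\<in>UNIV. D k m x * \<xi> x $ k) = 0"
  using geodesic[OF assms, of m] N_y[OF \<sigma>_in_S[OF assms], of m]
  by (simp add: D_def distrib_right sum.distrib \<sigma>_def)

lemma christoffel_eq:
  "\<gamma> i j k x = (\<Sum>s\<in>UNIV. g_up f i s (\<sigma> x) * ((dr j (h s k) x + dr k (h s j) x - dr s (h j k) x) / 2))"
proof -
  have "matrix_inv (\<chi> a b. h a b x) $ i $ s = g_up f i s (\<sigma> x)" for s
    by (simp add: g_up_def h_def)
  then show ?thesis by (simp add: christoffel_def sum_divide_distrib)
qed

lemma smooth_christoffel [simp]: "smooth_on W (\<gamma> i j k)"
  unfolding christoffel_eq[abs_def] by simp

lemma h_sym: "x \<in> W \<Longrightarrow> h i j x = h j i x"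
  by (simp add: h_def g_sym[OF \<sigma>_in_S])

lemma dr_h_sym: "x \<in> W \<Longrightarrow> dr k (h i j) x = dr k (h j i) x"
  by (rule dr_cong) (simp_all add: h_sym)

lemma christoffel_sym: "x \<in> W \<Longrightarrow> \<gamma> i j k x = \<gamma> i k j x"
  unfolding christoffel_eq using dr_h_sym[of x _ j k] by (simp add: add.commute)

lemma lower_christoffel:
  assumes "x \<in> W"
  shows "(\<Sum>i\<in>UNIV. h a i x * \<gamma> i j k x) = (dr j (h a k) x + dr k (h a j) x - dr a (h j k) x) / 2"
  unfolding h_def[of a _ x] christoffel_eq lower_raise[OF \<sigma>_in_S[OF assms]] ..

text \<open>A geodesic field has the same covariant derivative for its osculating metric as for the
  nonlinear connection: the derivatives of the osculating metric differ from the horizontal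
  derivatives of \<open>g\<close> by contractions of the Cartan tensor with the covariant derivative of the field;
  the field kills the Cartan tensor, and its covariant derivative along itself is zero.\<close>

lemma christoffel_\<xi>:
  assumes x: "x \<in> W"
  shows "(\<Sum>j\<in>UNIV. \<gamma> i j k x * \<xi> x $ j) = N i k (\<sigma> x)"
proof (rule lower_cancel[OF \<sigma>_in_S[OF x],
      where u = "\<lambda>i. \<Sum>j\<in>UNIV. \<gamma> i j k x * \<xi> x $ j" and v = "\<lambda>i. N i k (\<sigma> x)"])
  fix a
  note z = \<sigma>_in_S[OF x]
  have drh: "dr k (h a j) x = dh f k (g a j) (\<sigma> x) + (\<Sum>m\<in>UNIV. D k m x * dy m (g a j) (\<sigma> x))" for k a j
    using dr_along[OF x smooth_g, of k a j] by (simp add: h_def[abs_def])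
  have contr: "(\<Sum>j\<in>UNIV. dr k (h a j) x * \<xi> x $ j) = (\<Sum>j\<in>UNIV. dh f k (g a j) (\<sigma> x) * \<xi> x $ j)" for k a
  proof -
    have "(\<Sum>j\<in>UNIV. (\<Sum>m\<in>UNIV. D k m x * dy m (g a j) (\<sigma> x)) * \<xi> x $ j) = 0"
      using dy_g_y(1)[OF z, of _ a] by (simp flip: contract_swap)
    then show ?thesis by (simp add: drh distrib_right sum.distrib)
  qed
  have along: "(\<Sum>j\<in>UNIV. dr j (h a k) x * \<xi> x $ j) = (\<Sum>j\<in>UNIV. dh f j (g a k) (\<sigma> x) * \<xi> x $ j)"
  proof -
    have "(\<Sum>j\<in>UNIV. (\<Sum>m\<in>UNIV. dy m (g a k) (\<sigma> x) * D j m x) * \<xi> x $ j) = 0"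
      by (simp add: D_\<xi>[OF x] flip: contract_swap)
    then show ?thesis by (simp add: drh distrib_right sum.distrib mult.commute[of "D _ _ x"])
  qed
  have "(\<Sum>i\<in>UNIV. h a i x * (\<Sum>j\<in>UNIV. \<gamma> i j k x * \<xi> x $ j)) =
      ((\<Sum>j\<in>UNIV. dr j (h a k) x * \<xi> x $ j) + (\<Sum>j\<in>UNIV. dr k (h a j) x * \<xi> x $ j)
        - (\<Sum>j\<in>UNIV. dr a (h k j) x * \<xi> x $ j)) / 2"
    unfolding contract_swap lower_christoffel[OF x] dr_h_sym[OF x, of a _ k]
    by (simp add: distrib_right left_diff_distrib sum.distrib sum_subtractf flip: sum_divide_distrib)
  also have "\<dots> = (\<Sum>j\<in>UNIV. (\<Sum>i\<in>UNIV. g a i (\<sigma> x) * \<Gamma> i j k (\<sigma> x)) * \<xi> x $ j)"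
    unfolding contr along lower_chern[OF z] dh_g_sym[OF z, of a _ k] dh_g_sym[OF z, of _ k a]
    by (simp add: distrib_right left_diff_distrib sum.distrib sum_subtractf flip: sum_divide_distrib)
  also have "\<dots> = (\<Sum>i\<in>UNIV. g a i (\<sigma> x) * N i k (\<sigma> x))"
    using chern_y(1)[OF z] by (simp flip: contract_swap)
  finally show "(\<Sum>i\<in>UNIV. g a i (\<sigma> x) * (\<Sum>j\<in>UNIV. \<gamma> i j k x * \<xi> x $ j)) =
      (\<Sum>i\<in>UNIV. g a i (\<sigma> x) * N i k (\<sigma> x))" by (simp add: h_def)
qed

text \<open>The Ricci identity for the field, whose covariant derivative is \<open>D\<close>. The terms with \<open>D\<close> vanish
  after contraction with the field, so that its Jacobi endomorphism for the osculating metric is the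
  one of the Finsler structure.\<close>

lemma riemann_\<xi>:
  assumes x: "x \<in> W"
  shows "(\<Sum>j\<in>UNIV. riemann h i j k l x * \<xi> x $ j) = \<rho> i k l (\<sigma> x)
    + (\<Sum>m\<in>UNIV. D k m x * (dy m (N i l) (\<sigma> x) - \<gamma> i m l x))
    - (\<Sum>m\<in>UNIV. D l m x * (dy m (N i k) (\<sigma> x) - \<gamma> i m k x))"
proof -
  have d: "(\<Sum>j\<in>UNIV. dr k (\<gamma> i j l) x * \<xi> x $ j) = dh f k (N i l) (\<sigma> x)
      + (\<Sum>m\<in>UNIV. D k m x * dy m (N i l) (\<sigma> x)) - (\<Sum>j\<in>UNIV. dr k (\<lambda>x. \<xi> x $ j) x * \<gamma> i j l x)" for k l
  proof -
    have "dr k (\<lambda>x. N i l (\<sigma> x)) x = dr k (\<lambda>x. \<Sum>j\<in>UNIV. \<gamma> i j l x * \<xi> x $ j) x"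
      by (rule dr_cong) (simp_all add: x christoffel_\<xi>)
    then show ?thesis
      using x by (simp add: dr_along sum.distrib mult.commute[of "\<gamma> _ _ _ x" "dr _ _ _"])
  qed
  have "(\<Sum>j\<in>UNIV. riemann h i j k l x * \<xi> x $ j) =
      (\<Sum>j\<in>UNIV. dr k (\<gamma> i j l) x * \<xi> x $ j) - (\<Sum>j\<in>UNIV. dr l (\<gamma> i j k) x * \<xi> x $ j)
      + (\<Sum>j\<in>UNIV. (\<Sum>m\<in>UNIV. \<gamma> i m k x * \<gamma> m j l x) * \<xi> x $ j)
      - (\<Sum>j\<in>UNIV. (\<Sum>m\<in>UNIV. \<gamma> i m l x * \<gamma> m j k x) * \<xi> x $ j)"
    by (simp add: riemann_def distrib_right left_diff_distrib sum.distrib sum_subtractf)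
  also have "\<dots> = (\<Sum>j\<in>UNIV. dr k (\<gamma> i j l) x * \<xi> x $ j) - (\<Sum>j\<in>UNIV. dr l (\<gamma> i j k) x * \<xi> x $ j)
      + (\<Sum>m\<in>UNIV. N m l (\<sigma> x) * \<gamma> i m k x) - (\<Sum>m\<in>UNIV. N m k (\<sigma> x) * \<gamma> i m l x)"
    unfolding contract_swap[symmetric] christoffel_\<xi>[OF x] by (simp add: mult.commute)
  finally show ?thesis
    by (simp add: d \<rho>_def D_def distrib_right right_diff_distrib sum.distrib sum_subtractf)
qed

lemma riemann_\<xi>_\<xi>:
  assumes x: "x \<in> W"
  shows "(\<Sum>l\<in>UNIV. (\<Sum>j\<in>UNIV. riemann h i j k l x * \<xi> x $ j) * \<xi> x $ l) =
    (\<Sum>l\<in>UNIV. \<rho> i k l (\<sigma> x) * \<xi> x $ l)"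
proof -
  note z = \<sigma>_in_S[OF x]
  have "(\<Sum>l\<in>UNIV. (\<Sum>m\<in>UNIV. D k m x * (dy m (N i l) (\<sigma> x) - \<gamma> i m l x)) * \<xi> x $ l) = 0"
  proof -
    have "(\<Sum>l\<in>UNIV. (dy m (N i l) (\<sigma> x) - \<gamma> i m l x) * \<xi> x $ l) = 0" for m
      using dy_N_y[OF z, of m i] christoffel_\<xi>[OF x, of i m] christoffel_sym[OF x, of i m]
      by (simp add: left_diff_distrib sum_subtractf)
    then show ?thesis by (simp flip: contract_swap)
  qed
  moreover have "(\<Sum>l\<in>UNIV. (\<Sum>m\<in>UNIV. (dy m (N i k) (\<sigma> x) - \<gamma> i m k x) * D l m x) * \<xi> x $ l) = 0"
    by (simp add: D_\<xi>[OF x] flip: contract_swap)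
  then have "(\<Sum>l\<in>UNIV. (\<Sum>m\<in>UNIV. D l m x * (dy m (N i k) (\<sigma> x) - \<gamma> i m k x)) * \<xi> x $ l) = 0"
    by (simp add: mult.commute)
  ultimately show ?thesis
    by (simp add: riemann_\<xi>[OF x] distrib_right left_diff_distrib sum.distrib sum_subtractf)
qed

text \<open>Lowering the index inside the derivatives of the Christoffel symbols turns the derivatives of
  the metric that arise into quadratic terms, half of which cancel the existing ones. The result
  makes the symmetry of the Riemann tensor under exchange of its index pairs visible.\<close>

lemma lower_riemann:
  assumes x: "x \<in> W"
  shows "(\<Sum>i\<in>UNIV. h a i x * riemann h i j k l x) =
    (dr k (dr j (h a l)) x - dr k (dr a (h j l)) x - dr l (dr j (h a k)) x + dr l (dr a (h j k)) x) / 2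
    - (\<Sum>i\<in>UNIV. (\<Sum>s\<in>UNIV. h i s x * \<gamma> s a k x) * \<gamma> i j l x)
    + (\<Sum>i\<in>UNIV. (\<Sum>s\<in>UNIV. h i s x * \<gamma> s a l x) * \<gamma> i j k x)"
proof -
  have d: "(\<Sum>i\<in>UNIV. h a i x * dr k (\<gamma> i j l) x) =
      (dr k (dr j (h a l)) x + dr k (dr l (h a j)) x - dr k (dr a (h j l)) x) / 2
      - (\<Sum>i\<in>UNIV. dr k (h a i) x * \<gamma> i j l x)" for k l
  proof -
    have "dr k (\<lambda>x. (dr j (h a l) x + dr l (h a j) x - dr a (h j l) x) / 2) x =
        dr k (\<lambda>x. \<Sum>i\<in>UNIV. h a i x * \<gamma> i j l x) x"
      by (rule dr_cong) (simp_all add: x lower_christoffel)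
    then show ?thesis using x by (simp add: sum.distrib field_simps)
  qed
  have drh: "dr k (h a i) x = (\<Sum>s\<in>UNIV. h a s x * \<gamma> s i k x) + (\<Sum>s\<in>UNIV. h i s x * \<gamma> s a k x)" for k i
    using dr_h_sym[OF x, of k a i] dr_h_sym[OF x, of a k i] dr_h_sym[OF x, of i k a]
    by (simp add: lower_christoffel[OF x] field_simps)
  have "(\<Sum>i\<in>UNIV. h a i x * riemann h i j k l x) =
      (\<Sum>i\<in>UNIV. h a i x * dr k (\<gamma> i j l) x) - (\<Sum>i\<in>UNIV. h a i x * dr l (\<gamma> i j k) x)
      + (\<Sum>i\<in>UNIV. h a i x * (\<Sum>m\<in>UNIV. \<gamma> i m k x * \<gamma> m j l x))
      - (\<Sum>i\<in>UNIV. h a i x * (\<Sum>m\<in>UNIV. \<gamma> i m l x * \<gamma> m j k x))"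
    by (simp add: riemann_def distrib_left right_diff_distrib sum.distrib sum_subtractf)
  also have "dr k (dr l (h a j)) x = dr l (dr k (h a j)) x"
    using fd_commute[OF open_W smooth_h x] unfolding dr_def[abs_def] by blast
  ultimately show ?thesis
    unfolding d contract_swap drh by (simp add: distrib_right sum.distrib field_simps)
qed

lemma riemann_pair_symmetry:
  assumes x: "x \<in> W"
  shows "(\<Sum>i\<in>UNIV. h a i x * riemann h i j k l x) = (\<Sum>i\<in>UNIV. h k i x * riemann h i l a j x)"
proof -
  have comm: "dr k (dr l (h i j)) x = dr l (dr k (h i j)) x" for i j k l
    using fd_commute[OF open_W smooth_h x] unfolding dr_def[abs_def] by blast
  have drh: "dr l (dr k (h i j)) x = dr l (dr k (h j i)) x" for i j k l
    by (rule dr_cong) (simp_all add: x dr_h_sym)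
  have quad: "(\<Sum>i\<in>UNIV. (\<Sum>s\<in>UNIV. h i s x * u s) * v i) = (\<Sum>i\<in>UNIV. (\<Sum>s\<in>UNIV. h i s x * v s) * u i)"
    for u v :: "'n \<Rightarrow> real"
  proof -
    have "(\<Sum>i\<in>UNIV. (\<Sum>s\<in>UNIV. h i s x * u s) * v i) = (\<Sum>i\<in>UNIV. \<Sum>s\<in>UNIV. h s i x * u s * v i)"
      by (simp add: sum_distrib_right h_sym[OF x])
    also have "\<dots> = (\<Sum>s\<in>UNIV. \<Sum>i\<in>UNIV. h s i x * u s * v i)" by (rule sum.swap)
    also have "\<dots> = (\<Sum>i\<in>UNIV. (\<Sum>s\<in>UNIV. h i s x * v s) * u i)"
      by (simp add: sum_distrib_right sum_distrib_left ac_simps)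
    finally show ?thesis .
  qed
  have "dr a (dr l (h k j)) x = dr l (dr a (h j k)) x" "dr a (dr k (h l j)) x = dr k (dr a (h j l)) x"
    "dr j (dr l (h k a)) x = dr l (dr j (h a k)) x" "dr j (dr k (h l a)) x = dr k (dr j (h a l)) x"
    by (rule trans[OF comm drh])+
  moreover have "(\<Sum>i\<in>UNIV. (\<Sum>s\<in>UNIV. h i s x * \<gamma> s k a x) * \<gamma> i l j x) =
      (\<Sum>i\<in>UNIV. (\<Sum>s\<in>UNIV. h i s x * \<gamma> s a k x) * \<gamma> i j l x)"
    by (simp only: christoffel_sym[OF x, of _ k a] christoffel_sym[OF x, of _ l j])
  moreover have "(\<Sum>i\<in>UNIV. (\<Sum>s\<in>UNIV. h i s x * \<gamma> s k j x) * \<gamma> i l a x) =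
      (\<Sum>i\<in>UNIV. (\<Sum>s\<in>UNIV. h i s x * \<gamma> s a l x) * \<gamma> i j k x)"
    by (simp only: christoffel_sym[OF x, of _ k j] christoffel_sym[OF x, of _ l a])
      (rule quad)
  ultimately show ?thesis unfolding lower_riemann[OF x] by simp
qed

lemma jacobi_endomorphism_sym:
  assumes x: "x \<in> W"
  shows "(\<Sum>i\<in>UNIV. h a i x * (\<Sum>l\<in>UNIV. \<rho> i k l (\<sigma> x) * \<xi> x $ l)) =
    (\<Sum>i\<in>UNIV. h k i x * (\<Sum>l\<in>UNIV. \<rho> i a l (\<sigma> x) * \<xi> x $ l))"
proof -
  have "(\<Sum>i\<in>UNIV. h a i x * (\<Sum>l\<in>UNIV. \<rho> i k l (\<sigma> x) * \<xi> x $ l)) =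
      (\<Sum>l\<in>UNIV. (\<Sum>j\<in>UNIV. (\<Sum>i\<in>UNIV. h a i x * riemann h i j k l x) * \<xi> x $ j) * \<xi> x $ l)" for a k
    unfolding riemann_\<xi>_\<xi>[OF x, symmetric] contract_swap ..
  note eq = this
  have swap: "(\<Sum>l\<in>UNIV. \<Sum>j\<in>UNIV. B l j * c j * c l) = (\<Sum>j\<in>UNIV. \<Sum>l\<in>UNIV. B l j * c l * c j)"
    for B :: "'n \<Rightarrow> 'n \<Rightarrow> real" and c
    by (subst sum.swap) (simp add: ac_simps)
  have "(\<Sum>l\<in>UNIV. (\<Sum>j\<in>UNIV. (\<Sum>i\<in>UNIV. h a i x * riemann h i j k l x) * \<xi> x $ j) * \<xi> x $ l) =
      (\<Sum>l\<in>UNIV. \<Sum>j\<in>UNIV. (\<Sum>i\<in>UNIV. h k i x * riemann h i l a j x) * \<xi> x $ j * \<xi> x $ l)"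
    by (simp only: riemann_pair_symmetry[OF x, of a _ k] sum_distrib_right)
  also have "\<dots> = (\<Sum>j\<in>UNIV. \<Sum>l\<in>UNIV. (\<Sum>i\<in>UNIV. h k i x * riemann h i l a j x) * \<xi> x $ l * \<xi> x $ j)"
    by (rule swap)
  finally show ?thesis by (simp only: eq sum_distrib_right)
qed

end

section \<open>Flag curvature\<close>

text \<open>Polarisation on the standard basis.\<close>

lemma quadratic_form_eq_0:
  fixes q :: "'n::finite \<Rightarrow> 'n \<Rightarrow> real"
  assumes sym: "\<And>a b. q a b = q b a"
    and zero: "\<And>u::real ^ 'n. (\<Sum>a\<in>UNIV. \<Sum>b\<in>UNIV. q a b * u $ a * u $ b) = 0"
  shows "q a b = 0"
proof -
  have axis: "(\<Sum>j\<in>UNIV. c j * axis a (1::real) $ j) = c a" for c :: "'n \<Rightarrow> real" and a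
    by (simp add: axis_def if_distrib cong: if_cong)
  have axis': "(\<Sum>j\<in>UNIV. axis a (1::real) $ j * c j) = c a" for c :: "'n \<Rightarrow> real" and a
    by (simp only: mult.commute[of "axis _ _ $ _"] axis)
  have expand: "(\<Sum>a\<in>UNIV. \<Sum>b\<in>UNIV. q a b * u $ a * w $ b) = (\<Sum>a\<in>UNIV. u $ a * (\<Sum>b\<in>UNIV. q a b * w $ b))"
    for u w :: "real ^ 'n"
    by (simp add: sum_distrib_left ac_simps)
  have diag: "q a a = 0" for a
    using zero[of "axis a 1"] unfolding expand axis' axis .
  have "(\<Sum>i\<in>UNIV. (axis a 1 + axis b 1 :: real ^ 'n) $ i * (\<Sum>j\<in>UNIV. q i j * (axis a 1 + axis b 1 :: real ^ 'n) $ j)) =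
      q a a + q a b + q b a + q b b"
    by (simp add: distrib_left distrib_right sum.distrib axis axis')
  then show ?thesis
    using zero[of "axis a 1 + axis b 1"] diag sym[of a b] unfolding expand by simp
qed

lemma metric_at_bilinear:
  "metric_at h x (u + c *\<^sub>R v) w = metric_at h x u w + c * metric_at h x v w"
  "metric_at h x w (u + c *\<^sub>R v) = metric_at h x w u + c * metric_at h x w v"
  by (simp_all add: metric_at_def distrib_left distrib_right sum.distrib sum_distrib_left ac_simps)

text \<open>The strict Cauchy--Schwarz inequality, from the positive length of the component of \<open>u\<close>
  orthogonal to \<open>w\<close>.\<close>

lemma gram_determinant_pos:
  assumes sym: "metric_at h x u w = metric_at h x w u"
    and pos: "\<And>v. v \<noteq> 0 \<Longrightarrow> 0 < metric_at h x v v"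
    and "w \<noteq> 0" and indep: "\<And>t. u \<noteq> t *\<^sub>R w"
  shows "0 < metric_at h x u u * metric_at h x w w - (metric_at h x u w)\<^sup>2"
proof -
  let ?m = "metric_at h x"
  define c where "c = - (?m u w / ?m w w)"
  have w: "0 < ?m w w" using pos assms(3) by blast
  have "u + c *\<^sub>R w \<noteq> 0" using indep[of "- c"] by (auto simp: add_eq_0_iff2)
  then have "0 < ?m (u + c *\<^sub>R w) (u + c *\<^sub>R w)" by (rule pos)
  also have "\<dots> = ?m u u + 2 * c * ?m u w + c * c * ?m w w"
    by (simp add: metric_at_bilinear sym algebra_simps)
  also have "\<dots> = (?m u u * ?m w w - (?m u w)\<^sup>2) / ?m w w"
    using w by (simp add: c_def field_simps power2_eq_square)
  finally show ?thesis using w by (simp add: zero_less_divide_iff)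
qed

context finsler_domain
begin

text \<open>The quadratic forms \<open>jacobi\<close> and \<open>gram\<close> are the numerator and the denominator of the flag
  curvature of the plane that a vector spans with \<open>y\<close>; both have \<open>y\<close> in their kernel.\<close>

definition jacobi :: "'n \<Rightarrow> 'n \<Rightarrow> 'n loc"
  where "jacobi b k z = (\<Sum>i\<in>UNIV. g b i z * (\<Sum>l\<in>UNIV. \<rho> i k l z * y l z))"

definition gram :: "'n \<Rightarrow> 'n \<Rightarrow> 'n loc"
  where "gram b k z = (f z)\<^sup>2 * g b k z - y_lo b z * y_lo k z"

lemma jacobi_y: "(\<Sum>k\<in>UNIV. jacobi b k z * y k z) = 0"
proof -
  have "(\<Sum>k\<in>UNIV. (\<Sum>l\<in>UNIV. \<rho> i k l z * y l z) * y k z) = 0" (is "?s = 0") for i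
  proof -
    have "?s = (\<Sum>k\<in>UNIV. \<Sum>l\<in>UNIV. \<rho> i k l z * y l z * y k z)"
      by (simp add: sum_distrib_right)
    also have "\<dots> = (\<Sum>l\<in>UNIV. \<Sum>k\<in>UNIV. \<rho> i k l z * y l z * y k z)"
      by (rule sum.swap)
    also have "\<dots> = (\<Sum>l\<in>UNIV. \<Sum>k\<in>UNIV. - (\<rho> i l k z * y k z * y l z))"
      by (intro sum.cong refl) (subst \<rho>_antisym, simp)
    also have "\<dots> = - ?s"
      by (simp add: sum_distrib_right sum_negf)
    finally show ?thesis by simp
  qed
  then show ?thesis
    unfolding jacobi_def contract_swap[symmetric] by simp
qed

lemma gram_y:
  assumes "z \<in> S"
  shows "(\<Sum>k\<in>UNIV. gram b k z * y k z) = 0"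
proof -
  have "(\<Sum>k\<in>UNIV. gram b k z * y k z) = (f z)\<^sup>2 * y_lo b z - y_lo b z * (\<Sum>k\<in>UNIV. y_lo k z * y k z)"
    unfolding y_lo_def[of b] sum_distrib_left sum_subtractf[symmetric]
    by (intro sum.cong refl) (simp add: gram_def y_lo_def left_diff_distrib mult.assoc)
  then show ?thesis by (simp add: F2_eq[OF assms])
qed

text \<open>A symmetric form is determined by its values on the diagonal; on multiples of \<open>y\<close> both sides
  of the hypothesis are zero.\<close>

lemma jacobi_form_imp_curvature:
  assumes z: "z \<in> S"
    and sym: "\<And>b k. jacobi b k z = jacobi k b z"
    and form: "\<And>u. (\<And>t. u \<noteq> t *\<^sub>R snd z) \<Longrightarrow>
      (\<Sum>b\<in>UNIV. \<Sum>k\<in>UNIV. jacobi b k z * u $ b * u $ k) =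
      K * (\<Sum>b\<in>UNIV. \<Sum>k\<in>UNIV. gram b k z * u $ b * u $ k)"
  shows "(\<Sum>l\<in>UNIV. \<rho> i k l z * y l z) = K * ((f z)\<^sup>2 * (if i = k then 1 else 0) - y_lo k z * y i z)"
proof -
  have form': "(\<Sum>b\<in>UNIV. \<Sum>k\<in>UNIV. jacobi b k z * u $ b * u $ k) =
      K * (\<Sum>b\<in>UNIV. \<Sum>k\<in>UNIV. gram b k z * u $ b * u $ k)" for u
  proof (cases "\<exists>t. u = t *\<^sub>R snd z")
    case True
    then obtain t where u: "u = t *\<^sub>R snd z" by blast
    have "(\<Sum>k\<in>UNIV. q b k * u $ b * u $ k) = u $ b * t * (\<Sum>k\<in>UNIV. q b k * y k z)"
      for b and q :: "'n \<Rightarrow> 'n \<Rightarrow> real"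
      by (simp add: u sum_distrib_left ac_simps)
    from this[where q = "\<lambda>b k. jacobi b k z"] this[where q = "\<lambda>b k. gram b k z"]
    show ?thesis by (simp only: jacobi_y gram_y[OF z]) simp
  qed (use form in blast)
  have "jacobi b k z - K * gram b k z = 0" for b k
  proof (rule quadratic_form_eq_0[of "\<lambda>b k. jacobi b k z - K * gram b k z"])
    show "jacobi b k z - K * gram b k z = jacobi k b z - K * gram k b z" for b k
      using sym[of b k] g_sym[OF z, of b k] by (simp add: gram_def)
    show "(\<Sum>b\<in>UNIV. \<Sum>k\<in>UNIV. (jacobi b k z - K * gram b k z) * u $ b * u $ k) = 0" for u
      using form'[of u] by (simp add: left_diff_distrib sum_subtractf sum_distrib_left mult.assoc)
  qed
  then have jacobi: "jacobi b k z = K * gram b k z" for b k by simp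
  show ?thesis
  proof (rule lower_cancel[OF z, where u = "\<lambda>i. \<Sum>l\<in>UNIV. \<rho> i k l z * y l z"])
    fix a
    have "(\<Sum>i\<in>UNIV. g a i z * (K * ((f z)\<^sup>2 * (if i = k then 1 else 0) - y_lo k z * y i z))) =
        K * (f z)\<^sup>2 * (\<Sum>i\<in>UNIV. g a i z * (if i = k then 1 else 0))
        - K * y_lo k z * (\<Sum>i\<in>UNIV. g a i z * y i z)"
      unfolding sum_distrib_left sum_subtractf[symmetric] by (intro sum.cong refl) (simp add: algebra_simps)
    also have "\<dots> = K * gram a k z"
      by (simp add: gram_def y_lo_def algebra_simps)
    finally show "(\<Sum>i\<in>UNIV. g a i z * (\<Sum>l\<in>UNIV. \<rho> i k l z * y l z)) =
        (\<Sum>i\<in>UNIV. g a i z * (K * ((f z)\<^sup>2 * (if i = k then 1 else 0) - y_lo k z * y i z)))"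
      using jacobi[of a k] by (simp add: jacobi_def)
  qed
qed

end

context geodesic_field
begin

lemma metric_at_\<xi>:
  assumes "x \<in> W"
  shows "metric_at h x u (\<xi> x) = (\<Sum>i\<in>UNIV. y_lo i (\<sigma> x) * u $ i)"
    "metric_at h x (\<xi> x) (\<xi> x) = (f (\<sigma> x))\<^sup>2"
proof -
  show *: "metric_at h x u (\<xi> x) = (\<Sum>i\<in>UNIV. y_lo i (\<sigma> x) * u $ i)" for u
    by (simp add: metric_at_def y_lo_def h_def sum_distrib_left sum_distrib_right ac_simps)
  show "metric_at h x (\<xi> x) (\<xi> x) = (f (\<sigma> x))\<^sup>2"
    using F2_eq[OF \<sigma>_in_S[OF assms]] by (simp add: *)
qed


text \<open>The numerator of the sectional curvature is the quadratic form of the Jacobi endomorphism.\<close>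

lemma sectional_imp_jacobi_form:
  assumes x: "x \<in> W" and u: "\<And>t. u \<noteq> t *\<^sub>R \<xi> x" and sec: "sectional h x u (\<xi> x) = K"
  shows "(\<Sum>b\<in>UNIV. \<Sum>k\<in>UNIV. jacobi b k (\<sigma> x) * u $ b * u $ k) =
    K * (\<Sum>b\<in>UNIV. \<Sum>k\<in>UNIV. gram b k (\<sigma> x) * u $ b * u $ k)"
proof -
  note z = \<sigma>_in_S[OF x]
  define r where "r i k = (\<Sum>l\<in>UNIV. \<rho> i k l (\<sigma> x) * \<xi> x $ l)" for i k
  define T where "T b k = (\<Sum>i\<in>UNIV. h b i x * r i k)" for b k
  have T: "T b k = jacobi b k (\<sigma> x)" for b k
    by (simp add: T_def r_def jacobi_def h_def)
  have num: "metric_at h x (\<chi> i. \<Sum>j\<in>UNIV. \<Sum>k\<in>UNIV. \<Sum>l\<in>UNIV. riemann h i j k l x * \<xi> x $ j * u $ k * \<xi> x $ l) u =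
      (\<Sum>b\<in>UNIV. \<Sum>k\<in>UNIV. T b k * u $ b * u $ k)" for u
  proof -
    have "(\<Sum>j\<in>UNIV. \<Sum>k\<in>UNIV. \<Sum>l\<in>UNIV. riemann h i j k l x * \<xi> x $ j * u $ k * \<xi> x $ l) =
        (\<Sum>k\<in>UNIV. r i k * u $ k)" for i
    proof -
      have "(\<Sum>j\<in>UNIV. \<Sum>k\<in>UNIV. \<Sum>l\<in>UNIV. riemann h i j k l x * \<xi> x $ j * u $ k * \<xi> x $ l) =
          (\<Sum>k\<in>UNIV. \<Sum>j\<in>UNIV. \<Sum>l\<in>UNIV. riemann h i j k l x * \<xi> x $ j * u $ k * \<xi> x $ l)"
        by (rule sum.swap)
      also have "\<dots> = (\<Sum>k\<in>UNIV. \<Sum>l\<in>UNIV. \<Sum>j\<in>UNIV. riemann h i j k l x * \<xi> x $ j * u $ k * \<xi> x $ l)"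
        by (intro sum.cong refl sum.swap)
      also have "\<dots> = (\<Sum>k\<in>UNIV. r i k * u $ k)"
        by (simp only: r_def riemann_\<xi>_\<xi>[OF x, symmetric] sum_distrib_right) (simp add: ac_simps)
      finally show ?thesis .
    qed
    then have "metric_at h x (\<chi> i. \<Sum>j\<in>UNIV. \<Sum>k\<in>UNIV. \<Sum>l\<in>UNIV. riemann h i j k l x * \<xi> x $ j * u $ k * \<xi> x $ l) u =
        (\<Sum>i\<in>UNIV. \<Sum>b\<in>UNIV. h b i x * (\<Sum>k\<in>UNIV. r i k * u $ k) * u $ b)"
      using h_sym[OF x] by (simp add: metric_at_def)
    also have "\<dots> = (\<Sum>b\<in>UNIV. \<Sum>i\<in>UNIV. h b i x * (\<Sum>k\<in>UNIV. r i k * u $ k) * u $ b)"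
      by (rule sum.swap)
    also have "\<dots> = (\<Sum>b\<in>UNIV. (\<Sum>i\<in>UNIV. h b i x * (\<Sum>k\<in>UNIV. r i k * u $ k)) * u $ b)"
      by (simp add: sum_distrib_right)
    also have "\<dots> = (\<Sum>b\<in>UNIV. (\<Sum>k\<in>UNIV. T b k * u $ k) * u $ b)"
      unfolding contract_swap T_def ..
    also have "\<dots> = (\<Sum>b\<in>UNIV. \<Sum>k\<in>UNIV. T b k * u $ b * u $ k)"
      by (simp add: sum_distrib_left ac_simps)
    finally show ?thesis .
  qed
  have den: "metric_at h x u u * metric_at h x (\<xi> x) (\<xi> x) - (metric_at h x u (\<xi> x))\<^sup>2 =
      (\<Sum>b\<in>UNIV. \<Sum>k\<in>UNIV. gram b k (\<sigma> x) * u $ b * u $ k)" for u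
  proof -
    have "(\<Sum>b\<in>UNIV. \<Sum>k\<in>UNIV. gram b k (\<sigma> x) * u $ b * u $ k) = (f (\<sigma> x))\<^sup>2 * metric_at h x u u -
        (\<Sum>b\<in>UNIV. y_lo b (\<sigma> x) * u $ b) * (\<Sum>k\<in>UNIV. y_lo k (\<sigma> x) * u $ k)"
      unfolding sum_product metric_at_def
      by (simp only: gram_def h_def left_diff_distrib sum_subtractf sum_distrib_left) (simp add: ac_simps)
    then show ?thesis
      unfolding metric_at_\<xi>(2)[OF x] unfolding metric_at_\<xi>(1)[OF x]
      by (simp add: power2_eq_square mult.commute)
  qed
  have "0 < metric_at h x v v" if "v \<noteq> 0" for v
    using positive_definite[OF z that] by (simp add: metric_at_def h_def)
  moreover have "metric_at h x u (\<xi> x) = metric_at h x (\<xi> x) u"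
    unfolding metric_at_def by (subst sum.swap) (simp add: h_sym[OF x] ac_simps)
  ultimately have "0 < metric_at h x u u * metric_at h x (\<xi> x) (\<xi> x) - (metric_at h x u (\<xi> x))\<^sup>2"
    using u \<xi>_nonzero[OF x] by (intro gram_determinant_pos) auto
  then show ?thesis
    using sec unfolding sectional_def num den T by (auto simp: field_simps)
qed

lemma jacobi_symmetric:
  assumes "x \<in> W"
  shows "jacobi b k (\<sigma> x) = jacobi k b (\<sigma> x)"
  using jacobi_endomorphism_sym[OF assms, of b k] by (simp add: jacobi_def h_def)

end

section \<open>Charts, tangent vectors and geodesic vector fields\<close>

lemma chart_facts:
  assumes "is_chart c"
  shows "open (dom_of c)" "open (region c)"
    "\<And>p. p \<in> dom_of c \<Longrightarrow> coord_inv c (coord c p) = p"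
    "\<And>x. x \<in> region c \<Longrightarrow> coord c (coord_inv c x) = x"
    "\<And>x. x \<in> region c \<Longrightarrow> coord_inv c x \<in> dom_of c"
    "continuous_on (region c) (coord_inv c)"
  using assms unfolding is_chart_def homeomorphism_def by auto

lemma open_coord_image:
  assumes "is_chart c" "open U"
  shows "open (coord c ` (dom_of c \<inter> U))"
proof -
  have "coord c ` (dom_of c \<inter> U) = region c \<inter> coord_inv c -` U"
    using chart_facts(3-5)[OF assms(1)] by force
  then show ?thesis
    using continuous_open_preimage[OF chart_facts(6,2)[OF assms(1)] assms(2)] by simp
qed

lemma transition_facts:
  assumes "smooth_structure A" "c \<in> A" "d \<in> A"
  shows "\<And>p. p \<in> dom_of c \<Longrightarrow> p \<in> dom_of d \<Longrightarrow> transition c d differentiable (at (coord c p))"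
    "\<And>p. p \<in> dom_of c \<Longrightarrow> transition c d (coord c p) = coord d p"
proof -
  have ch: "is_chart c" "is_chart d" and sm: "smooth_on (coord c ` (dom_of c \<inter> dom_of d)) (transition c d)"
    using assms unfolding smooth_structure_def compatible_def by blast+
  show "transition c d differentiable (at (coord c p))" if "p \<in> dom_of c" "p \<in> dom_of d" for p
    using smooth_on_differentiable[OF sm] that by blast
  show "transition c d (coord c p) = coord d p" if "p \<in> dom_of c" for p
    using chart_facts(3)[OF ch(1) that] by (simp add: transition_def)
qed

lemma linear_transition_derivative:
  assumes "smooth_structure A" "c \<in> A" "d \<in> A" "p \<in> dom_of c" "p \<in> dom_of d"
  shows "linear (frechet_derivative (transition c d) (at (coord c p)))"
  by (rule linear_frechet_derivative[OF transition_facts(1)[OF assms]])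

lemma transition_derivative_chain:
  assumes A: "smooth_structure A" "c \<in> A" "d \<in> A" "e \<in> A"
    and p: "p \<in> dom_of c" "p \<in> dom_of d" "p \<in> dom_of e"
  shows "frechet_derivative (transition c e) (at (coord c p)) v =
    frechet_derivative (transition d e) (at (coord d p)) (frechet_derivative (transition c d) (at (coord c p)) v)"
proof -
  have ch: "is_chart c" "is_chart d" "is_chart e" using A unfolding smooth_structure_def by blast+
  let ?V = "coord c ` (dom_of c \<inter> (dom_of d \<inter> dom_of e))"
  have "open ?V"
    using chart_facts(1)[OF ch(2)] chart_facts(1)[OF ch(3)] by (intro open_coord_image[OF ch(1)]) auto
  have d: "((\<lambda>x. transition d e (transition c d x)) has_derivative
      (\<lambda>v. frechet_derivative (transition d e) (at (coord d p))
        (frechet_derivative (transition c d) (at (coord c p)) v))) (at (coord c p))"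
    using has_derivative_compose[OF has_derivative_fd[OF transition_facts(1)[OF A(1,2,3) p(1,2)]], of "transition d e"]
      has_derivative_fd[OF transition_facts(1)[OF A(1,3,4) p(2,3)]]
    unfolding transition_facts(2)[OF A(1,2,3) p(1)] .
  have "(transition c e has_derivative
      (\<lambda>v. frechet_derivative (transition d e) (at (coord d p))
        (frechet_derivative (transition c d) (at (coord c p)) v))) (at (coord c p))"
  proof (rule has_derivative_transform_within_open[OF d \<open>open ?V\<close>])
    show "coord c p \<in> ?V" using p by blast
    fix x assume "x \<in> ?V"
    then obtain q where "x = coord c q" "q \<in> dom_of c" "q \<in> dom_of d" "q \<in> dom_of e" by blast
    then show "transition d e (transition c d x) = transition c e x"
      using transition_facts(2)[OF A(1,2,3)] transition_facts(2)[OF A(1,3,4)]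
        transition_facts(2)[OF A(1,2,4)] by simp
  qed
  then show ?thesis by (rule fd_eqI)
qed

lemma transition_self_derivative:
  assumes A: "smooth_structure A" "c \<in> A" and p: "p \<in> dom_of c"
  shows "frechet_derivative (transition c c) (at (coord c p)) v = v"
proof -
  have ch: "is_chart c" using A unfolding smooth_structure_def by blast
  have "(transition c c has_derivative (\<lambda>v. v)) (at (coord c p))"
  proof (rule has_derivative_transform_within_open[OF has_derivative_ident chart_facts(2)[OF ch]])
    show "coord c p \<in> region c" using p by blast
    show "x = transition c c x" if "x \<in> region c" for x
      using chart_facts(4)[OF ch that] by (simp add: transition_def)
  qed
  then show ?thesis by (rule fd_eqI)
qed

lemma coord_vector_in_tangent_space:
  assumes "smooth_structure A" "c \<in> A" "p \<in> dom_of c"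
  shows "coord_vector A c p v \<in> tangent_space A p"
proof -
  have "coord_vector A c p v e = frechet_derivative (transition d e) (at (coord d p)) (coord_vector A c p v d)"
    if "d \<in> A" "e \<in> A" "p \<in> dom_of d" "p \<in> dom_of e" for d e
    using transition_derivative_chain[OF assms(1,2) that(1,2) assms(3) that(3,4), of v] that
    unfolding coord_vector_def by simp
  moreover have "coord_vector A c p v d = 0" if "\<not> (d \<in> A \<and> p \<in> dom_of d)" for d
    using that unfolding coord_vector_def by auto
  ultimately show ?thesis unfolding tangent_space_def by blast
qed

lemma coord_vector_self:
  assumes "smooth_structure A" "c \<in> A" "p \<in> dom_of c"
  shows "coord_vector A c p v c = v"
  using transition_self_derivative[OF assms] assms by (simp add: coord_vector_def)

lemma coord_vector_scaleR:
  assumes "smooth_structure A" "c \<in> A" "p \<in> dom_of c"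
  shows "coord_vector A c p (t *\<^sub>R v) = (\<lambda>d. t *\<^sub>R coord_vector A c p v d)"
  using linear_cmul[OF linear_transition_derivative[OF assms(1,2) _ assms(3)]]
  by (auto simp: coord_vector_def fun_eq_iff)

lemma tangent_eq_zero:
  assumes "smooth_structure A" "c \<in> A" "p \<in> dom_of c" "v \<in> tangent_space A p" "v c = 0"
  shows "v = zero_tangent"
proof
  fix d
  show "v d = zero_tangent d"
  proof (cases "d \<in> A \<and> p \<in> dom_of d")
    case True
    then have "v d = frechet_derivative (transition c d) (at (coord c p)) (v c)"
      using assms unfolding tangent_space_def by blast
    then show ?thesis
      using linear_0[OF linear_transition_derivative[OF assms(1,2) _ assms(3)]] True assms(5)
      by (simp add: zero_tangent_def)
  next
    case False
    then show ?thesis using assms(4) unfolding tangent_space_def zero_tangent_def by blast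
  qed
qed

lemma finsler_domain_local_rep:
  assumes A: "smooth_structure A" and F: "finsler_structure A F" and c: "c \<in> A"
  shows "finsler_domain (region c) (local_rep A F c)"
proof
  have ch: "is_chart c" using A c unfolding smooth_structure_def by blast
  show "open (region c)" by (rule chart_facts(2)[OF ch])
  show "smooth_on (region c \<times> - {0}) (local_rep A F c)"
    using F c unfolding finsler_structure_def slit_region_def by blast
  show "0 < (\<Sum>i\<in>UNIV. \<Sum>j\<in>UNIV. g_lo (local_rep A F c) i j z * u $ i * u $ j)"
    if "z \<in> region c \<times> - {0}" "u \<noteq> 0" for z and u :: "real ^ 'b"
    using F c that unfolding finsler_structure_def slit_region_def by blast
  fix x y :: "real ^ 'b" and t :: real
  assume x: "x \<in> region c" and "y \<noteq> 0" "0 < t"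
  let ?p = "coord_inv c x"
  have p: "?p \<in> dom_of c" using chart_facts(5)[OF ch x] .
  have "(?p, coord_vector A c ?p y) \<in> tangent_bundle A"
    using coord_vector_in_tangent_space[OF A c p] by (simp add: tangent_bundle_def)
  then have "F (?p, \<lambda>d. t *\<^sub>R coord_vector A c ?p y d) = t * F (?p, coord_vector A c ?p y)"
    using F \<open>0 < t\<close> unfolding finsler_structure_def by blast
  then show "local_rep A F c (x, t *\<^sub>R y) = t * local_rep A F c (x, y)"
    by (simp add: local_rep_def coord_vector_scaleR[OF A c p])
qed

text \<open>By definition only the integral curves of a geodesic field are constrained. Since one of them
  passes through every point, the field satisfies a differential equation.\<close>

lemma geodesic_vector_field_equation:
  fixes A :: "('a::t2_space, 'n::finite) chart set"
  assumes A: "smooth_structure A" and X: "geodesic_vector_field A F U X" and c: "c \<in> A"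
    and x: "x \<in> coord c ` (dom_of c \<inter> U)"
  defines "\<xi> \<equiv> \<lambda>x. X (coord_inv c x) c"
  shows "(\<Sum>j\<in>UNIV. dr j (\<lambda>x. \<xi> x $ i) x * \<xi> x $ j) = - 2 * spray (local_rep A F c) i (x, \<xi> x)"
proof -
  have ch: "is_chart c" using A c unfolding smooth_structure_def by blast
  let ?W = "coord c ` (dom_of c \<inter> U)"
  have U: "open U" and tangent: "\<And>p. p \<in> U \<Longrightarrow> X p \<in> tangent_space A p" and sm: "smooth_on ?W \<xi>"
    using X c unfolding geodesic_vector_field_def vector_field_def \<xi>_def by blast+
  have W: "open ?W" by (rule open_coord_image[OF ch U])
  obtain e \<eta> where e: "0 < e" and \<eta>0: "\<eta> 0 = x" and \<eta>W: "\<And>t. t \<in> {-e<..<e} \<Longrightarrow> \<eta> t \<in> ?W"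
    and \<eta>: "\<And>t. t \<in> {-e<..<e} \<Longrightarrow> (\<eta> has_vector_derivative \<xi> (\<eta> t)) (at t)"
    using ex_integral_curve[OF W sm x] by blast
  define I where "I = {-e<..<e}"
  have I0: "0 \<in> I" and openI: "open I" using e by (auto simp: I_def)
  note \<eta>W = \<eta>W[folded I_def] and \<eta> = \<eta>[folded I_def]
  define \<gamma> where "\<gamma> t = coord_inv c (\<eta> t)" for t
  have \<gamma>: "\<gamma> t \<in> dom_of c" "\<gamma> t \<in> U" "coord c (\<gamma> t) = \<eta> t" if "t \<in> I" for t
    using \<eta>W[OF that] chart_facts(3)[OF ch] by (auto simp: \<gamma>_def)
  have deriv: "((coord d \<circ> \<gamma>) has_vector_derivative X (\<gamma> t) d) (at t)"
    if d: "d \<in> A" "\<gamma> t \<in> dom_of d" and t: "t \<in> I" for d t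
  proof -
    let ?D = "frechet_derivative (transition c d) (at (\<eta> t))"
    have "transition c d differentiable (at (\<eta> t))"
      using transition_facts(1)[OF A c d(1) \<gamma>(1)[OF t] d(2)] \<gamma>(3)[OF t] by simp
    note diff = has_derivative_fd[OF this] linear_frechet_derivative[OF this]
    have "((\<lambda>s. transition c d (\<eta> s)) has_derivative (\<lambda>r. ?D (r *\<^sub>R \<xi> (\<eta> t)))) (at t)"
      using \<eta>[OF t] unfolding has_vector_derivative_def
      by (rule has_derivative_compose[where f = \<eta> and g = "transition c d", OF _ diff(1)])
    moreover have "(\<lambda>r. ?D (r *\<^sub>R \<xi> (\<eta> t))) = (\<lambda>r. r *\<^sub>R X (\<gamma> t) d)"
    proof -
      have "X (\<gamma> t) d = frechet_derivative (transition c d) (at (coord c (\<gamma> t))) (X (\<gamma> t) c)"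
        using tangent[OF \<gamma>(2)[OF t]] c d \<gamma>(1)[OF t] unfolding tangent_space_def by blast
      also have "\<dots> = ?D (\<xi> (\<eta> t))"
        unfolding \<gamma>(3)[OF t] by (simp add: \<xi>_def \<gamma>_def)
      finally show ?thesis by (simp add: linear_cmul[OF diff(2)])
    qed
    moreover have "(\<lambda>s. transition c d (\<eta> s)) = coord d \<circ> \<gamma>"
      by (simp add: transition_def \<gamma>_def fun_eq_iff)
    ultimately show ?thesis by (simp add: has_vector_derivative_def)
  qed
  have "continuous_on I \<eta>"
    using \<eta> has_vector_derivative_continuous
    by (intro continuous_at_imp_continuous_on ballI) blast
  then have "continuous_on I \<gamma>"
    unfolding \<gamma>_def[abs_def]
    by (intro continuous_on_compose2[OF chart_facts(6)[OF ch]]) (use \<eta>W in auto)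
  then have "integral_curve A U X I \<gamma>"
    unfolding integral_curve_def using \<gamma>(2) deriv by blast
  then have "is_geodesic A F I \<gamma>"
    using X openI unfolding geodesic_vector_field_def I_def by (simp add: is_interval_oo)
  then have geo: "(velocity c \<gamma> has_vector_derivative
      (\<chi> i. - 2 * spray (local_rep A F c) i (coord c (\<gamma> 0), velocity c \<gamma> 0))) (at 0)"
    using c I0 \<gamma>(1)[OF I0] unfolding is_geodesic_def by blast
  have vel: "velocity c \<gamma> t = \<xi> (\<eta> t)" if "t \<in> I" for t
    using vector_derivative_at[OF deriv[OF c \<gamma>(1)[OF that] that]]
    by (simp add: velocity_def \<xi>_def \<gamma>_def)
  have "((\<lambda>t. \<xi> (\<eta> t)) has_vector_derivative (\<chi> i. - 2 * spray (local_rep A F c) i (x, \<xi> x))) (at 0)"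
    using has_vector_derivative_transform_within_open[OF geo openI I0 vel] \<gamma>(3)[OF I0] vel[OF I0] \<eta>0
    by simp
  from bounded_linear.has_vector_derivative[OF bounded_linear_vec_nth this]
  have 1: "((\<lambda>t. \<xi> (\<eta> t) $ i) has_vector_derivative - 2 * spray (local_rep A F c) i (x, \<xi> x)) (at 0)"
    by simp
  let ?D = "frechet_derivative (\<lambda>x. \<xi> x $ i) (at x)"
  have diff: "(\<lambda>x. \<xi> x $ i) differentiable (at x)"
    using smooth_on_differentiable[OF smooth_on_linear_compose[OF bounded_linear_vec_nth W sm] x] .
  have "((\<lambda>t. \<xi> (\<eta> t) $ i) has_derivative (\<lambda>r. ?D (r *\<^sub>R \<xi> x))) (at 0)"
    using \<eta>[OF I0] unfolding has_vector_derivative_def \<eta>0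
    by (rule has_derivative_compose[where f = \<eta> and g = "\<lambda>x. \<xi> x $ i"])
       (simp only: \<eta>0 has_derivative_fd[OF diff])
  then have "((\<lambda>t. \<xi> (\<eta> t) $ i) has_vector_derivative ?D (\<xi> x)) (at 0)"
    by (simp add: has_vector_derivative_def linear_cmul[OF linear_frechet_derivative[OF diff]])
  from vector_derivative_unique_at[OF this 1]
  have "?D (\<xi> x) = - 2 * spray (local_rep A F c) i (x, \<xi> x)" .
  moreover have "\<xi> x = (\<Sum>j\<in>UNIV. \<xi> x $ j *\<^sub>R axis j 1)"
    using basis_expansion[of "\<xi> x"] by (simp add: scalar_mult_eq_scaleR)
  then have "?D (\<xi> x) = (\<Sum>j\<in>UNIV. \<xi> x $ j * ?D (axis j 1))"
    using fd_linear(2)[OF diff, of "\<lambda>j. \<xi> x $ j" "\<lambda>j. axis j 1" UNIV] by simp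
  ultimately show ?thesis by (simp add: dr_def mult.commute)
qed

lemma geodesic_field_local_rep:
  fixes A :: "('a::t2_space, 'n::finite) chart set"
  assumes A: "smooth_structure A" and F: "finsler_structure A F" and X: "geodesic_vector_field A F U X"
    and c: "c \<in> A"
  shows "geodesic_field (region c) (local_rep A F c) (coord c ` (dom_of c \<inter> U)) (\<lambda>x. X (coord_inv c x) c)"
proof -
  have ch: "is_chart c" using A c unfolding smooth_structure_def by blast
  interpret finsler_domain "region c" "local_rep A F c"
    by (rule finsler_domain_local_rep[OF A F c])
  show ?thesis
  proof
    show "open (coord c ` (dom_of c \<inter> U))"
      using X open_coord_image[OF ch] unfolding geodesic_vector_field_def by blast
    show "smooth_on (coord c ` (dom_of c \<inter> U)) (\<lambda>x. X (coord_inv c x) c)"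
      using X c unfolding geodesic_vector_field_def vector_field_def by blast
    show "X (coord_inv c x) c \<noteq> 0" if "x \<in> coord c ` (dom_of c \<inter> U)" for x
    proof -
      from that obtain p where "p \<in> dom_of c" "p \<in> U" "coord_inv c x = p"
        using chart_facts(3)[OF ch] by auto
      then show ?thesis
        using X tangent_eq_zero[OF A c] unfolding geodesic_vector_field_def vector_field_def by metis
    qed
  qed (use geodesic_vector_field_equation[OF A X c] in auto)
qed

text \<open>In coordinates, constant flag curvature determines the curvature of the nonlinear connection
  in the direction of \<open>y\<close>. Each plane comes with its own geodesic field, but the quadratic form of
  the Jacobi endomorphism depends only on the value of the field at the point.\<close>

lemma constant_flag_curvature_local:
  fixes A :: "('a::t2_space, 'n::finite) chart set"
  assumes A: "smooth_structure A" and F: "finsler_structure A F" and K: "\<And>p v P. v \<in> tangent_space A p \<Longrightarrow>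
      v \<noteq> zero_tangent \<Longrightarrow> tangent_plane A p P \<Longrightarrow> v \<in> P \<Longrightarrow> has_flag_curvature A F p P v K"
    and c: "c \<in> A" and z: "z \<in> slit_region c"
  defines "f \<equiv> local_rep A F c"
  shows "(\<Sum>l\<in>UNIV. finsler_domain.\<rho> f i k l z * snd z $ l) =
    K * ((f z)\<^sup>2 * (if i = k then 1 else 0) - finsler_domain.y_lo f k z * snd z $ i)"
proof -
  have ch: "is_chart c" using A c unfolding smooth_structure_def by blast
  interpret finsler_domain "region c" f
    unfolding f_def by (rule finsler_domain_local_rep[OF A F c])
  obtain x y0 where z_eq: "z = (x, y0)" and x: "x \<in> region c" and y0: "y0 \<noteq> 0"
    using z by (auto simp: slit_region_def)
  let ?p = "coord_inv c x"
  have p: "?p \<in> dom_of c" "coord c ?p = x" using chart_facts(4,5)[OF ch x] by auto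
  let ?v = "coord_vector A c ?p"
  have field: "(\<forall>b k. jacobi b k z = jacobi k b z) \<and>
      (\<Sum>b\<in>UNIV. \<Sum>k\<in>UNIV. jacobi b k z * u $ b * u $ k) =
      K * (\<Sum>b\<in>UNIV. \<Sum>k\<in>UNIV. gram b k z * u $ b * u $ k)"
    if u: "\<And>t. u \<noteq> t *\<^sub>R y0" for u
  proof -
    define P where "P = {lincomb a (?v u) b (?v y0) | a b. True}"
    have self: "?v w c = w" for w by (rule coord_vector_self[OF A c p(1)])
    have basis: "plane_basis A ?p (?v u) (?v y0) P"
      unfolding plane_basis_def
    proof (intro conjI allI impI)
      fix a b assume "lincomb a (?v u) b (?v y0) = zero_tangent"
      from fun_cong[OF this, of c] have eq: "a *\<^sub>R u + b *\<^sub>R y0 = 0"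
        by (simp add: lincomb_def self zero_tangent_def)
      show "a = 0"
      proof (rule ccontr)
        assume "a \<noteq> 0"
        have "u = inverse a *\<^sub>R (a *\<^sub>R u)" using \<open>a \<noteq> 0\<close> by simp
        also have "a *\<^sub>R u = - (b *\<^sub>R y0)" using eq by (simp add: add_eq_0_iff2)
        finally have "u = (- (inverse a * b)) *\<^sub>R y0" by simp
        then show False using u by blast
      qed
      then show "b = 0" using eq y0 by simp
    qed (use coord_vector_in_tangent_space[OF A c p(1)] P_def in auto)
    have "?v y0 = lincomb 0 (?v u) 1 (?v y0)" by (simp add: lincomb_def)
    then have "?v y0 \<in> P" unfolding P_def by blast
    moreover have "?v y0 \<noteq> zero_tangent"
      using self[of y0] y0 by (auto simp: zero_tangent_def)
    ultimately have "has_flag_curvature A F ?p P (?v y0) K"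
      using K coord_vector_in_tangent_space[OF A c p(1)] basis unfolding tangent_plane_def by blast
    then obtain U X where pU: "?p \<in> U" and X: "geodesic_vector_field A F U X" and Xp: "X ?p = ?v y0"
      and sec: "has_sectional_curvature A (osculating_metric A F X) ?p P K"
      unfolding has_flag_curvature_def by blast
    let ?\<xi> = "\<lambda>x. X (coord_inv c x) c"
    interpret gf: geodesic_field "region c" f "coord c ` (dom_of c \<inter> U)" ?\<xi>
      unfolding f_def by (rule geodesic_field_local_rep[OF A F X c])
    have \<xi>x: "?\<xi> x = y0" using Xp self by simp
    have xW: "x \<in> coord c ` (dom_of c \<inter> U)" using p pU by force
    have \<sigma>x: "gf.\<sigma> x = z" by (simp add: gf.\<sigma>_def \<xi>x z_eq)
    have "gf.h = osculating_metric A F X c"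
      by (intro ext) (simp only: gf.h_def gf.\<sigma>_def osculating_metric_def f_def[symmetric])
    moreover have "sectional (osculating_metric A F X c) x u y0 = K"
      using sec c p basis self unfolding has_sectional_curvature_def by metis
    ultimately have "sectional gf.h x u (?\<xi> x) = K" by (simp add: \<xi>x)
    from gf.sectional_imp_jacobi_form[OF xW _ this] gf.jacobi_symmetric[OF xW] show ?thesis
      using u by (simp add: \<sigma>x \<xi>x)
  qed
  show ?thesis
  proof (rule jacobi_form_imp_curvature)
    show "z \<in> S" using z by (simp add: slit_region_def)
    show "jacobi b k z = jacobi k b z" for b k
    proof (cases "b = k")
      case False
      \<comment> \<open>Two different indices exist, hence some plane contains \<open>y\<close>, and its geodesic field
        provides the symmetry.\<close>
      have "\<exists>u. \<forall>t. u \<noteq> t *\<^sub>R y0"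
      proof (rule ccontr)
        assume "\<not> ?thesis"
        then obtain s t where s: "axis b 1 = s *\<^sub>R y0" and t: "axis k 1 = t *\<^sub>R y0" by metis
        have "s * y0 $ b = 1" "s * y0 $ k = 0" "t * y0 $ k = 1"
          using arg_cong[OF s, of "\<lambda>v. v $ b"] arg_cong[OF s, of "\<lambda>v. v $ k"]
            arg_cong[OF t, of "\<lambda>v. v $ k"] False by (auto simp: axis_def)
        then show False by auto
      qed
      then show ?thesis using field by blast
    qed simp
    show "(\<Sum>b\<in>UNIV. \<Sum>k\<in>UNIV. jacobi b k z * u $ b * u $ k) =
        K * (\<Sum>b\<in>UNIV. \<Sum>k\<in>UNIV. gram b k z * u $ b * u $ k)" if "\<And>t. u \<noteq> t *\<^sub>R snd z" for u
      using field that by (simp add: z_eq)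
  qed
qed

section \<open>Landsberg spaces of constant flag curvature are symmetric\<close>

theorem corollary3p8:
  fixes A :: "('a::{t2_space, second_countable_topology}, 'n::finite) chart set"
    and F :: "'a \<times> ('a, 'n) tangent \<Rightarrow> real"
  assumes "smooth_structure A"
    and "finsler_structure A F"
    and "landsberg A F"
    and "constant_flag_curvature A F"
    and "CARD('n) > 2"
    and "\<And>c z i k l h p. c \<in> A \<Longrightarrow> z \<in> slit_region c \<Longrightarrow>
      (let f = local_rep A F c in
        (\<Sum>m\<in>UNIV. dy m (R2 f i k l) z * cartan_dot_up f m h p z)
        + (\<Sum>m\<in>UNIV. R2 f m k l z * chern_y f i m p h z)
        - (\<Sum>m\<in>UNIV. R2 f i m l z * chern_y f m k p h z)
        - (\<Sum>m\<in>UNIV. R2 f i k m z * chern_y f m l p h z)) = 0"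
  shows "symmetric_finsler A F"
proof -
  obtain K where K: "\<And>p v P. v \<in> tangent_space A p \<Longrightarrow> v \<noteq> zero_tangent \<Longrightarrow>
      tangent_plane A p P \<Longrightarrow> v \<in> P \<Longrightarrow> has_flag_curvature A F p P v K"
    using assms(4) unfolding constant_flag_curvature_def by blast
  have "cov13 (local_rep A F c) (Rhh (local_rep A F c)) i j k h l z = 0"
    if c: "c \<in> A" and z: "z \<in> slit_region c" for c z i j k h l
  proof -
    interpret finsler_domain "region c" "local_rep A F c"
      by (rule finsler_domain_local_rep[OF assms(1,2) c])
    have landsberg: "cartan_dot_lo (local_rep A F c) i j k z = 0" if "z \<in> S" for z i j k
      using assms(3) c that unfolding landsberg_def slit_region_def by blast
    note curvature = constant_flag_curvature_local[OF assms(1,2) K c, unfolded slit_region_def]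
    show ?thesis
      using cov13_Rhh_eq_0[OF landsberg_constant_curvature[OF landsberg curvature]] z
      unfolding slit_region_def by blast
  qed
  then show ?thesis unfolding symmetric_finsler_def by blast
qed

end
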